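(* Let $(\mathbf p(c))_{c>0}$ be a family of probability measures $\mathbf p(c)=(p_k(c))_{k\ge0}$ on $\mathbb N=\{0,1,2,\dots\}$ such that $\mathbf p(c)$ has mean $c$. Assume that there exist $\alpha>0$ and a function $f:\mathbb N\to\mathbb R$ such that for every $k\in\mathbb N$, as $c\to\infty$, $$\frac{E_{\mathbf p(c)}\left[X(X-1)\cdots(X-k+1)\right]}{c^k}=1+\frac{f(k)}{c^\alpha}+o\left(\frac1{c^\alpha}\right),$$ where under $E_{\mathbf p(c)}$ the random variable $X$ has law $\mathbf p(c)$. Let $\mu(\mathbf p(c))$ be the rescaled expected spectral measure of the unimodular Galton–Watson tree $UGW(\mathbf p(c))$ (defined in the context). Then for every integer $k\ge0$, as $c\to\infty$, $$m_k(\mu(\mathbf p(c)))=m_k\left(\sigma+\frac1{c^\alpha}\,\sigma_f^{\{1\}}+\frac1c\,\sigma^{\{1\}}\right)+o\left(\frac1{c^{\min(1,\alpha)}}\right),$$ where - $\sigma$ is the semi-circle law with density $\frac1{2\pi}\sqrt{4-x^2}\,\mathbf 1_{|x|<2}$; - $\sigma^{\{1\}}$ is the signed measure of total mass $0$ with density $\frac1{2\pi}\frac{x^4-4x^2+2}{\sqrt{4-x^2}}\,\mathbf 1_{|x|<2}$; - $\sigma_f^{\{1\}}$ is a signed measure of total mass $0$, with all odd moments equal to $0$, whose moment generating function is given, as an identity of formal power series, by $$\sum_{k\ge0}m_{2k}\left(\sigma_f^{\{1\}}\right)x^k=\frac{2F(xT(x))}{1-xT(x)^2},$$ where $T(x)=\sum_{k\ge0}\frac{1}{k+1}\binom{2k}{k}x^k$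 is the generating series of the Catalan numbers and $F(x)=\sum_{k\ge0}f(k)x^k$.
   Context: For a (possibly signed) measure $\mu$ on $\mathbb R$ with $\int|x|^k\,|d\mu(x)|<\infty$, $m_k(\mu)=\int x^k\,d\mu(x)$. The unimodular Galton–Watson tree $UGW(\mathbf p(c))$ is the random rooted tree in which the root has a random number of children with law $\mathbf p(c)$, and all other vertices have independent numbers of children with law $\mathbf q(c)$, the size-biased version of $\mathbf p(c)$: $q_k(c)=(k+1)p_{k+1}(c)/c$, $k\ge 0$. (This is the local limit of random graphs from the configuration model with i.i.d. degrees of law $\mathbf p(c)$.) The hypothesis on factorial moments implies in particular that each fixed moment of $\mathbf p(c)$ is finite for $c$ large, so that for $c$ large the variance is finite and the adjacency operator $A$ of $UGW(\mathbf p(c))$ is almost surely essentially self-adjoint (known fact). The measure $\mu(\mathbf p(c))$ is the expectation of the spectral measure at the root vector $e_{\mathrm{root}}$ of the rescaled operator $c^{-1/2}A$. Its odd moments are $0$ and its even moments are $$m_{2k}(\mu(\mathbf p(c)))=c^{-k}\,L_k(UGW(\mathbf p(c))),$$ where $L_k(UGW(\mathbf p(c)))$ is the expected number of closed walks (loops) of length $2k$ started at the root in $UGW(\mathbf p(c))$. *)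

theory Defs
  imports "HOL-Probability.Probability" "HOL-Computational_Algebra.Formal_Power_Series"
    "HOL-Library.Landau_Symbols"
begin

section \<open>Signed measures on the real line and their moments\<close>

text \<open>A finite signed measure is represented by its values on Borel sets; values on other sets
  are irrelevant, so sums and scalar multiples are taken pointwise.\<close>

definition signed_measure :: "(real set \<Rightarrow> real) \<Rightarrow> bool" where
  "signed_measure \<nu> \<longleftrightarrow>
     (\<forall>B :: nat \<Rightarrow> real set. range B \<subseteq> sets borel \<and> disjoint_family B \<longrightarrow>
        (\<lambda>i. \<nu> (B i)) sums \<nu> (\<Union>i. B i))"

text \<open>The integral against a signed measure does not depend on the chosen decomposition into a
  difference of finite positive measures. A decomposition with both parts integrable exists iff
  the Jordan decomposition is one, i.e. iff \<open>x ^ k\<close> is integrable against the total variation.\<close>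

definition has_moment :: "(real set \<Rightarrow> real) \<Rightarrow> nat \<Rightarrow> real \<Rightarrow> bool" where
  "has_moment \<nu> k m \<longleftrightarrow>
     (\<exists>P N. finite_measure P \<and> finite_measure N \<and> sets P = sets borel \<and> sets N = sets borel \<and>
        (\<forall>B\<in>sets borel. \<nu> B = measure P B - measure N B) \<and>
        integrable P (\<lambda>x. x ^ k) \<and> integrable N (\<lambda>x. x ^ k) \<and>
        m = (LINT x|P. x ^ k) - (LINT x|N. x ^ k))"

definition moment :: "(real set \<Rightarrow> real) \<Rightarrow> nat \<Rightarrow> real" where
  "moment \<nu> k = (THE m. has_moment \<nu> k m)"

definition signed_density :: "(real \<Rightarrow> real) \<Rightarrow> real set \<Rightarrow> real" where
  "signed_density g B = (LINT x:B|lborel. g x)"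

definition semicircle :: "real set \<Rightarrow> real" where
  "semicircle = signed_density
     (\<lambda>x. indicator {-2<..<2} x * (1 / (2 * pi) * sqrt (4 - x\<^sup>2)))"

definition sigma1 :: "real set \<Rightarrow> real" where
  "sigma1 = signed_density
     (\<lambda>x. indicator {-2<..<2} x * (1 / (2 * pi) * ((x ^ 4 - 4 * x\<^sup>2 + 2) / sqrt (4 - x\<^sup>2))))"

definition catalan_fps :: "real fps" where
  "catalan_fps = Abs_fps (\<lambda>k. 1 / real (k + 1) * real ((2 * k) choose k))"

text \<open>The conditions determine only the moments of \<open>\<nu>\<close>, not \<open>\<nu>\<close> itself.\<close>

definition is_sigma_f1 :: "(nat \<Rightarrow> real) \<Rightarrow> (real set \<Rightarrow> real) \<Rightarrow> bool" where
  "is_sigma_f1 f \<nu> \<longleftrightarrow>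
     signed_measure \<nu> \<and> \<nu> UNIV = 0 \<and>
     (\<forall>k. \<exists>m. has_moment \<nu> k m) \<and>
     (\<forall>k. odd k \<longrightarrow> moment \<nu> k = 0) \<and>
     Abs_fps (\<lambda>k. moment \<nu> (2 * k)) =
       2 * fps_compose (Abs_fps f) (fps_X * catalan_fps) / (1 - fps_X * catalan_fps\<^sup>2)"

section \<open>Spectral measures of operators on square-summable functions\<close>

text \<open>The Hilbert space over a set \<open>V\<close> consists of the square-summable complex functions that
  vanish outside \<open>V\<close>. Unbounded operators are represented by their graphs.\<close>

definition ell2 :: "'v set \<Rightarrow> ('v \<Rightarrow> complex) set" where
  "ell2 V = {u. (\<forall>v. v \<notin> V \<longrightarrow> u v = 0) \<and> (\<lambda>v. (cmod (u v))\<^sup>2) summable_on UNIV}"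

definition ell2_inner :: "('v \<Rightarrow> complex) \<Rightarrow> ('v \<Rightarrow> complex) \<Rightarrow> complex" where
  "ell2_inner u w = (\<Sum>\<^sub>\<infinity>v. cnj (u v) * w v)"

definition ell2_dist :: "('v \<Rightarrow> complex) \<Rightarrow> ('v \<Rightarrow> complex) \<Rightarrow> real" where
  "ell2_dist u w = sqrt (\<Sum>\<^sub>\<infinity>v. (cmod (u v - w v))\<^sup>2)"

definition operator_closure ::
  "'v set \<Rightarrow> (('v \<Rightarrow> complex) \<times> ('v \<Rightarrow> complex)) set \<Rightarrow> (('v \<Rightarrow> complex) \<times> ('v \<Rightarrow> complex)) set" where
  "operator_closure V G =
     {(u, w). u \<in> ell2 V \<and> w \<in> ell2 V \<and>
        (\<exists>x y. (\<forall>n::nat. (x n, y n) \<in> G) \<and>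
           (\<lambda>n. ell2_dist (x n) u) \<longlonglongrightarrow> 0 \<and> (\<lambda>n. ell2_dist (y n) w) \<longlonglongrightarrow> 0)}"

text \<open>Idempotence and symmetry on the whole Hilbert space make every \<open>E B\<close> an orthogonal
  projection (linearity and boundedness follow).\<close>

definition projection_valued_measure ::
  "'v set \<Rightarrow> (real set \<Rightarrow> ('v \<Rightarrow> complex) \<Rightarrow> ('v \<Rightarrow> complex)) \<Rightarrow> bool" where
  "projection_valued_measure V E \<longleftrightarrow>
     (\<forall>B\<in>sets borel. \<forall>u\<in>ell2 V. E B u \<in> ell2 V \<and> E B (E B u) = E B u) \<and>
     (\<forall>B\<in>sets borel. \<forall>u\<in>ell2 V. \<forall>w\<in>ell2 V. ell2_inner (E B u) w = ell2_inner u (E B w)) \<and>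
     (\<forall>u\<in>ell2 V. E UNIV u = u) \<and>
     (\<forall>B\<in>sets borel. \<forall>C\<in>sets borel. \<forall>u\<in>ell2 V. E (B \<inter> C) u = E B (E C u)) \<and>
     (\<forall>B :: nat \<Rightarrow> real set. range B \<subseteq> sets borel \<and> disjoint_family B \<longrightarrow>
        (\<forall>u\<in>ell2 V. \<forall>w\<in>ell2 V.
           (\<lambda>i. ell2_inner w (E (B i) u)) sums ell2_inner w (E (\<Union>i. B i) u)))"

definition vector_measure ::
  "(real set \<Rightarrow> ('v \<Rightarrow> complex) \<Rightarrow> ('v \<Rightarrow> complex)) \<Rightarrow> ('v \<Rightarrow> complex) \<Rightarrow> real measure" where
  "vector_measure E u =
     measure_of UNIV (sets borel) (\<lambda>B. ennreal (Re (ell2_inner u (E B u))))"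

text \<open>\<open>H\<close> is the spectral integral of the identity function against \<open>E\<close>. For the graph \<open>H\<close> of a
  linear operator the quadratic form identity determines the operator by polarization.\<close>

definition spectral_resolution ::
  "'v set \<Rightarrow> (('v \<Rightarrow> complex) \<times> ('v \<Rightarrow> complex)) set \<Rightarrow>
     (real set \<Rightarrow> ('v \<Rightarrow> complex) \<Rightarrow> ('v \<Rightarrow> complex)) \<Rightarrow> bool" where
  "spectral_resolution V H E \<longleftrightarrow>
     projection_valued_measure V E \<and>
     Domain H = {u \<in> ell2 V. integrable (vector_measure E u) (\<lambda>x. x\<^sup>2)} \<and>
     (\<forall>(u, w)\<in>H. ell2_inner u w = complex_of_real (LINT x|vector_measure E u. x))"

text \<open>The spectral measure at a vector of an essentially self-adjoint operator with graph \<open>G\<close>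
  is that of its closure. Having a spectral resolution forces the closure to be self-adjoint.\<close>

definition is_spectral_measure_at ::
  "'v set \<Rightarrow> (('v \<Rightarrow> complex) \<times> ('v \<Rightarrow> complex)) set \<Rightarrow> ('v \<Rightarrow> complex) \<Rightarrow> real measure \<Rightarrow> bool" where
  "is_spectral_measure_at V G e \<nu> \<longleftrightarrow>
     (\<exists>E. spectral_resolution V (operator_closure V G) E \<and> \<nu> = vector_measure E e)"

section \<open>The unimodular Galton--Watson tree\<close>

text \<open>A rooted tree is encoded by the numbers of children \<open>N v\<close> of all potential vertices \<open>v\<close>.
  The root is \<open>[]\<close> and the children of \<open>v\<close> are \<open>i # v\<close> with \<open>i < N v\<close>.\<close>

fun in_tree :: "(nat list \<Rightarrow> nat) \<Rightarrow> nat list \<Rightarrow> bool" where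
  "in_tree N [] \<longleftrightarrow> True"
| "in_tree N (i # v) \<longleftrightarrow> i < N v \<and> in_tree N v"

definition tree_vertices :: "(nat list \<Rightarrow> nat) \<Rightarrow> nat list set" where
  "tree_vertices N = {v. in_tree N v}"

definition tree_adj :: "(nat list \<Rightarrow> nat) \<Rightarrow> nat list \<Rightarrow> nat list \<Rightarrow> bool" where
  "tree_adj N u v \<longleftrightarrow>
     u \<in> tree_vertices N \<and> v \<in> tree_vertices N \<and> (\<exists>i. u = i # v \<or> v = i # u)"

text \<open>The graph of \<open>s\<close> times the adjacency operator on finitely supported functions.\<close>

definition scaled_adjacency ::
  "real \<Rightarrow> (nat list \<Rightarrow> nat) \<Rightarrow> ((nat list \<Rightarrow> complex) \<times> (nat list \<Rightarrow> complex)) set" where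
  "scaled_adjacency s N =
     {(u, \<lambda>v. complex_of_real s * (\<Sum>w | tree_adj N v w. u w)) | u.
        finite {v. u v \<noteq> 0} \<and> {v. u v \<noteq> 0} \<subseteq> tree_vertices N}"

definition root_vector :: "nat list \<Rightarrow> complex" where
  "root_vector v = (if v = [] then 1 else 0)"

definition pmf_mean :: "nat pmf \<Rightarrow> real" where
  "pmf_mean p = measure_pmf.expectation p real"

definition size_biased :: "nat pmf \<Rightarrow> nat pmf" where
  "size_biased p = embed_pmf (\<lambda>k. real (k + 1) * pmf p (k + 1) / pmf_mean p)"

definition UGW :: "nat pmf \<Rightarrow> (nat list \<Rightarrow> nat) measure" where
  "UGW p = PiM UNIV (\<lambda>v. measure_pmf (if v = [] then p else size_biased p))"

text \<open>\<open>\<mu>\<close> is the expectation (Giry monad bind) of the random spectral measure at the root.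
  The measurable kernel \<open>\<nu>\<close> needs to be the spectral measure only almost surely, as the
  adjacency operator is only almost surely essentially self-adjoint.\<close>

definition is_UGW_spectral_measure :: "nat pmf \<Rightarrow> real measure \<Rightarrow> bool" where
  "is_UGW_spectral_measure p \<mu> \<longleftrightarrow>
     (\<exists>\<nu>. \<nu> \<in> UGW p \<rightarrow>\<^sub>M prob_algebra borel \<and>
        (AE N in UGW p. is_spectral_measure_at (tree_vertices N)
           (scaled_adjacency (pmf_mean p powr (-1/2)) N) root_vector (\<nu> N)) \<and>
        \<mu> = UGW p \<bind> \<nu>)"

end

theory Submission imports Defs begin

text \<open>The moment \<open>m\<^sub>2\<^sub>k\<close> is \<open>c\<^sup>-\<^sup>k\<close> times the expected number of closed walks of length \<open>2k\<close> at the root.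
  Writing \<open>W\<close> for the generating series of these walks and \<open>W\<^sub>i\<close> for that of the subtree at the
  \<open>i\<close>-th child, decomposition at the returns to the root gives
  \<open>W = \<Sum>\<^sub>r x\<^sup>r (\<Sum>\<^sub>i W\<^sub>i)\<^sup>r\<close>, where the \<open>W\<^sub>i\<close> are i.i.d. Expanding the \<open>r\<close>-th power and grouping the
  factors by the child they belong to, a partition of the factors into \<open>j\<close> blocks contributes the
  \<open>j\<close>-th factorial moment of the offspring law. After rescaling it has weight \<open>c\<^sup>j\<^sup>-\<^sup>r\<close>, so to first order only
  \<open>j = r\<close> and \<open>j = r - 1\<close> matter. This gives linear equations for the coefficients of \<open>1 / c powr \<alpha>\<close> and
  \<open>1 / c\<close>, which are solved with \<open>T = 1 + x T\<^sup>2\<close>.\<close>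

section \<open>Signed measures and their moments\<close>

text \<open>Two factors at the same child are dependent, so the recursion does not close on
  expectations of single walk counts: it needs all joint moments of counts in one tree, indexed by
  lists. What keeps the first order computable is that blocks with several factors carry a factor
  1/c at least, so their joint moments enter only through the limits, products of Catalan numbers;
  first-order expansions are required for one-entry lists alone. Since the root has law p and the
  others its size-biased law, the factorial moments at the root and below are shifted by one index,
  which is why f r and f (r + 1) appear in two different equations. Moments are known to be finite
  only for large c, hence the expectations are computed in \<open>ennreal\<close> first. Two
  statements lie outside this calculus. The spectral measure is given by quadratic forms of a closed
  operator, and its moments are extracted by polarization: the measure at Hu is x^2 times the
  measure at u. The series attached to an arbitrary f satisfies no positivity or growth condition,
  so a signed measure with these moments is assembled from dilated finite-difference
  functionals.\<close>

lemma simple_integral_combination_eq_0: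
  fixes I :: "'i set" and M :: "'i \<Rightarrow> 'a measure" and c :: "'i \<Rightarrow> real" and g :: "'a \<Rightarrow> real"
  assumes I: "finite I" and fin: "\<And>i. i \<in> I \<Longrightarrow> finite_measure (M i)"
    and sets: "\<And>i. i \<in> I \<Longrightarrow> sets (M i) = sets N"
    and zero: "\<And>B. B \<in> sets N \<Longrightarrow> (\<Sum>i\<in>I. c i * measure (M i) B) = 0"
    and g: "simple_function N g"
  shows "(\<Sum>i\<in>I. c i * (LINT x|M i. g x)) = 0"
proof -
  have g_eq: "g x = (\<Sum>y\<in>g ` space N. y * indicator (g -` {y} \<inter> space N) x)" if "x \<in> space N" for x
  proof -
    have "(\<Sum>y\<in>g ` space N. y * indicator (g -` {y} \<inter> space N) x)
        = (\<Sum>y\<in>g ` space N. if y = g x then y else 0)"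
      using that by (intro sum.cong) (auto simp: indicator_def)
    also have "\<dots> = g x"
      using g that by (simp add: simple_function_def)
    finally show ?thesis by simp
  qed
  have meas: "g -` {y} \<inter> space N \<in> sets N" if "y \<in> g ` space N" for y
    using g that by (auto simp: simple_function_def)
  have "(LINT x|M i. g x) = (\<Sum>y\<in>g ` space N. y * measure (M i) (g -` {y} \<inter> space N))" if i: "i \<in> I" for i
  proof -
    interpret finite_measure "M i" by (rule fin[OF i])
    have sp: "space (M i) = space N" using sets[OF i] by (rule sets_eq_imp_space_eq)
    have "(LINT x|M i. g x) = (LINT x|M i. (\<Sum>y\<in>g ` space N. y * indicator (g -` {y} \<inter> space N) x))"
      by (rule Bochner_Integration.integral_cong[OF refl g_eq]) (simp add: sp)
    also have "\<dots> = (\<Sum>y\<in>g ` space N. LINT x|M i. y * indicator (g -` {y} \<inter> space N) x)"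
      using meas sets[OF i]
      by (intro Bochner_Integration.integral_sum integrable_mult_right integrable_real_indicator)
        (auto simp: emeasure_eq_measure)
    also have "\<dots> = (\<Sum>y\<in>g ` space N. y * measure (M i) (g -` {y} \<inter> space N))"
      using meas sets[OF i] by (intro sum.cong) (auto simp: sp)
    finally show ?thesis .
  qed
  then have "(\<Sum>i\<in>I. c i * (LINT x|M i. g x)) =
      (\<Sum>i\<in>I. \<Sum>y\<in>g ` space N. y * (c i * measure (M i) (g -` {y} \<inter> space N)))"
    by (simp add: sum_distrib_left mult_ac)
  also have "\<dots> = (\<Sum>y\<in>g ` space N. y * (\<Sum>i\<in>I. c i * measure (M i) (g -` {y} \<inter> space N)))"
    by (subst sum.swap) (simp add: sum_distrib_left)
  also have "\<dots> = 0"
    by (intro sum.neutral ballI) (simp add: zero meas)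
  finally show ?thesis .
qed

text \<open>A linear relation between finite measures passes to simple functions and then, by
  dominated convergence with bound 2 |g|, to every function integrable for all of them. Signs in the
  coefficients stand for differences of measures, so one lemma serves uniqueness of moments,
  additivity and the comparison of spectral measures.\<close>

lemma integral_combination_eq_0:
  fixes I :: "'i set" and M :: "'i \<Rightarrow> 'a measure" and c :: "'i \<Rightarrow> real" and g :: "'a \<Rightarrow> real"
  assumes I: "finite I" and fin: "\<And>i. i \<in> I \<Longrightarrow> finite_measure (M i)"
    and sets: "\<And>i. i \<in> I \<Longrightarrow> sets (M i) = sets N"
    and zero: "\<And>B. B \<in> sets N \<Longrightarrow> (\<Sum>i\<in>I. c i * measure (M i) B) = 0"
    and g: "\<And>i. i \<in> I \<Longrightarrow> integrable (M i) g"
  shows "(\<Sum>i\<in>I. c i * (LINT x|M i. g x)) = 0"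
proof (cases "I = {}")
  case False
  then obtain i0 where i0: "i0 \<in> I" by auto
  have "g \<in> borel_measurable N"
    using borel_measurable_integrable[OF g[OF i0]] sets[OF i0] by (simp cong: measurable_cong_sets)
  then obtain s where s: "\<And>n. simple_function N (s n)"
      "\<And>x. x \<in> space N \<Longrightarrow> (\<lambda>n. s n x) \<longlonglongrightarrow> g x"
      "\<And>n x. x \<in> space N \<Longrightarrow> norm (s n x) \<le> 2 * norm (g x)"
    using borel_measurable_implies_sequence_metric[of g N 0] by (simp add: dist_norm) blast
  have "(\<lambda>n. LINT x|M i. s n x) \<longlonglongrightarrow> (LINT x|M i. g x)" if i: "i \<in> I" for i
  proof (rule integral_dominated_convergence[where w = "\<lambda>x. 2 * norm (g x)"])
    have sp: "space (M i) = space N" using sets[OF i] by (rule sets_eq_imp_space_eq)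
    show "g \<in> borel_measurable (M i)" using g[OF i] by auto
    show "s n \<in> borel_measurable (M i)" for n
      using borel_measurable_simple_function[OF s(1)[of n]] sets[OF i] by (simp cong: measurable_cong_sets)
    show "integrable (M i) (\<lambda>x. 2 * norm (g x))" using g[OF i] by auto
    show "AE x in M i. (\<lambda>n. s n x) \<longlonglongrightarrow> g x" using s(2) sp by auto
    show "AE x in M i. norm (s n x) \<le> 2 * norm (g x)" for n using s(3) sp by auto
  qed
  then have "(\<lambda>n. \<Sum>i\<in>I. c i * (LINT x|M i. s n x)) \<longlonglongrightarrow> (\<Sum>i\<in>I. c i * (LINT x|M i. g x))"
    by (intro tendsto_sum tendsto_mult_left)
  moreover have "(\<Sum>i\<in>I. c i * (LINT x|M i. s n x)) = 0" for n
    by (rule simple_integral_combination_eq_0[OF I fin sets zero s(1)])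
  ultimately show ?thesis
    by (simp add: LIMSEQ_const_iff)
qed simp

text \<open>Two decompositions of the same signed measure give P - N - P' + N' = 0 on Borel sets,
  whence the coefficients 1, -1, -1, 1. This justifies the definite description in
  \<open>moment\<close>.\<close>

lemma has_moment_unique:
  assumes "has_moment \<nu> k m" "has_moment \<nu> k m'"
  shows "m = m'"
proof -
  obtain P N where 1: "finite_measure P" "finite_measure N" "sets P = sets borel" "sets N = sets borel"
    "\<forall>B\<in>sets borel. \<nu> B = measure P B - measure N B"
    "integrable P (\<lambda>x. x ^ k)" "integrable N (\<lambda>x. x ^ k)" "m = (LINT x|P. x ^ k) - (LINT x|N. x ^ k)"
    using assms(1) unfolding has_moment_def by blast
  obtain P' N' where 2: "finite_measure P'" "finite_measure N'" "sets P' = sets borel" "sets N' = sets borel"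
    "\<forall>B\<in>sets borel. \<nu> B = measure P' B - measure N' B"
    "integrable P' (\<lambda>x. x ^ k)" "integrable N' (\<lambda>x. x ^ k)" "m' = (LINT x|P'. x ^ k) - (LINT x|N'. x ^ k)"
    using assms(2) unfolding has_moment_def by blast
  let ?M = "[P,N,P',N']"
  have "(\<Sum>i\<in>{..<4::nat}. ([1,-1,-1,1] ! i) * (LINT x|(?M ! i). x ^ k)) = 0"
  proof (rule integral_combination_eq_0[where N = borel])
    fix i :: nat assume "i \<in> {..<4}"
    then have "i = 0 \<or> i = 1 \<or> i = 2 \<or> i = 3" by auto
    then show "finite_measure (?M ! i)" "sets (?M ! i) = sets borel"
      "integrable (?M ! i) (\<lambda>x. x ^ k)"
      using 1 2 by auto
  next
    fix B :: "real set" assume "B \<in> sets borel"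
    then have "measure P B - measure N B = measure P' B - measure N' B" using 1 2 by force
    then show "(\<Sum>i\<in>{..<4::nat}. ([1,-1,-1,1] ! i) * measure (?M ! i) B) = 0"
      by (simp add: eval_nat_numeral lessThan_Suc)
  qed simp
  then show ?thesis using 1 2 by (simp add: eval_nat_numeral lessThan_Suc)
qed

lemma moment_eqI: "has_moment \<nu> k m \<Longrightarrow> moment \<nu> k = m"
  unfolding moment_def using has_moment_unique by blast

text \<open>Supplies the decomposition (P + P') - (N + N') of a sum of two signed measures.\<close>

definition plus_measure :: "'a measure \<Rightarrow> 'a measure \<Rightarrow> 'a measure" where
  "plus_measure P Q = measure_of (space P) (sets P) (\<lambda>B. emeasure P B + emeasure Q B)"

lemma sets_plus_measure [simp, measurable_cong]: "sets (plus_measure P Q) = sets P"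
  by (simp add: plus_measure_def)

lemma emeasure_plus_measure:
  assumes "sets Q = sets P" "B \<in> sets P"
  shows "emeasure (plus_measure P Q) B = emeasure P B + emeasure Q B"
  unfolding plus_measure_def
proof (rule emeasure_measure_of_sigma)
  show "sigma_algebra (space P) (sets P)" by (rule sets.sigma_algebra_axioms)
  show "positive (sets P) (\<lambda>B. emeasure P B + emeasure Q B)" by (simp add: positive_def)
  show "countably_additive (sets P) (\<lambda>B. emeasure P B + emeasure Q B)"
  proof (rule countably_additiveI)
    fix A :: "nat \<Rightarrow> 'a set" assume A: "range A \<subseteq> sets P" "disjoint_family A"
    have "(\<Sum>i. emeasure P (A i) + emeasure Q (A i)) = (\<Sum>i. emeasure P (A i)) + (\<Sum>i. emeasure Q (A i))"
      by (intro suminf_add[symmetric]) auto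
    also have "\<dots> = emeasure P (\<Union>i. A i) + emeasure Q (\<Union>i. A i)"
      using A assms by (simp add: suminf_emeasure)
    finally show "(\<Sum>i. emeasure P (A i) + emeasure Q (A i)) = emeasure P (\<Union>i. A i) + emeasure Q (\<Union>i. A i)" .
  qed
qed (use assms in auto)

lemma nn_integral_plus_measure:
  assumes Q: "sets Q = sets P" and g: "g \<in> borel_measurable P"
  shows "(\<integral>\<^sup>+x. g x \<partial>plus_measure P Q) = (\<integral>\<^sup>+x. g x \<partial>P) + (\<integral>\<^sup>+x. g x \<partial>Q)"
proof -
  have sp: "space (plus_measure P Q) = space P" "space Q = space P"
    using sets_eq_imp_space_eq[OF Q] by (simp_all add: plus_measure_def)
  have m: "h \<in> borel_measurable (plus_measure P Q)" "h \<in> borel_measurable Q"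
    if "h \<in> borel_measurable P" for h :: "'a \<Rightarrow> ennreal"
    using that measurable_cong_sets[OF sets_plus_measure refl] measurable_cong_sets[OF Q refl] by blast+
  show ?thesis
    using g
  proof (induction g rule: borel_measurable_induct)
    case (cong f g)
    then have "integral\<^sup>N M f = integral\<^sup>N M g" if "space M = space P" for M
      using that by (intro nn_integral_cong) auto
    then show ?case
      using cong.IH sp by presburger
  next
    case (set A)
    then show ?case using Q by (simp add: emeasure_plus_measure)
  next
    case (mult u c)
    then show ?case by (simp add: nn_integral_cmult m distrib_left)
  next
    case (add u v)
    then show ?case by (simp add: nn_integral_add m ac_simps)
  next
    case (seq U)
    have "incseq (\<lambda>i. \<integral>\<^sup>+x. U i x \<partial>P)" "incseq (\<lambda>i. \<integral>\<^sup>+x. U i x \<partial>Q)"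
      using seq by (auto intro!: nn_integral_mono simp: incseq_def le_fun_def)
    then have s: "(SUP i. (\<integral>\<^sup>+x. U i x \<partial>P) + (\<integral>\<^sup>+x. U i x \<partial>Q)) = (SUP i. \<integral>\<^sup>+x. U i x \<partial>P) + (SUP i. \<integral>\<^sup>+x. U i x \<partial>Q)"
      by (rule ennreal_SUP_add)
    have e: "(\<integral>\<^sup>+x. (SUP i. U i) x \<partial>M) = (SUP i. \<integral>\<^sup>+x. U i x \<partial>M)"
      if "\<And>i. U i \<in> borel_measurable M" for M :: "'a measure"
      using seq that by (simp add: nn_integral_monotone_convergence_SUP image_comp)
    show ?case
      using s seq.IH seq.hyps(1) by (simp only: e m)
  qed
qed

lemma has_moment_add:
  assumes "has_moment \<nu> k m" "has_moment \<nu>' k m'"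
  shows "has_moment (\<lambda>B. \<nu> B + \<nu>' B) k (m + m')"
proof -
  have *: "finite_measure (plus_measure P P') \<and> (\<forall>B\<in>sets borel. measure (plus_measure P P') B = measure P B + measure P' B)
     \<and> integrable (plus_measure P P') (\<lambda>x. x ^ k) \<and>
      (LINT x|plus_measure P P'. x ^ k) = (LINT x|P. x ^ k) + (LINT x|P'. x ^ k)"
    if P: "finite_measure P" "finite_measure P'" "sets P = sets borel" "sets P' = sets borel"
      "integrable P (\<lambda>x. x ^ k)" "integrable P' (\<lambda>x. x ^ k)" for P P' :: "real measure"
  proof -
    have em: "emeasure (plus_measure P P') B = emeasure P B + emeasure P' B" if "B \<in> sets borel" for B
      using P that by (intro emeasure_plus_measure) auto
    have sp: "space P = UNIV" "space P' = UNIV" "space (plus_measure P P') = UNIV"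
      using P(3,4)[THEN sets_eq_imp_space_eq] by (simp_all add: plus_measure_def)
    have fin: "finite_measure (plus_measure P P')"
      using em[of UNIV] finite_measure.emeasure_finite[OF P(1), of UNIV] finite_measure.emeasure_finite[OF P(2), of UNIV]
      by (intro finite_measureI) (simp add: sp)
    have me: "measure (plus_measure P P') B = measure P B + measure P' B" if "B \<in> sets borel" for B
      using em[OF that] finite_measure.emeasure_finite[OF P(1), of B] finite_measure.emeasure_finite[OF P(2), of B]
      by (simp add: measure_def enn2real_plus top.not_eq_extremum)
    have int: "integrable (plus_measure P P') (\<lambda>x. x ^ k)"
    proof (rule integrableI_bounded)
      show "(\<lambda>x. x ^ k) \<in> borel_measurable (plus_measure P P')"
        using P by (simp cong: measurable_cong_sets)
      have "(\<integral>\<^sup>+x. ennreal (norm (x ^ k)) \<partial>plus_measure P P') =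
        (\<integral>\<^sup>+x. ennreal (norm (x ^ k)) \<partial>P) + (\<integral>\<^sup>+x. ennreal (norm (x ^ k)) \<partial>P')"
        using P by (intro nn_integral_plus_measure) (auto cong: measurable_cong_sets)
      also have "\<dots> < \<infinity>"
        using P(5,6) by (simp add: integrable_iff_bounded)
      finally show "(\<integral>\<^sup>+x. ennreal (norm (x ^ k)) \<partial>plus_measure P P') < \<infinity>" .
    qed
    \<comment> \<open>Once the sum measure is known to integrate x^k, its integral is read off from
      the relation sum - P - P' = 0.\<close>
    let ?M = "[plus_measure P P',P,P']"
    have "(\<Sum>i\<in>{..<3::nat}. ([1,-1,-1] ! i) * (LINT x|(?M ! i). x ^ k)) = 0"
    proof (rule integral_combination_eq_0[where N = borel])
      fix i :: nat assume "i \<in> {..<3}"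
      then have "i = 0 \<or> i = 1 \<or> i = 2" by auto
      then show "finite_measure (?M ! i)" "sets (?M ! i) = sets borel"
        "integrable (?M ! i) (\<lambda>x. x ^ k)"
        using P fin int by (elim disjE; simp)+
    next
      fix B :: "real set" assume "B \<in> sets borel"
      then show "(\<Sum>i\<in>{..<3::nat}. ([1,-1,-1] ! i) * measure (?M ! i) B) = 0"
        using me by (simp add: eval_nat_numeral lessThan_Suc)
    qed simp
    then show ?thesis using fin me int by (simp add: eval_nat_numeral lessThan_Suc)
  qed
  obtain P N where 1: "finite_measure P" "finite_measure N" "sets P = sets borel" "sets N = sets borel"
    "\<forall>B\<in>sets borel. \<nu> B = measure P B - measure N B"
    "integrable P (\<lambda>x. x ^ k)" "integrable N (\<lambda>x. x ^ k)" "m = (LINT x|P. x ^ k) - (LINT x|N. x ^ k)"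
    using assms(1) unfolding has_moment_def by blast
  obtain P' N' where 2: "finite_measure P'" "finite_measure N'" "sets P' = sets borel" "sets N' = sets borel"
    "\<forall>B\<in>sets borel. \<nu>' B = measure P' B - measure N' B"
    "integrable P' (\<lambda>x. x ^ k)" "integrable N' (\<lambda>x. x ^ k)" "m' = (LINT x|P'. x ^ k) - (LINT x|N'. x ^ k)"
    using assms(2) unfolding has_moment_def by blast
  show ?thesis
    unfolding has_moment_def
    using *[OF 1(1) 2(1) 1(3) 2(3) 1(6) 2(6)] *[OF 1(2) 2(2) 1(4) 2(4) 1(7) 2(7)] 1 2
    by (intro exI[of _ "plus_measure P P'"] exI[of _ "plus_measure N N'"]) simp
qed

text \<open>A nonnegative factor leaves the two parts of the decomposition in their roles, so both
  are merely given a constant density.\<close>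

lemma has_moment_scale:
  assumes "has_moment \<nu> k m" "a \<ge> 0"
  shows "has_moment (\<lambda>B. a * \<nu> B) k (a * m)"
proof -
  have *: "finite_measure (density P (\<lambda>_. ennreal a)) \<and>
     (\<forall>B\<in>sets borel. measure (density P (\<lambda>_. ennreal a)) B = a * measure P B)
     \<and> integrable (density P (\<lambda>_. ennreal a)) (\<lambda>x. x ^ k) \<and>
      (LINT x|density P (\<lambda>_. ennreal a). x ^ k) = a * (LINT x|P. x ^ k)"
    if P: "finite_measure P" "sets P = sets borel" "integrable P (\<lambda>x. x ^ k)" for P :: "real measure"
  proof -
    interpret finite_measure P by fact
    have em: "emeasure (density P (\<lambda>_. ennreal a)) B = ennreal (a * measure P B)" if "B \<in> sets P" for B
      using that \<open>a \<ge> 0\<close> by (simp add: emeasure_density_const emeasure_eq_measure ennreal_mult)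
    have "finite_measure (density P (\<lambda>_. ennreal a))"
      using em[OF sets.top] by (intro finite_measureI) simp
    moreover have "measure (density P (\<lambda>_. ennreal a)) B = a * measure P B" if "B \<in> sets P" for B
      using em[OF that] \<open>a \<ge> 0\<close> by (simp add: measure_def)
    moreover have "integrable (density P (\<lambda>_. ennreal a)) (\<lambda>x. x ^ k)"
      using P \<open>a \<ge> 0\<close> by (subst integrable_density) (auto cong: measurable_cong_sets)
    moreover have "(LINT x|density P (\<lambda>_. ennreal a). x ^ k) = a * (LINT x|P. x ^ k)"
      using P \<open>a \<ge> 0\<close> by (subst integral_density) (auto cong: measurable_cong_sets)
    ultimately show ?thesis using P by auto
  qed
  obtain P N where 1: "finite_measure P" "finite_measure N" "sets P = sets borel" "sets N = sets borel"
    "\<forall>B\<in>sets borel. \<nu> B = measure P B - measure N B"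
    "integrable P (\<lambda>x. x ^ k)" "integrable N (\<lambda>x. x ^ k)" "m = (LINT x|P. x ^ k) - (LINT x|N. x ^ k)"
    using assms(1) unfolding has_moment_def by blast
  show ?thesis
    unfolding has_moment_def
    using *[OF 1(1) 1(3) 1(6)] *[OF 1(2) 1(4) 1(7)] 1
    by (intro exI[of _ "density P (\<lambda>_. ennreal a)"] exI[of _ "density N (\<lambda>_. ennreal a)"])
      (simp add: right_diff_distrib)
qed

text \<open>The positive and negative parts of g are densities of two finite measures; both are
  bounded by |g|, so integrability of x^k g carries over to them.\<close>

lemma has_moment_density:
  assumes g: "integrable lborel g" and gk: "integrable lborel (\<lambda>x. x ^ k * g x)"
  shows "has_moment (signed_density g) k (LINT x|lborel. x ^ k * g x)"
proof -
  have [measurable]: "g \<in> borel_measurable borel" using g by auto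
  have *: "finite_measure (density lborel (\<lambda>x. ennreal (h x))) \<and>
     (\<forall>B\<in>sets borel. measure (density lborel (\<lambda>x. ennreal (h x))) B = (LINT x:B|lborel. h x))
     \<and> integrable (density lborel (\<lambda>x. ennreal (h x))) (\<lambda>x. x ^ k) \<and>
      (LINT x|density lborel (\<lambda>x. ennreal (h x)). x ^ k) = (LINT x|lborel. x ^ k * h x)"
    if h: "integrable lborel h" "integrable lborel (\<lambda>x. x ^ k * h x)" "\<And>x. h x \<ge> 0" for h
  proof -
    have [measurable]: "h \<in> borel_measurable borel" using h by auto
    have em: "emeasure (density lborel (\<lambda>x. ennreal (h x))) B = ennreal (LINT x:B|lborel. h x)"
      if [measurable]: "B \<in> sets borel" for B
    proof -
      have "integrable lborel (\<lambda>x. indicator B x *\<^sub>R h x)"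
        using h that by (intro integrable_mult_indicator) auto
      then have "(\<integral>\<^sup>+x. ennreal (indicator B x * h x) \<partial>lborel) = ennreal (LINT x:B|lborel. h x)"
        unfolding set_lebesgue_integral_def using h by (subst nn_integral_eq_integral) auto
      moreover have "ennreal (h x) * indicator B x = ennreal (indicator B x * h x)" for x
        by (simp add: indicator_def)
      ultimately show ?thesis by (simp add: emeasure_density)
    qed
    have nn: "(LINT x:B|lborel. h x) \<ge> 0" for B
      unfolding set_lebesgue_integral_def using h by (intro integral_nonneg_AE) auto
    have "finite_measure (density lborel (\<lambda>x. ennreal (h x)))"
      using em[of UNIV] by (intro finite_measureI) simp
    then show ?thesis
      using em nn h by (auto simp: measure_def integrable_density integral_density mult.commute)
  qed
  have p: "integrable lborel (\<lambda>x. max 0 (g x))" "integrable lborel (\<lambda>x. max 0 (- g x))"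
    using g by auto
  have ind: "integrable lborel (\<lambda>x. x ^ k * max 0 (g x))"
    by (rule Bochner_Integration.integrable_bound[OF gk])
      (auto simp: abs_mult intro!: AE_I2 mult_left_mono)
  have ind': "integrable lborel (\<lambda>x. x ^ k * max 0 (- g x))"
    by (rule Bochner_Integration.integrable_bound[OF gk])
      (auto simp: abs_mult intro!: AE_I2 mult_left_mono)
  have dec: "g x = max 0 (g x) - max 0 (- g x)" for x by auto
  have s: "signed_density g B = (LINT x:B|lborel. max 0 (g x)) - (LINT x:B|lborel. max 0 (- g x))"
    if "B \<in> sets borel" for B
    unfolding signed_density_def
  proof (subst set_integral_diff(2)[symmetric])
    show "set_integrable lborel B (\<lambda>x. max 0 (g x))" "set_integrable lborel B (\<lambda>x. max 0 (- g x))"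
      unfolding set_integrable_def using p that by (intro integrable_mult_indicator; simp)+
  qed (simp add: dec[symmetric])
  have m: "(LINT x|lborel. x ^ k * g x) =
     (LINT x|lborel. x ^ k * max 0 (g x)) - (LINT x|lborel. x ^ k * max 0 (- g x))"
    using ind ind' by (subst Bochner_Integration.integral_diff[symmetric])
      (auto simp: right_diff_distrib[symmetric] dec[symmetric])
  show ?thesis
    unfolding has_moment_def
    using *[OF p(1) ind] *[OF p(2) ind'] s m
    by (intro exI[of _ "density lborel (\<lambda>x. ennreal (max 0 (g x)))"]
      exI[of _ "density lborel (\<lambda>x. ennreal (max 0 (- g x)))"]) simp
qed

section \<open>The semicircle law and its correction\<close>

text \<open>Two applications of the absorption identity around the symmetry of row 2k + 1. This
  recurrence drives the arcsine moments as well as the differential equation of the central binomial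
  series.\<close>

lemma central_binomial_Suc:
  "real (Suc k) * real ((2 * Suc k) choose (Suc k)) = 2 * (2 * real k + 1) * real ((2 * k) choose k)"
proof -
  have "Suc k * ((2 * Suc k) choose (Suc k)) = 2 * (Suc k * ((2*k+1) choose k))"
    using Suc_times_binomial_eq[of "2*k+1" k] by (simp add: algebra_simps)
  also have "Suc k * ((2*k+1) choose k) = Suc k * ((2*k+1) choose (Suc k))"
    using binomial_symmetric[of k "2*k+1"] by simp
  also have "\<dots> = (2*k+1) * ((2*k) choose k)"
    using Suc_times_binomial_eq[of "2*k" k] by (simp add: algebra_simps)
  finally have "Suc k * ((2 * Suc k) choose (Suc k)) = 2 * ((2*k+1) * ((2*k) choose k))" .
  then show ?thesis by (metis (mono_tags, lifting) of_nat_1 of_nat_add of_nat_mult of_nat_numeral mult.assoc)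
qed

text \<open>Written over the common denominator sqrt (4 - x^2), the derivative links the arcsine
  integrals of x^(n-1) and x^(n+1); this is the integration by parts behind their
  recurrence.\<close>

lemma sqrt_deriv:
  assumes "-2 < x" "x < 2"
  shows "((\<lambda>x. x ^ n * sqrt (4 - x\<^sup>2)) has_real_derivative
      (4 * real n * x ^ (n - 1) - (real n + 1) * x ^ (n + 1)) / sqrt (4 - x\<^sup>2)) (at x)"
proof -
  have "\<bar>x\<bar> < 2" using assms by auto
  then have pos: "4 - x\<^sup>2 > 0" using power_strict_mono[of "\<bar>x\<bar>" 2 2] by simp
  have sq: "sqrt (4 - x\<^sup>2) * sqrt (4 - x\<^sup>2) = 4 - x\<^sup>2" using pos by simp
  have x1: "real n * x ^ (n - 1) * x\<^sup>2 = real n * x ^ (n + 1)"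
    by (cases n) (auto simp: power2_eq_square)
  have "((\<lambda>x. x ^ n * sqrt (4 - x\<^sup>2)) has_real_derivative
      (real n * x ^ (n - 1) * sqrt (4 - x\<^sup>2) + x ^ n * (- (2 * x) * (inverse (sqrt (4 - x\<^sup>2)) / 2)))) (at x)"
    using pos by (auto intro!: derivative_eq_intros simp: power2_eq_square)
  also have "real n * x ^ (n - 1) * sqrt (4 - x\<^sup>2) + x ^ n * (- (2 * x) * (inverse (sqrt (4 - x\<^sup>2)) / 2)) =
      (4 * real n * x ^ (n - 1) - (real n + 1) * x ^ (n + 1)) / sqrt (4 - x\<^sup>2)"
    using pos by (cases n) (simp_all add: field_simps sq power2_eq_square)
  finally show ?thesis .
qed

text \<open>Moments of the arcsine law on (-2, 2), unnormalized: the density 1 / sqrt (4 - x^2) has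
  mass pi.\<close>

definition arc_moment :: "nat \<Rightarrow> real" where
  "arc_moment n = (if even n then pi * real (n choose (n div 2)) else 0)"

text \<open>Induction in steps of two, with arcsin (x / 2) and - sqrt (4 - x^2) as antiderivatives
  in the base cases. The integrands can be unbounded at the endpoints, so the interior version of
  the fundamental theorem is applied to antiderivatives continuous on the closed interval.\<close>

lemma arc_has_integral:
  "((\<lambda>x. x ^ n / sqrt (4 - x\<^sup>2)) has_integral arc_moment n) {-2..2}"
proof (induction n rule: nat_less_induct)
  case (1 n)
  consider "n = 0" | "n = 1" | m where "n = m + 2"
    by (metis One_nat_def Suc_eq_plus1 add_2_eq_Suc' not0_implies_Suc)
  then show ?case
  proof cases
    case 1
    have d: "((\<lambda>x. arcsin (x / 2)) has_real_derivative 1 / sqrt (4 - x\<^sup>2)) (at x)" if "x \<in> {-2<..<2}" for x :: real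
    proof -
      have "\<bar>x\<bar> < 2" using that by auto
      then have pos: "4 - x\<^sup>2 > 0" using power_strict_mono[of "\<bar>x\<bar>" 2 2] by simp
      have "sqrt (1 - (x/2)\<^sup>2) = sqrt ((4 - x\<^sup>2) / 4)" by (simp add: field_simps)
      also have "\<dots> = sqrt (4 - x\<^sup>2) / 2" by (simp add: real_sqrt_divide)
      finally have s: "sqrt (1 - (x/2)\<^sup>2) = sqrt (4 - x\<^sup>2) / 2" .
      show ?thesis
        using that pos s by (auto intro!: derivative_eq_intros simp: field_simps)
    qed
    have "((\<lambda>x. 1 / sqrt (4 - x\<^sup>2)) has_integral arcsin (2/2) - arcsin (-2/2)) {-2..2}"
    proof (rule fundamental_theorem_of_calculus_interior)
      show "continuous_on {-2..2} (\<lambda>x::real. arcsin (x / 2))"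
        by (intro continuous_intros) auto
    qed (use d in \<open>auto simp: has_real_derivative_iff_has_vector_derivative\<close>)
    then show ?thesis using 1 by (simp add: arc_moment_def)
  next
    case 2
    have "((\<lambda>x. x / sqrt (4 - x\<^sup>2)) has_integral (- sqrt (4 - 2\<^sup>2)) - (- sqrt (4 - (-2)\<^sup>2))) {-2..2}"
    proof (rule fundamental_theorem_of_calculus_interior)
      fix x :: real assume x: "x \<in> {-2<..<2}"
      show "((\<lambda>x. - sqrt (4 - x\<^sup>2)) has_vector_derivative x / sqrt (4 - x\<^sup>2)) (at x)"
        using DERIV_minus[OF sqrt_deriv[of x 0]] x by (simp add: has_real_derivative_iff_has_vector_derivative)
    qed (auto intro!: continuous_intros)
    then show ?thesis using 2 by (simp add: arc_moment_def)
  next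
    case (3 m)
    \<comment> \<open>The antiderivative x^(m+1) sqrt (4 - x^2) vanishes at both endpoints, so the
      integrals of order m and m + 2 are proportional.\<close>
    have "((\<lambda>x. (4 * real (m + 1) * x ^ m - (real (m + 1) + 1) * x ^ (m + 2)) / sqrt (4 - x\<^sup>2)) has_integral
        (2 ^ (m + 1) * sqrt (4 - 2\<^sup>2)) - ((-2) ^ (m + 1) * sqrt (4 - (-2)\<^sup>2))) {-2..2}"
    proof (rule fundamental_theorem_of_calculus_interior)
      fix x :: real assume x: "x \<in> {-2<..<2}"
      show "((\<lambda>x. x ^ (m + 1) * sqrt (4 - x\<^sup>2)) has_vector_derivative
         (4 * real (m + 1) * x ^ m - (real (m + 1) + 1) * x ^ (m + 2)) / sqrt (4 - x\<^sup>2)) (at x)"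
        using sqrt_deriv[of x "m + 1"] x by (simp add: has_real_derivative_iff_has_vector_derivative)
    qed (auto intro!: continuous_intros)
    moreover have "((\<lambda>x. x ^ m / sqrt (4 - x\<^sup>2)) has_integral arc_moment m) {-2..2}"
      using "1.IH" 3 by auto
    ultimately have "((\<lambda>x. (4 * real (m + 1) / (real m + 2)) * (x ^ m / sqrt (4 - x\<^sup>2)) - (1 / (real m + 2)) *
        ((4 * real (m + 1) * x ^ m - (real (m + 1) + 1) * x ^ (m + 2)) / sqrt (4 - x\<^sup>2))) has_integral
        (4 * real (m + 1) / (real m + 2)) * arc_moment m - (1 / (real m + 2)) * 0) {-2..2}"
      by (intro has_integral_diff has_integral_mult_right) auto
    moreover have "(4 * real (m + 1) / (real m + 2)) * (x ^ m / s) - (1 / (real m + 2)) *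
        ((4 * real (m + 1) * x ^ m - (real (m + 1) + 1) * x ^ (m + 2)) / s) = x ^ (m + 2) / s" for x s :: real
    proof -
      have "(4 * r / q) * (A / s) - (1 / q) * ((4 * r * A - q * B) / s) = B / s" if "q \<noteq> 0" for A B r q :: real
        using that by (cases "s = 0") (simp_all add: field_simps)
      from this[of "real m + 2" "real (m + 1)" "x ^ m" "x ^ (m + 2)"] show ?thesis
        by (simp add: add.commute)
    qed
    moreover have "(4 * real (m + 1) / (real m + 2)) * arc_moment m = arc_moment (m + 2)"
    proof (cases "even m")
      case True
      then obtain k where k: "m = 2 * k" by auto
      define X Y where "X = real ((2 * Suc k) choose (Suc k))" and "Y = real ((2 * k) choose k)"
      have "arc_moment m = pi * Y" "arc_moment (m + 2) = pi * X"
        using k by (simp_all add: arc_moment_def X_def Y_def)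
      moreover have "real (Suc k) * X = 2 * (2 * real k + 1) * Y"
        unfolding X_def Y_def by (rule central_binomial_Suc)
      then have "4 * real (m + 1) / (real m + 2) * Y = X"
        using k by (simp add: field_simps)
      ultimately show ?thesis by (simp add: mult.left_commute)
    qed (simp add: arc_moment_def)
    ultimately show ?thesis using 3 by simp
  qed
qed

text \<open>The fundamental theorem yields gauge integrals. For n = 0 nonnegativity upgrades this to
  Lebesgue integrability, and on (-2, 2) the other integrands are at most 2^n times that
  one.\<close>

lemma arc_set_integrable:
  "set_integrable lborel {-2<..<2} (\<lambda>x. x ^ n / sqrt (4 - x\<^sup>2))"
  "(LINT x:{-2<..<2}|lborel. x ^ n / sqrt (4 - x\<^sup>2)) = arc_moment n"
proof -
  have "0 \<le> 1 / sqrt (4 - x\<^sup>2)" if "x \<in> {-2<..<2}" for x :: real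
    using that power_mono[of "\<bar>x\<bar>" 2 2] by auto
  moreover have "(\<lambda>x::real. 1 / sqrt (4 - x\<^sup>2)) integrable_on {-2<..<2}"
    using arc_has_integral[of 0] by (auto simp: has_integral_Icc_iff_Ioo integrable_on_def)
  ultimately have "(\<lambda>x::real. 1 / sqrt (4 - x\<^sup>2)) absolutely_integrable_on {-2<..<2}"
    by (intro nonnegative_absolutely_integrable_1)
  then have 0: "set_integrable lborel {-2<..<2} (\<lambda>x::real. 1 / sqrt (4 - x\<^sup>2))"
    unfolding set_integrable_def by (subst (asm) integrable_completion) auto
  show int: "set_integrable lborel {-2<..<2} (\<lambda>x. x ^ n / sqrt (4 - x\<^sup>2))"
    unfolding set_integrable_def
  proof (rule Bochner_Integration.integrable_bound)
    show "integrable lborel (\<lambda>x. 2 ^ n * (indicator {-2<..<2} x *\<^sub>R (1 / sqrt (4 - x\<^sup>2)) :: real))"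
      using 0 unfolding set_integrable_def by (rule integrable_mult_right)
    have "\<bar>x\<bar> ^ n / \<bar>s\<bar> \<le> 2 ^ n / \<bar>s\<bar>" if "\<bar>x\<bar> < 2" for x s :: real
      using that by (intro divide_right_mono power_mono) auto
    then show "AE x in lborel. norm (indicator {-2<..<2} x *\<^sub>R (x ^ n / sqrt (4 - x\<^sup>2)))
       \<le> norm (2 ^ n * (indicator {-2<..<2} x *\<^sub>R (1 / sqrt (4 - x\<^sup>2)) :: real))"
      by (intro AE_I2) (auto simp: indicator_def abs_mult power_abs)
  qed auto
  have "((\<lambda>x. x ^ n / sqrt (4 - x\<^sup>2)) has_integral arc_moment n) {-2<..<2}"
    using arc_has_integral[of n] by (simp add: has_integral_Icc_iff_Ioo)
  then show "(LINT x:{-2<..<2}|lborel. x ^ n / sqrt (4 - x\<^sup>2)) = arc_moment n"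
    using set_borel_integral_eq_integral(2)[OF int] by (simp add: integral_unique)
qed

lemma arc_integrable:
  "integrable lborel (\<lambda>x. indicator {-2<..<2} x * (x ^ n / sqrt (4 - x\<^sup>2)))"
  "(LINT x|lborel. indicator {-2<..<2} x * (x ^ n / sqrt (4 - x\<^sup>2))) = arc_moment n"
  using arc_set_integrable[of n] by (auto simp: set_integrable_def set_lebesgue_integral_def)

text \<open>On (-2, 2), sqrt (4 - x^2) = (4 - x^2) / sqrt (4 - x^2), which turns the semicircle
  density into a polynomial multiple of the arcsine density.\<close>

lemma semicircle_moment:
  "has_moment semicircle n ((4 * arc_moment n - arc_moment (n + 2)) / (2 * pi))"
proof -
  let ?g = "\<lambda>x::real. indicator {-2<..<2} x * (1 / (2 * pi) * sqrt (4 - x\<^sup>2))"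
  let ?a = "\<lambda>n x. indicator {-2<..<2} x * (x ^ n / sqrt (4 - x\<^sup>2)) :: real"
  have e: "x ^ n * ?g x = (4 * ?a n x - ?a (n + 2) x) / (2 * pi)" for n x
  proof (cases "x \<in> {-2<..<2}")
    case True
    then have "\<bar>x\<bar> < 2" by auto
    then have pos: "4 - x\<^sup>2 > 0" using power_strict_mono[of "\<bar>x\<bar>" 2 2] by simp
    have "sqrt (4 - x\<^sup>2) * sqrt (4 - x\<^sup>2) = 4 - x\<^sup>2" using pos by simp
    then have "sqrt (4 - x\<^sup>2) = (4 - x\<^sup>2) / sqrt (4 - x\<^sup>2)"
      using pos by (simp add: field_simps)
    then have "x ^ n * sqrt (4 - x\<^sup>2) = 4 * (x ^ n / sqrt (4 - x\<^sup>2)) - x ^ (n + 2) / sqrt (4 - x\<^sup>2)"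
      using pos by (simp add: field_simps power2_eq_square)
    then show ?thesis using True by (simp add: field_simps)
  qed auto
  have "has_moment semicircle n (LINT x|lborel. x ^ n * ?g x)"
    unfolding semicircle_def
  proof (rule has_moment_density)
    have int: "integrable lborel (\<lambda>x. x ^ n * ?g x)" for n
      unfolding e
      by (intro integrable_divide Bochner_Integration.integrable_add Bochner_Integration.integrable_diff
          integrable_mult_right arc_integrable(1))
    show "integrable lborel ?g" using int[of 0] by simp
    show "integrable lborel (\<lambda>x. x ^ n * ?g x)" by (rule int)
  qed
  also have "(LINT x|lborel. x ^ n * ?g x) = (4 * arc_moment n - arc_moment (n + 2)) / (2 * pi)"
    unfolding e using arc_integrable(1)
    by (simp only: integral_divide_zero Bochner_Integration.integral_add Bochner_Integration.integral_diff
        integral_mult_right_zero integrable_mult_right Bochner_Integration.integrable_diff arc_integrable(2))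
  finally show ?thesis .
qed

lemma sigma1_moment:
  "has_moment sigma1 n ((arc_moment (n + 4) - 4 * arc_moment (n + 2) + 2 * arc_moment n) / (2 * pi))"
proof -
  let ?g = "\<lambda>x::real. indicator {-2<..<2} x * (1 / (2 * pi) * ((x ^ 4 - 4 * x\<^sup>2 + 2) / sqrt (4 - x\<^sup>2)))"
  let ?a = "\<lambda>n x. indicator {-2<..<2} x * (x ^ n / sqrt (4 - x\<^sup>2)) :: real"
  have e: "x ^ n * ?g x = (?a (n + 4) x - 4 * ?a (n + 2) x + 2 * ?a n x) / (2 * pi)" for n x
  proof -
    have "x ^ n * ((x ^ 4 - 4 * x\<^sup>2 + 2) / s) = x ^ (n + 4) / s - 4 * (x ^ (n + 2) / s) + 2 * (x ^ n / s)" for s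
      by (simp add: power_add power2_eq_square algebra_simps add_divide_distrib diff_divide_distrib)
    then have "x ^ n * ?g x = indicator {-2<..<2} x * (x ^ (n + 4) / sqrt (4 - x\<^sup>2)
        - 4 * (x ^ (n + 2) / sqrt (4 - x\<^sup>2)) + 2 * (x ^ n / sqrt (4 - x\<^sup>2))) / (2 * pi)"
      by (metis (no_types, opaque_lifting) mult.left_commute mult.commute mult_1 times_divide_eq_left times_divide_eq_right)
    then show ?thesis
      by (simp only: distrib_left right_diff_distrib mult.left_commute)
  qed
  have "has_moment sigma1 n (LINT x|lborel. x ^ n * ?g x)"
    unfolding sigma1_def
  proof (rule has_moment_density)
    have int: "integrable lborel (\<lambda>x. x ^ n * ?g x)" for n
      unfolding e
      by (intro integrable_divide Bochner_Integration.integrable_add Bochner_Integration.integrable_diff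
          integrable_mult_right arc_integrable(1))
    show "integrable lborel ?g" using int[of 0] by simp
    show "integrable lborel (\<lambda>x. x ^ n * ?g x)" by (rule int)
  qed
  also have "(LINT x|lborel. x ^ n * ?g x) = (arc_moment (n + 4) - 4 * arc_moment (n + 2) + 2 * arc_moment n) / (2 * pi)"
    unfolding e using arc_integrable(1)
    by (simp only: integral_divide_zero Bochner_Integration.integral_add Bochner_Integration.integral_diff
        integral_mult_right_zero integrable_mult_right Bochner_Integration.integrable_diff arc_integrable(2))
  finally show ?thesis .
qed

section \<open>Catalan generating series\<close>

text \<open>The series (1 - 4x)^(-1/2), handled through its differential equation and its
  square.\<close>

definition central_fps :: "real fps" where
  "central_fps = Abs_fps (\<lambda>k. real ((2 * k) choose k))"

lemma central_fps_deriv: "(1 - 4 * fps_X) * fps_deriv central_fps = 2 * central_fps"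
proof (rule fps_ext)
  fix k :: nat
  let ?c = "\<lambda>k. real ((2 * k) choose k)"
  have "fps_nth ((1 - 4 * fps_X) * fps_deriv central_fps) k =
      real (Suc k) * ?c (Suc k) - 4 * (real k * ?c k)"
    by (cases k) (simp_all add: central_fps_def left_diff_distrib mult.assoc numeral_fps_const del: binomial_Suc_Suc)
  also have "\<dots> = 2 * ?c k"
    using central_binomial_Suc[of k] by (simp add: algebra_simps del: binomial_Suc_Suc)
  also have "\<dots> = fps_nth (2 * central_fps) k"
    by (simp add: central_fps_def numeral_fps_const)
  finally show "fps_nth ((1 - 4 * fps_X) * fps_deriv central_fps) k = fps_nth (2 * central_fps) k" .
qed

text \<open>By the differential equation the derivative of (1 - 4x) C^2 is zero, so the product
  equals its constant coefficient.\<close>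

lemma central_fps_square: "(1 - 4 * fps_X) * central_fps\<^sup>2 = 1"
proof -
  have "fps_deriv ((1 - 4 * fps_X) * central_fps\<^sup>2) =
      2 * central_fps * ((1 - 4 * fps_X) * fps_deriv central_fps) - 4 * central_fps\<^sup>2"
    by (simp add: power2_eq_square algebra_simps)
  also have "\<dots> = 0"
    by (simp add: central_fps_deriv power2_eq_square)
  finally have "(1 - 4 * fps_X) * central_fps\<^sup>2 = fps_const (fps_nth ((1 - 4 * fps_X) * central_fps\<^sup>2) 0)"
    by (rule fps_deriv_eq_0_iff[THEN iffD1])
  then show ?thesis by (simp add: central_fps_def power2_eq_square)
qed

text \<open>Formal version of T = (1 - sqrt (1 - 4x)) / (2x), with (1 - 4x) C in the role of the
  square root.\<close>

lemma one_minus_catalan: "1 - 2 * fps_X * catalan_fps = (1 - 4 * fps_X) * central_fps"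
proof (rule fps_ext)
  fix k :: nat
  let ?c = "\<lambda>k. real ((2 * k) choose k)"
  show "fps_nth (1 - 2 * fps_X * catalan_fps) k = fps_nth ((1 - 4 * fps_X) * central_fps) k"
  proof (cases k)
    case (Suc n)
    have "fps_nth ((1 - 4 * fps_X) * central_fps) (Suc n) = ?c (Suc n) - 4 * ?c n"
      by (simp add: central_fps_def left_diff_distrib mult.assoc numeral_fps_const del: binomial_Suc_Suc)
    also have "\<dots> = - 2 * (1 / real (n + 1) * ?c n)"
      using central_binomial_Suc[of n] by (simp add: field_simps del: binomial_Suc_Suc)
    also have "\<dots> = fps_nth (1 - 2 * fps_X * catalan_fps) (Suc n)"
      by (simp add: catalan_fps_def mult.assoc numeral_fps_const)
    finally show ?thesis using Suc by simp
  qed (simp add: central_fps_def)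
qed

text \<open>Squaring the closed form for 1 - 2xT leaves 4x (T - 1 - xT^2) = 0, and power series over
  the reals have no zero divisors.\<close>

lemma catalan_fps_eq: "catalan_fps = 1 + fps_X * catalan_fps\<^sup>2"
proof -
  have "(1 - 2 * fps_X * catalan_fps)\<^sup>2 = (1 - 4 * fps_X) * ((1 - 4 * fps_X) * central_fps\<^sup>2)"
    unfolding one_minus_catalan by (simp add: power2_eq_square mult_ac)
  then have "(1 - 2 * fps_X * catalan_fps)\<^sup>2 = 1 - 4 * fps_X"
    by (simp add: central_fps_square)
  then have "4 * fps_X * (catalan_fps - (1 + fps_X * catalan_fps\<^sup>2)) = 0"
    by (simp add: power2_eq_square algebra_simps)
  then show ?thesis by simp
qed

lemma central_fps_inverse: "(1 - 2 * fps_X * catalan_fps) * central_fps = 1"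
  unfolding one_minus_catalan using central_fps_square by (simp add: power2_eq_square mult.assoc)

text \<open>Generating series of the even moments of \<open>sigma1\<close>, obtained from the
  arcsine moments.\<close>

definition sigma1_fps :: "real fps" where
  "sigma1_fps = Abs_fps (\<lambda>k. (real ((2 * (k + 2)) choose (k + 2)) - 4 * real ((2 * (k + 1)) choose (k + 1))
      + 2 * real ((2 * k) choose k)) / 2)"

text \<open>Multiplication by x^2 aligns the shifted central binomials; 1 - 2x removes the two
  coefficients that fall below the shift.\<close>

lemma fps_X2_sigma1: "2 * fps_X\<^sup>2 * sigma1_fps = central_fps * (1 - 4 * fps_X + 2 * fps_X\<^sup>2) - (1 - 2 * fps_X)"
proof (rule fps_ext)
  fix k :: nat
  have X2: "fps_nth (fps_X\<^sup>2 * g) 0 = 0" "fps_nth (fps_X\<^sup>2 * g) (Suc 0) = 0"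
    "fps_nth (fps_X\<^sup>2 * g) (Suc (Suc n)) = fps_nth g n" for g :: "real fps" and n
    by (simp_all add: power2_eq_square mult.assoc)
  have r: "central_fps * (1 - 4 * fps_X + 2 * fps_X\<^sup>2) - (1 - 2 * fps_X) =
     central_fps - fps_const 4 * (fps_X * central_fps) + fps_const 2 * (fps_X\<^sup>2 * central_fps) - 1 + fps_const 2 * fps_X"
    by (simp add: algebra_simps numeral_fps_const)
  have l: "2 * fps_X\<^sup>2 * sigma1_fps = fps_const 2 * (fps_X\<^sup>2 * sigma1_fps)"
    by (simp add: numeral_fps_const mult.assoc)
  consider "k = 0" | "k = 1" | n where "k = n + 2"
    by (metis One_nat_def Suc_eq_plus1 add_2_eq_Suc' not0_implies_Suc)
  then show "fps_nth (2 * fps_X\<^sup>2 * sigma1_fps) k =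
      fps_nth (central_fps * (1 - 4 * fps_X + 2 * fps_X\<^sup>2) - (1 - 2 * fps_X)) k"
    unfolding r l
    by cases (simp_all add: X2 central_fps_def sigma1_fps_def del: binomial_Suc_Suc)
qed

text \<open>In terms of y = xT^2 one has T = 1 + y and x (1 + y)^2 = y. Inserting (1 - 2xT) C = 1
  next to 1 - 2x makes C a common factor; the remaining polynomial collapses to 2 x^2 y^2.\<close>

lemma sigma1_fps_eq: "sigma1_fps = fps_X\<^sup>2 * catalan_fps ^ 4 * central_fps"
proof -
  let ?x = "fps_X :: real fps" and ?T = catalan_fps and ?C = central_fps
  define y where "y = ?x * ?T\<^sup>2"
  have T: "?T = 1 + y" using catalan_fps_eq by (simp add: y_def)
  have xy: "?x * (1 + y)\<^sup>2 = y" using y_def by (simp add: T)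
  have 1: "2 * ?x\<^sup>2 * sigma1_fps = ?C * (1 - 4 * ?x + 2 * ?x\<^sup>2) - (1 - 2 * ?x) * ((1 - 2 * ?x * ?T) * ?C)"
    by (simp add: fps_X2_sigma1 central_fps_inverse)
  have 2: "(1 - 4 * ?x + 2 * ?x\<^sup>2) - (1 - 2 * ?x) * (1 - 2 * ?x * ?T) = 2 * ?x\<^sup>2 * y\<^sup>2"
  proof -
    have "(1 - 4 * ?x + 2 * ?x\<^sup>2) - (1 - 2 * ?x) * (1 - 2 * ?x * (1 + y)) =
        2 * ?x * (y - ?x * (1 + y)\<^sup>2) + 2 * ?x\<^sup>2 * y\<^sup>2"
      by (simp add: power2_eq_square algebra_simps)
    then show ?thesis unfolding T xy by simp
  qed
  have gen: "C * A - B * (D * C) = C * (A - B * D)" for A B C D :: "real fps"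
    by (simp add: algebra_simps)
  have "2 * ?x\<^sup>2 * sigma1_fps = 2 * ?x\<^sup>2 * (y\<^sup>2 * ?C)"
  proof -
    have "2 * ?x\<^sup>2 * sigma1_fps = ?C * ((1 - 4 * ?x + 2 * ?x\<^sup>2) - (1 - 2 * ?x) * (1 - 2 * ?x * ?T))"
      unfolding 1 by (rule gen)
    then show ?thesis unfolding 2 by (simp add: mult_ac)
  qed
  then have "sigma1_fps = y\<^sup>2 * ?C" by simp
  then show ?thesis by (simp add: y_def power_mult_distrib flip: power_mult)
qed

section \<open>Signed measures with prescribed moments\<close>

text \<open>Weighted atoms (weight, position) of the functional that sends g to 1/n! times its n-th
  forward difference at 0. It annihilates polynomials of degree below n and sends x^n to 1.\<close>

fun difference_atoms :: "nat \<Rightarrow> (real \<times> real) list" where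
  "difference_atoms 0 = [(1, 0)]"
| "difference_atoms (Suc n) = map (\<lambda>(w, x). (w / real (Suc n), x + 1)) (difference_atoms n)
     @ map (\<lambda>(w, x). (- w / real (Suc n), x)) (difference_atoms n)"

text \<open>The value on x^k is the Stirling number S(k, n) of the second kind; what matters is its
  triangular shape.\<close>

definition difference_moment :: "nat \<Rightarrow> nat \<Rightarrow> real" where
  "difference_moment n k = (\<Sum>(w, x)\<leftarrow>difference_atoms n. w * x ^ k)"

text \<open>A forward difference of x^k is (x + 1)^k - x^k, whose binomial expansion has lost the
  top term; the division by n + 1 builds up n!.\<close>

lemma difference_moment_Suc:
  "real (Suc n) * difference_moment (Suc n) k = (\<Sum>i<k. real (k choose i) * difference_moment n i)"
proof -
  have *: "(\<Sum>(w, x)\<leftarrow>L. w * (x + 1) ^ k) - (\<Sum>(w, x)\<leftarrow>L. w * x ^ k) =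
      (\<Sum>i<k. real (k choose i) * (\<Sum>(w, x)\<leftarrow>L. w * x ^ i))" for L :: "(real \<times> real) list"
  proof (induction L)
    case (Cons a L)
    obtain w x where a: "a = (w, x)" by fastforce
    have "(x + 1) ^ k = (\<Sum>i<k. real (k choose i) * x ^ i) + x ^ k"
      using binomial_ring[of x 1 k] by (simp add: lessThan_Suc_atMost[symmetric])
    then have "w * (x + 1) ^ k = (\<Sum>i<k. real (k choose i) * (w * x ^ i)) + w * x ^ k"
      by (simp add: distrib_left sum_distrib_left mult.left_commute)
    then show ?case using Cons by (simp add: a distrib_left sum.distrib)
  qed simp
  have 1: "(\<Sum>(w, x)\<leftarrow>map (\<lambda>(w, x). (w / c, x + 1)) L. w * x ^ k) = (\<Sum>(w, x)\<leftarrow>L. w * (x + 1) ^ k) / c"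
    for L and c :: real by (induction L) (auto simp: add_divide_distrib)
  have 2: "(\<Sum>(w, x)\<leftarrow>map (\<lambda>(w, x). (- w / c, x)) L. w * x ^ k) = - (\<Sum>(w, x)\<leftarrow>L. w * x ^ k) / c"
    for L and c :: real by (induction L) (auto simp: add_divide_distrib diff_divide_distrib)
  have "difference_moment (Suc n) k = ((\<Sum>(w, x)\<leftarrow>difference_atoms n. w * (x + 1) ^ k)
      - (\<Sum>(w, x)\<leftarrow>difference_atoms n. w * x ^ k)) / real (Suc n)"
    by (simp only: difference_moment_def difference_atoms.simps map_append sum_list_append 1 2)
      (simp add: diff_divide_distrib)
  then show ?thesis by (simp add: * difference_moment_def)
qed

lemma difference_moment_less: "k < n \<Longrightarrow> difference_moment n k = 0"
proof (induction n arbitrary: k)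
  case (Suc n)
  have "real (Suc n) * difference_moment (Suc n) k = 0"
    unfolding difference_moment_Suc using Suc by (intro sum.neutral) auto
  then show ?case by simp
qed simp

lemma difference_moment_same: "difference_moment n n = 1"
proof (induction n)
  case (Suc n)
  have "real (Suc n) * difference_moment (Suc n) (Suc n) =
     (\<Sum>i<n. real (Suc n choose i) * difference_moment n i) + real (Suc n choose n) * difference_moment n n"
    unfolding difference_moment_Suc by simp
  also have "(\<Sum>i<n. real (Suc n choose i) * difference_moment n i) = 0"
    by (intro sum.neutral) (simp add: difference_moment_less)
  finally show ?case using Suc by simp
qed (simp add: difference_moment_def)

text \<open>Atoms at equal positions are kept apart, so this is an upper bound for the k-th absolute
  moment of the difference functional.\<close>

definition difference_abs_moment :: "nat \<Rightarrow> nat \<Rightarrow> real" where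
  "difference_abs_moment n k = (\<Sum>(w, x)\<leftarrow>difference_atoms n. \<bar>w * x ^ k\<bar>)"

lemma difference_abs_moment_nonneg: "difference_abs_moment n k \<ge> 0"
  unfolding difference_abs_moment_def by (rule sum_list_nonneg) auto

text \<open>Dilating the n-th functional by t and weighting it with c / t^n keeps its n-th moment
  equal to c, while absolute moments of lower order shrink at least like 1/t. The value of t brings
  them below 2^-n; the summand 1 guarantees t \<ge> 1.\<close>

definition dilation :: "nat \<Rightarrow> real \<Rightarrow> real" where
  "dilation n c = 1 + \<bar>c\<bar> * 2 ^ n * (\<Sum>k<n. difference_abs_moment n k)"

text \<open>Solution of a triangular system: the coefficient at n is what is missing from
  \<open>a n\<close> after the blocks m < n, dilated by their own factors, have contributed; blocks
  m > n do not see x^n.\<close>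

function moment_coeff :: "(nat \<Rightarrow> real) \<Rightarrow> nat \<Rightarrow> real" where
  "moment_coeff a n = a n - (\<Sum>m<n. moment_coeff a m * dilation m (moment_coeff a m) ^ n
      / dilation m (moment_coeff a m) ^ m * difference_moment m n)"
  by auto
termination by (relation "Wellfounded.measure snd") auto
declare moment_coeff.simps [simp del]

lemma dilation_ge_1: "dilation n c \<ge> 1"
  unfolding dilation_def using difference_abs_moment_nonneg by (simp add: sum_nonneg)

text \<open>As k < n, at least one power of t \<ge> 1 is left over in t^n / t^k, and it absorbs |c|
  2^n times the absolute moment by the choice of \<open>dilation\<close>.\<close>

lemma dilation_bound:
  assumes "k < n"
  shows "\<bar>c\<bar> * dilation n c ^ k / dilation n c ^ n * difference_abs_moment n k \<le> (1 / 2) ^ n"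
proof -
  let ?t = "dilation n c"
  have t: "?t \<ge> 1" by (rule dilation_ge_1)
  have "difference_abs_moment n k \<le> (\<Sum>k<n. difference_abs_moment n k)"
    using assms difference_abs_moment_nonneg by (intro member_le_sum) auto
  then have "\<bar>c\<bar> * 2 ^ n * difference_abs_moment n k \<le> \<bar>c\<bar> * 2 ^ n * (\<Sum>k<n. difference_abs_moment n k)"
    by (intro mult_left_mono) auto
  also have "\<dots> \<le> ?t" by (simp add: dilation_def)
  finally have 1: "\<bar>c\<bar> * difference_abs_moment n k * 2 ^ n \<le> ?t" by (simp add: mult_ac)
  have "?t ^ Suc k \<le> ?t ^ n" using assms t by (intro power_increasing) auto
  have "\<bar>c\<bar> * ?t ^ k * difference_abs_moment n k * 2 ^ n = (\<bar>c\<bar> * difference_abs_moment n k * 2 ^ n) * ?t ^ k"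
    by simp
  also have "\<dots> \<le> ?t * ?t ^ k" using 1 t by (intro mult_right_mono) auto
  also have "\<dots> \<le> ?t ^ n" using \<open>?t ^ Suc k \<le> ?t ^ n\<close> by simp
  finally show ?thesis using t by (simp add: field_simps power_divide)
qed

text \<open>The measure is an infinite sum of dilated difference functionals. Degrees below n are
  annihilated by the n-th block, so each moment is a finite triangular sum, while the dilations make
  all absolute moments converge, whatever the growth of a.\<close>

lemma exists_signed_measure_with_moments:
  fixes a :: "nat \<Rightarrow> real"
  shows "\<exists>\<nu>. signed_measure \<nu> \<and> (\<forall>k. has_moment \<nu> k (a k))"
proof -
  define c where "c = moment_coeff a"
  define t where "t n = dilation n (c n)" for n
  have t1: "t n \<ge> 1" for n by (simp add: t_def dilation_ge_1)
  \<comment> \<open>An index (n, j) denotes the j-th atom of the n-th block; \<open>W\<close> is its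
    weight and \<open>X\<close> its position after dilation.\<close>
  define J where "J = Sigma UNIV (\<lambda>n. {..<length (difference_atoms n)})"
  define W where "W = (\<lambda>(n, j). c n / t n ^ n * fst (difference_atoms n ! j))"
  define X where "X = (\<lambda>(n, j). t n * snd (difference_atoms n ! j))"
  have sumj: "(\<Sum>j<length (difference_atoms n). g (difference_atoms n ! j)) = (\<Sum>z\<leftarrow>difference_atoms n. g z)"
    for n and g :: "real \<times> real \<Rightarrow> real"
    by (simp add: sum_list_sum_nth atLeast0LessThan)
  \<comment> \<open>For fixed k, blocks n > k are controlled by 2^-n and the finitely many others do
    not affect summability. The case k = 0 gives finite total variation.\<close>
  have abs: "Infinite_Set_Sum.abs_summable_on (\<lambda>i. W i * X i ^ k) J" for k
    unfolding J_def
  proof (subst abs_summable_on_Sigma_iff, safe)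
    show "Infinite_Set_Sum.abs_summable_on (\<lambda>y. W (x, y) * X (x, y) ^ k) {..<length (difference_atoms x)}" for x by simp
    have "(\<Sum>\<^sub>ay\<in>{..<length (difference_atoms n)}. norm (W (n, y) * X (n, y) ^ k)) =
       \<bar>c n\<bar> * t n ^ k / t n ^ n * difference_abs_moment n k" for n
    proof -
      have "(\<Sum>\<^sub>ay\<in>{..<length (difference_atoms n)}. norm (W (n, y) * X (n, y) ^ k)) =
        (\<Sum>j<length (difference_atoms n). (\<bar>c n\<bar> * t n ^ k / t n ^ n) *
           (case difference_atoms n ! j of (w, x) \<Rightarrow> \<bar>w * x ^ k\<bar>))"
        using t1[of n] by (subst infsetsum_finite)
          (auto simp: W_def X_def abs_mult power_mult_distrib split_beta power_abs intro!: sum.cong)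
      also have "\<dots> = \<bar>c n\<bar> * t n ^ k / t n ^ n * difference_abs_moment n k"
        by (subst sum_distrib_left[symmetric], subst sumj) (simp add: difference_abs_moment_def)
      finally show ?thesis .
    qed
    moreover have "Infinite_Set_Sum.abs_summable_on (\<lambda>n. \<bar>c n\<bar> * t n ^ k / t n ^ n * difference_abs_moment n k) UNIV"
    proof (subst abs_summable_on_nat_iff', rule summable_comparison_test_ev)
      show "summable (\<lambda>n. (1 / 2 :: real) ^ n)" by simp
      show "\<forall>\<^sub>F n in sequentially. norm (norm (\<bar>c n\<bar> * t n ^ k / t n ^ n * difference_abs_moment n k)) \<le> (1 / 2) ^ n"
        using eventually_gt_at_top[of k]
      proof eventually_elim
        case (elim n)
        have "0 \<le> \<bar>c n\<bar> * t n ^ k / t n ^ n * difference_abs_moment n k"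
          using t1[of n] difference_abs_moment_nonneg[of n k] by (intro mult_nonneg_nonneg divide_nonneg_nonneg) auto
        then show ?case using dilation_bound[OF elim, of "c n"] by (simp add: t_def)
      qed
    qed
    ultimately show "Infinite_Set_Sum.abs_summable_on (\<lambda>x. \<Sum>\<^sub>ay\<in>{..<length (difference_atoms x)}. norm (W (x, y) * X (x, y) ^ k)) UNIV"
      by simp
  qed auto
  have total: "(\<Sum>\<^sub>ai\<in>J. W i * X i ^ k) = a k" for k
  proof -
    have "(\<Sum>\<^sub>ai\<in>J. W i * X i ^ k) = (\<Sum>\<^sub>an\<in>UNIV. \<Sum>\<^sub>aj\<in>{..<length (difference_atoms n)}. W (n, j) * X (n, j) ^ k)"
      using abs[of k] unfolding J_def by (subst infsetsum_Sigma) auto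
    also have "(\<lambda>n. \<Sum>\<^sub>aj\<in>{..<length (difference_atoms n)}. W (n, j) * X (n, j) ^ k) =
        (\<lambda>n. c n * t n ^ k / t n ^ n * difference_moment n k)"
    proof
      fix n
      have "(\<Sum>\<^sub>aj\<in>{..<length (difference_atoms n)}. W (n, j) * X (n, j) ^ k) =
        (\<Sum>j<length (difference_atoms n). (c n * t n ^ k / t n ^ n) *
           (case difference_atoms n ! j of (w, x) \<Rightarrow> w * x ^ k))"
        by (subst infsetsum_finite)
          (auto simp: W_def X_def power_mult_distrib split_beta intro!: sum.cong)
      also have "\<dots> = c n * t n ^ k / t n ^ n * difference_moment n k"
        by (subst sum_distrib_left[symmetric], subst sumj) (simp add: difference_moment_def)
      finally show "(\<Sum>\<^sub>aj\<in>{..<length (difference_atoms n)}. W (n, j) * X (n, j) ^ k) =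
          c n * t n ^ k / t n ^ n * difference_moment n k" .
    qed
    \<comment> \<open>Difference moments of order k vanish for n > k, so the series stops at n = k,
      where the term equals \<open>c k\<close>.\<close>
    also have "(\<Sum>\<^sub>an\<in>UNIV. c n * t n ^ k / t n ^ n * difference_moment n k) =
        (\<Sum>\<^sub>an\<in>{..k}. c n * t n ^ k / t n ^ n * difference_moment n k)"
      by (intro infsetsum_cong_neutral) (auto simp: difference_moment_less)
    also have "\<dots> = (\<Sum>n<k. c n * t n ^ k / t n ^ n * difference_moment n k) + c k"
      using t1[of k] by (simp add: lessThan_Suc_atMost[symmetric] difference_moment_same)
    also have "\<dots> = a k"
      unfolding c_def t_def by (subst (3) moment_coeff.simps) simp
    finally show ?thesis .
  qed
  \<comment> \<open>The sign s = 1 selects the positive part of the weights and s = -1 the negative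
    part, so both halves of the decomposition are treated at once.\<close>
  define V where "V s i = max 0 (s * W i)" for s i
  have V0: "V s i \<ge> 0" for s i by (simp add: V_def)
  define Q where "Q s = distr (density (count_space J) (\<lambda>i. ennreal (V s i))) borel X" for s
  have Wabs: "Infinite_Set_Sum.abs_summable_on (\<lambda>i. W i * X i ^ k) J" "integrable (count_space J) (\<lambda>i. W i * X i ^ k)" for k
    using abs[of k] by (auto simp: abs_summable_on_def)
  have int: "integrable (count_space J) (\<lambda>i. V s i * X i ^ k)" if "\<bar>s\<bar> = 1" for s k
  proof (rule Bochner_Integration.integrable_bound[OF Wabs(2)[of k]])
    have "\<bar>max 0 (s * w)\<bar> \<le> \<bar>w\<bar>" for w using that by (auto simp: max_def abs_if split: if_splits)
    then show "AE i in count_space J. norm (V s i * X i ^ k) \<le> norm (W i * X i ^ k)"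
      by (intro AE_I2) (simp add: abs_mult mult_right_mono V_def)
  qed auto
  have Q: "finite_measure (Q s)" "sets (Q s) = sets borel" "integrable (Q s) (\<lambda>x. x ^ k)"
    "(LINT x|Q s. x ^ k) = (LINT i|count_space J. V s i * X i ^ k)" if "\<bar>s\<bar> = 1" for s k
  proof -
    have "(\<integral>\<^sup>+i. ennreal (V s i) \<partial>count_space J) < \<infinity>"
      using int[OF that, of 0] V0 by (simp add: integrable_iff_bounded)
    moreover have "emeasure (Q s) (space (Q s)) = (\<integral>\<^sup>+i. ennreal (V s i) * indicator J i \<partial>count_space J)"
      by (simp add: Q_def emeasure_distr emeasure_density)
    then have "emeasure (Q s) (space (Q s)) = (\<integral>\<^sup>+i. ennreal (V s i) \<partial>count_space J)"
      by (metis (no_types, lifting) indicator_simps(1) mult.right_neutral nn_integral_cong space_count_space)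
    ultimately show "finite_measure (Q s)"
      by (intro finite_measureI) simp
    show "sets (Q s) = sets borel" by (simp add: Q_def)
    show "integrable (Q s) (\<lambda>x. x ^ k)"
      using int[OF that, of k] V0 by (simp add: Q_def integrable_distr_eq integrable_density)
    show "(LINT x|Q s. x ^ k) = (LINT i|count_space J. V s i * X i ^ k)"
      using V0 by (simp add: Q_def integral_distr integral_density)
  qed
  define \<nu> where "\<nu> B = measure (Q 1) B - measure (Q (-1)) B" for B
  have "signed_measure \<nu>"
    unfolding signed_measure_def
  proof (intro allI impI)
    fix B :: "nat \<Rightarrow> real set" assume B: "range B \<subseteq> sets borel \<and> disjoint_family B"
    have "(\<lambda>i. measure (Q s) (B i)) sums measure (Q s) (\<Union>i. B i)" if "\<bar>s\<bar> = 1" for s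
      using B Q(2)[OF that] finite_measure.emeasure_finite[OF Q(1)[OF that]]
      by (intro measure_UNION) auto
    from this[of 1] this[of "-1"] show "(\<lambda>i. \<nu> (B i)) sums \<nu> (\<Union>i. B i)"
      unfolding \<nu>_def by (intro sums_diff) auto
  qed
  moreover have "has_moment \<nu> k (a k)" for k
  proof -
    have "V 1 i * x - V (- 1) i * x = W i * x" for i and x :: real by (auto simp: V_def max_def)
    then have "(LINT x|Q 1. x ^ k) - (LINT x|Q (-1). x ^ k) = (LINT i|count_space J. W i * X i ^ k)"
      using int[of 1 k] int[of "-1" k] by (simp only: Q abs_minus abs_one Bochner_Integration.integral_diff[symmetric])
    also have "\<dots> = a k" using total[of k] by (simp add: infsetsum_def)
    finally show ?thesis
      unfolding has_moment_def \<nu>_def using Q(1,2)[of 1] Q(3,4)[of 1 k] Q(1,2)[of "-1"] Q(3,4)[of "-1" k]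
      by (intro exI[of _ "Q 1"] exI[of _ "Q (-1)"]) auto
  qed
  ultimately show ?thesis by blast
qed

section \<open>Spectral moments\<close>

lemma ell2_abs_summable:
  assumes "u \<in> ell2 V" "w \<in> ell2 V"
  shows "(\<lambda>v. norm (cnj (u v) * w v)) summable_on UNIV"
proof (rule summable_on_comparison_test)
  show "(\<lambda>v. (cmod (u v))\<^sup>2 + (cmod (w v))\<^sup>2) summable_on UNIV"
    using assms by (intro summable_on_add) (auto simp: ell2_def)
  show "norm (cnj (u v) * w v) \<le> (cmod (u v))\<^sup>2 + (cmod (w v))\<^sup>2" for v
  proof -
    have "norm (cnj (u v) * w v) = cmod (u v) * cmod (w v)" by (simp add: norm_mult)
    moreover have "0 \<le> cmod (u v) * cmod (w v)" by simp
    ultimately show ?thesis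
      using sum_squares_bound[of "cmod (u v)" "cmod (w v)"] by linarith
  qed
qed simp

lemma ell2_summable:
  assumes "u \<in> ell2 V" "w \<in> ell2 V"
  shows "(\<lambda>v. cnj (u v) * w v) summable_on UNIV"
  using ell2_abs_summable[OF assms] by (rule abs_summable_summable)

lemma ell2_lin:
  assumes "u \<in> ell2 V" "w \<in> ell2 V"
  shows "(\<lambda>v. u v + t * w v) \<in> ell2 V"
proof -
  have "(\<lambda>v. (cmod (u v + t * w v))\<^sup>2) summable_on UNIV"
  proof (rule summable_on_comparison_test)
    show "(\<lambda>v. 2 * (cmod (u v))\<^sup>2 + 2 * (cmod t)\<^sup>2 * (cmod (w v))\<^sup>2) summable_on UNIV"
      using assms by (intro summable_on_add summable_on_cmult_right) (auto simp: ell2_def)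
    show "(cmod (u v + t * w v))\<^sup>2 \<le> 2 * (cmod (u v))\<^sup>2 + 2 * (cmod t)\<^sup>2 * (cmod (w v))\<^sup>2" for v
    proof -
      have "(cmod (u v + t * w v))\<^sup>2 \<le> (cmod (u v) + cmod (t * w v))\<^sup>2"
        by (intro power_mono norm_triangle_ineq) auto
      also have "\<dots> \<le> 2 * (cmod (u v))\<^sup>2 + 2 * (cmod (t * w v))\<^sup>2"
        using sum_squares_bound[of "cmod (u v)" "cmod (t * w v)"] by (simp add: power2_sum)
      finally show ?thesis by (simp add: norm_mult power_mult_distrib)
    qed
  qed simp
  then show ?thesis using assms by (simp add: ell2_def)
qed

lemma ell2_diff: "u \<in> ell2 V \<Longrightarrow> w \<in> ell2 V \<Longrightarrow> (\<lambda>v. u v - w v) \<in> ell2 V"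
  using ell2_lin[of u V w "-1"] by simp

lemma ell2_inner_lin_right:
  assumes "a \<in> ell2 V" "u \<in> ell2 V" "w \<in> ell2 V"
  shows "ell2_inner a (\<lambda>v. u v + t * w v) = ell2_inner a u + t * ell2_inner a w"
proof -
  have "ell2_inner a (\<lambda>v. u v + t * w v) = (\<Sum>\<^sub>\<infinity>v. cnj (a v) * u v + t * (cnj (a v) * w v))"
    by (simp add: ell2_inner_def algebra_simps)
  also have "\<dots> = ell2_inner a u + t * ell2_inner a w"
    unfolding ell2_inner_def using assms
    by (subst infsum_add) (auto intro!: ell2_summable summable_on_cmult_right simp: infsum_cmult_right')
  finally show ?thesis .
qed

lemma ell2_inner_cnj: "ell2_inner u w = cnj (ell2_inner w u)"
  unfolding ell2_inner_def by (subst infsum_cnj[symmetric]) (simp add: mult.commute)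

lemma ell2_inner_lin_left:
  assumes "a \<in> ell2 V" "u \<in> ell2 V" "w \<in> ell2 V"
  shows "ell2_inner (\<lambda>v. u v + t * w v) a = ell2_inner u a + cnj t * ell2_inner w a"
  using ell2_inner_lin_right[OF assms, of t]
  by (metis complex_cnj_add complex_cnj_mult ell2_inner_cnj)

lemmas ell2_inner_diff_right = ell2_inner_lin_right[where t = "-1", simplified]
lemmas ell2_inner_diff_left = ell2_inner_lin_left[where t = "-1", simplified]

lemma ell2_inner_self_nonneg:
  assumes "u \<in> ell2 V"
  shows "Re (ell2_inner u u) \<ge> 0"
proof -
  have "Re (ell2_inner u u) = (\<Sum>\<^sub>\<infinity>v. Re (cnj (u v) * u v))"
    unfolding ell2_inner_def using ell2_summable[OF assms assms] by (rule infsum_Re[symmetric])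
  also have "\<dots> \<ge> 0" by (intro infsum_nonneg) simp
  finally show ?thesis .
qed

lemma ell2_dist_eq: "(ell2_dist u w)\<^sup>2 = (\<Sum>\<^sub>\<infinity>v. (cmod (u v - w v))\<^sup>2)"
  unfolding ell2_dist_def by (simp add: infsum_nonneg)

lemma ell2_cauchy_schwarz:
  assumes u: "u \<in> ell2 V" and w: "w \<in> ell2 V"
  shows "cmod (ell2_inner u w) \<le> sqrt (\<Sum>\<^sub>\<infinity>v. (cmod (u v))\<^sup>2) * sqrt (\<Sum>\<^sub>\<infinity>v. (cmod (w v))\<^sup>2)"
proof -
  have s: "(\<lambda>v. (cmod (u v))\<^sup>2) summable_on UNIV" "(\<lambda>v. (cmod (w v))\<^sup>2) summable_on UNIV"
    using u w by (auto simp: ell2_def)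
  have "cmod (ell2_inner u w) \<le> (\<Sum>\<^sub>\<infinity>v. norm (cnj (u v) * w v))"
    unfolding ell2_inner_def by (rule norm_infsum_bound[OF ell2_abs_summable[OF u w]])
  also have "\<dots> \<le> sqrt (\<Sum>\<^sub>\<infinity>v. (cmod (u v))\<^sup>2) * sqrt (\<Sum>\<^sub>\<infinity>v. (cmod (w v))\<^sup>2)"
  proof (rule infsum_le_finite_sums[OF ell2_abs_summable[OF u w]])
    fix F :: "'a set" assume F: "finite F" "F \<subseteq> UNIV"
    have "(\<Sum>v\<in>F. norm (cnj (u v) * w v)) = (\<Sum>v\<in>F. \<bar>cmod (u v)\<bar> * \<bar>cmod (w v)\<bar>)"
      by (simp add: norm_mult)
    also have "\<dots> \<le> L2_set (\<lambda>v. cmod (u v)) F * L2_set (\<lambda>v. cmod (w v)) F"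
      by (rule L2_set_mult_ineq)
    also have "\<dots> \<le> sqrt (\<Sum>\<^sub>\<infinity>v. (cmod (u v))\<^sup>2) * sqrt (\<Sum>\<^sub>\<infinity>v. (cmod (w v))\<^sup>2)"
      unfolding L2_set_def using F s
      by (intro mult_mono real_sqrt_le_mono finite_sum_le_infsum) (auto intro: sum_nonneg infsum_nonneg)
    finally show "(\<Sum>v\<in>F. norm (cnj (u v) * w v)) \<le> \<dots>" .
  qed
  finally show ?thesis .
qed

lemma ell2_inner_tendsto:
  assumes x: "\<And>n. x n \<in> ell2 V" "u \<in> ell2 V" "(\<lambda>n. ell2_dist (x n) u) \<longlonglongrightarrow> 0"
    and y: "\<And>n. y n \<in> ell2 V" "w \<in> ell2 V" "(\<lambda>n. ell2_dist (y n) w) \<longlonglongrightarrow> 0"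
  shows "(\<lambda>n. ell2_inner (x n) (y n)) \<longlonglongrightarrow> ell2_inner u w"
proof -
  let ?N = "\<lambda>u. sqrt (\<Sum>\<^sub>\<infinity>v. (cmod (u v))\<^sup>2)"
  have "cmod (ell2_inner (x n) (y n) - ell2_inner u w) \<le>
      ell2_dist (x n) u * ell2_dist (y n) w + ?N u * ell2_dist (y n) w + ell2_dist (x n) u * ?N w" for n
  proof -
    let ?dx = "\<lambda>v. x n v - u v" and ?dy = "\<lambda>v. y n v - w v"
    have d: "?dx \<in> ell2 V" "?dy \<in> ell2 V" using x y by (auto intro: ell2_diff)
    have eq: "ell2_inner (x n) (y n) - ell2_inner u w =
        ell2_inner ?dx ?dy + ell2_inner u ?dy + ell2_inner ?dx w"
      using x y d by (simp add: ell2_inner_diff_left[of _ V] ell2_inner_diff_right[of _ V])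
    have "cmod (ell2_inner (x n) (y n) - ell2_inner u w) \<le>
        cmod (ell2_inner ?dx ?dy) + cmod (ell2_inner u ?dy) + cmod (ell2_inner ?dx w)"
      unfolding eq using norm_triangle_ineq[of "ell2_inner ?dx ?dy + ell2_inner u ?dy" "ell2_inner ?dx w"]
        norm_triangle_ineq[of "ell2_inner ?dx ?dy" "ell2_inner u ?dy"] by linarith
    also have "\<dots> \<le> ?N ?dx * ?N ?dy + ?N u * ?N ?dy + ?N ?dx * ?N w"
      by (rule add_mono[OF add_mono[OF ell2_cauchy_schwarz[OF d] ell2_cauchy_schwarz[OF x(2) d(2)]]
            ell2_cauchy_schwarz[OF d(1) y(2)]])
    finally show ?thesis by (simp add: ell2_dist_def)
  qed
  moreover have "(\<lambda>n. ell2_dist (x n) u * ell2_dist (y n) w + ?N u * ell2_dist (y n) w + ell2_dist (x n) u * ?N w)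
      \<longlonglongrightarrow> 0 * 0 + ?N u * 0 + 0 * ?N w"
    by (intro tendsto_intros x y)
  ultimately have "(\<lambda>n. ell2_inner (x n) (y n) - ell2_inner u w) \<longlonglongrightarrow> 0"
    by (intro Lim_null_comparison[where f = "\<lambda>n. ell2_inner (x n) (y n) - ell2_inner u w",
          OF always_eventually[OF allI]]) simp_all
  then show ?thesis by (simp add: LIM_zero_iff)
qed

text \<open>The crude bound (x + y)^2 \<le> 2 x^2 + 2 y^2 holds coordinatewise and can be summed,
  which suffices for limits.\<close>

lemma ell2_dist_lin:
  assumes "a \<in> ell2 V" "b \<in> ell2 V" "u \<in> ell2 V" "w \<in> ell2 V"
  shows "(ell2_dist (\<lambda>v. a v + t * b v) (\<lambda>v. u v + t * w v))\<^sup>2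
      \<le> 2 * (ell2_dist a u)\<^sup>2 + 2 * (cmod t)\<^sup>2 * (ell2_dist b w)\<^sup>2"
proof -
  have d: "(\<lambda>v. a v - u v) \<in> ell2 V" "(\<lambda>v. b v - w v) \<in> ell2 V"
    using assms by (auto intro: ell2_diff)
  then have s: "(\<lambda>v. (cmod (a v - u v))\<^sup>2) summable_on UNIV" "(\<lambda>v. (cmod (b v - w v))\<^sup>2) summable_on UNIV"
    by (auto simp: ell2_def)
  have "(\<lambda>v. (a v - u v) + t * (b v - w v)) \<in> ell2 V" by (intro ell2_lin d)
  then have s2: "(\<lambda>v. (cmod ((a v + t * b v) - (u v + t * w v)))\<^sup>2) summable_on UNIV"
    by (simp add: ell2_def algebra_simps)
  have "(\<Sum>\<^sub>\<infinity>v. (cmod ((a v + t * b v) - (u v + t * w v)))\<^sup>2) \<le>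
     (\<Sum>\<^sub>\<infinity>v. 2 * (cmod (a v - u v))\<^sup>2 + 2 * (cmod t)\<^sup>2 * (cmod (b v - w v))\<^sup>2)"
  proof (rule infsum_mono[OF s2])
    show "(\<lambda>v. 2 * (cmod (a v - u v))\<^sup>2 + 2 * (cmod t)\<^sup>2 * (cmod (b v - w v))\<^sup>2) summable_on UNIV"
      by (intro summable_on_add summable_on_cmult_right s)
    fix v
    have "(cmod ((a v + t * b v) - (u v + t * w v)))\<^sup>2 = (cmod ((a v - u v) + t * (b v - w v)))\<^sup>2"
      by (simp add: algebra_simps)
    also have "\<dots> \<le> (cmod (a v - u v) + cmod (t * (b v - w v)))\<^sup>2"
      by (intro power_mono norm_triangle_ineq) auto
    also have "\<dots> \<le> 2 * (cmod (a v - u v))\<^sup>2 + 2 * (cmod (t * (b v - w v)))\<^sup>2"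
      using sum_squares_bound[of "cmod (a v - u v)" "cmod (t * (b v - w v))"] by (simp add: power2_sum)
    finally show "(cmod ((a v + t * b v) - (u v + t * w v)))\<^sup>2 \<le>
        2 * (cmod (a v - u v))\<^sup>2 + 2 * (cmod t)\<^sup>2 * (cmod (b v - w v))\<^sup>2"
      by (simp add: norm_mult power_mult_distrib)
  qed
  also have "\<dots> = 2 * (ell2_dist a u)\<^sup>2 + 2 * (cmod t)\<^sup>2 * (ell2_dist b w)\<^sup>2"
    unfolding ell2_dist_eq using s
    by (subst infsum_add) (auto intro!: summable_on_cmult_right simp: infsum_cmult_right')
  finally show ?thesis by (simp add: ell2_dist_eq)
qed

text \<open>Limits of linear combinations are linear combinations of limits. Together with symmetry
  this is what polarization in the closed operator requires.\<close>

lemma operator_closure_lin: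
  assumes G: "\<And>x y x' y'. (x, y) \<in> G \<Longrightarrow> (x', y') \<in> G \<Longrightarrow>
      x \<in> ell2 V \<and> y \<in> ell2 V \<and> ((\<lambda>v. x v + t * x' v), (\<lambda>v. y v + t * y' v)) \<in> G"
    and H: "(u, w) \<in> operator_closure V G" "(u', w') \<in> operator_closure V G"
  shows "((\<lambda>v. u v + t * u' v), (\<lambda>v. w v + t * w' v)) \<in> operator_closure V G"
proof -
  obtain x y where 1: "u \<in> ell2 V" "w \<in> ell2 V" "\<And>n::nat. (x n, y n) \<in> G"
    "(\<lambda>n. ell2_dist (x n) u) \<longlonglongrightarrow> 0" "(\<lambda>n. ell2_dist (y n) w) \<longlonglongrightarrow> 0"
    using H(1) by (auto simp: operator_closure_def)
  obtain x' y' where 2: "u' \<in> ell2 V" "w' \<in> ell2 V" "\<And>n::nat. (x' n, y' n) \<in> G"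
    "(\<lambda>n. ell2_dist (x' n) u') \<longlonglongrightarrow> 0" "(\<lambda>n. ell2_dist (y' n) w') \<longlonglongrightarrow> 0"
    using H(2) by (auto simp: operator_closure_def)
  have *: "(\<lambda>n. ell2_dist (\<lambda>v. a n v + t * b n v) (\<lambda>v. f v + t * g v)) \<longlonglongrightarrow> 0"
    if "\<And>n. a n \<in> ell2 V" "\<And>n. b n \<in> ell2 V" "f \<in> ell2 V" "g \<in> ell2 V"
      "(\<lambda>n. ell2_dist (a n) f) \<longlonglongrightarrow> 0" "(\<lambda>n. ell2_dist (b n) g) \<longlonglongrightarrow> 0" for a b f g
  proof -
    have "(\<lambda>n. 2 * (ell2_dist (a n) f)\<^sup>2 + 2 * (cmod t)\<^sup>2 * (ell2_dist (b n) g)\<^sup>2) \<longlonglongrightarrow> 2 * 0\<^sup>2 + 2 * (cmod t)\<^sup>2 * 0\<^sup>2"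
      by (intro tendsto_intros that)
    then have lim: "(\<lambda>n. 2 * (ell2_dist (a n) f)\<^sup>2 + 2 * (cmod t)\<^sup>2 * (ell2_dist (b n) g)\<^sup>2) \<longlonglongrightarrow> 0"
      by simp
    have "(\<lambda>n. (ell2_dist (\<lambda>v. a n v + t * b n v) (\<lambda>v. f v + t * g v))\<^sup>2) \<longlonglongrightarrow> 0"
      by (rule tendsto_sandwich[OF always_eventually[OF allI] always_eventually[OF allI] tendsto_const lim])
        (simp, rule ell2_dist_lin[OF that(1-4)])
    from tendsto_real_sqrt[OF this] show ?thesis by (simp add: ell2_dist_def infsum_nonneg)
  qed
  have e: "x n \<in> ell2 V" "y n \<in> ell2 V" "x' n \<in> ell2 V" "y' n \<in> ell2 V" for n
    using G 1(3)[of n] 2(3)[of n] by blast+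
  show ?thesis
    unfolding operator_closure_def mem_Collect_eq prod.case
  proof (intro conjI exI allI)
    show "(\<lambda>v. x n v + t * x' n v, \<lambda>v. y n v + t * y' n v) \<in> G" for n
      using G[OF 1(3) 2(3)] by blast
    show "(\<lambda>n. ell2_dist (\<lambda>v. x n v + t * x' n v) (\<lambda>v. u v + t * u' v)) \<longlonglongrightarrow> 0"
      by (rule *[OF e(1,3) 1(1) 2(1) 1(4) 2(4)])
    show "(\<lambda>n. ell2_dist (\<lambda>v. y n v + t * y' n v) (\<lambda>v. w v + t * w' v)) \<longlonglongrightarrow> 0"
      by (rule *[OF e(2,4) 1(2) 2(2) 1(5) 2(5)])
  qed (intro ell2_lin 1 2)+
qed

lemma operator_closure_symmetric:
  assumes G: "\<And>x y x' y'. (x, y) \<in> G \<Longrightarrow> (x', y') \<in> G \<Longrightarrow>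
      x \<in> ell2 V \<and> y \<in> ell2 V \<and> ell2_inner y x' = ell2_inner x y'"
    and H: "(u, w) \<in> operator_closure V G" "(u', w') \<in> operator_closure V G"
  shows "ell2_inner w u' = ell2_inner u w'"
proof -
  obtain x y where 1: "u \<in> ell2 V" "w \<in> ell2 V" "\<And>n::nat. (x n, y n) \<in> G"
    "(\<lambda>n. ell2_dist (x n) u) \<longlonglongrightarrow> 0" "(\<lambda>n. ell2_dist (y n) w) \<longlonglongrightarrow> 0"
    using H(1) by (auto simp: operator_closure_def)
  obtain x' y' where 2: "u' \<in> ell2 V" "w' \<in> ell2 V" "\<And>n::nat. (x' n, y' n) \<in> G"
    "(\<lambda>n. ell2_dist (x' n) u') \<longlonglongrightarrow> 0" "(\<lambda>n. ell2_dist (y' n) w') \<longlonglongrightarrow> 0"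
    using H(2) by (auto simp: operator_closure_def)
  have e: "x n \<in> ell2 V" "y n \<in> ell2 V" "x' n \<in> ell2 V" "y' n \<in> ell2 V" for n
    using G 1(3)[of n] 2(3)[of n] by blast+
  have "(\<lambda>n. ell2_inner (y n) (x' n)) \<longlonglongrightarrow> ell2_inner w u'"
    using 1 2 e by (intro ell2_inner_tendsto[of _ V])
  moreover have "(\<lambda>n. ell2_inner (x n) (y' n)) \<longlonglongrightarrow> ell2_inner u w'"
    using 1 2 e by (intro ell2_inner_tendsto[of _ V])
  moreover have "ell2_inner (y n) (x' n) = ell2_inner (x n) (y' n)" for n
    using G[OF 1(3) 2(3)] by blast
  ultimately show ?thesis using LIMSEQ_unique by fastforce
qed

lemma operator_closure_superset:
  assumes "(u, w) \<in> G" "u \<in> ell2 V" "w \<in> ell2 V"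
  shows "(u, w) \<in> operator_closure V G"
  unfolding operator_closure_def mem_Collect_eq prod.case
  by (intro conjI assms exI[of _ "\<lambda>_. u"] exI[of _ "\<lambda>_. w"]) (use assms in \<open>simp_all add: ell2_dist_def\<close>)

section \<open>Scalar measures attached to a projection-valued measure\<close>

context
  fixes V :: "'v set" and E :: "real set \<Rightarrow> ('v \<Rightarrow> complex) \<Rightarrow> ('v \<Rightarrow> complex)"
  assumes pvm: "projection_valued_measure V E"
begin

lemma pvm_ell2: "B \<in> sets borel \<Longrightarrow> u \<in> ell2 V \<Longrightarrow> E B u \<in> ell2 V"
  and pvm_idem: "B \<in> sets borel \<Longrightarrow> u \<in> ell2 V \<Longrightarrow> E B (E B u) = E B u"
  and pvm_sym: "B \<in> sets borel \<Longrightarrow> u \<in> ell2 V \<Longrightarrow> w \<in> ell2 V \<Longrightarrow> ell2_inner (E B u) w = ell2_inner u (E B w)"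
  and pvm_UNIV: "u \<in> ell2 V \<Longrightarrow> E UNIV u = u"
  and pvm_Int: "B \<in> sets borel \<Longrightarrow> C \<in> sets borel \<Longrightarrow> u \<in> ell2 V \<Longrightarrow> E (B \<inter> C) u = E B (E C u)"
  and pvm_sums: "range A \<subseteq> sets borel \<Longrightarrow> disjoint_family A \<Longrightarrow> u \<in> ell2 V \<Longrightarrow> w \<in> ell2 V \<Longrightarrow>
     (\<lambda>i. ell2_inner w (E (A i) u)) sums ell2_inner w (E (\<Union>i. A i) u)"
  using pvm unfolding projection_valued_measure_def by blast+

lemma pvm_inner_nonneg:
  assumes "B \<in> sets borel" "u \<in> ell2 V"
  shows "Re (ell2_inner u (E B u)) \<ge> 0"
proof -
  have "ell2_inner u (E B u) = ell2_inner (E B u) (E B u)"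
    using assms by (metis pvm_ell2 pvm_idem pvm_sym)
  then show ?thesis using ell2_inner_self_nonneg[OF pvm_ell2[OF assms]] by simp
qed

lemma sets_vector_measure [simp, measurable_cong]: "sets (vector_measure E u) = sets borel"
  unfolding vector_measure_def by (metis sets_measure_of sets.space_closed sets.sigma_sets_eq space_borel)

lemma space_vector_measure [simp]: "space (vector_measure E u) = UNIV"
  unfolding vector_measure_def by (metis space_measure_of sets.space_closed space_borel)

lemma emeasure_vector_measure:
  assumes u: "u \<in> ell2 V" and B: "B \<in> sets borel"
  shows "emeasure (vector_measure E u) B = ennreal (Re (ell2_inner u (E B u)))"
proof (rule emeasure_measure_of[OF vector_measure_def])
  \<comment> \<open>Additivity along constantly empty sets: a constant series converges only when
    its term is 0.\<close>
  have "(\<lambda>i::nat. ell2_inner u (E {} u)) sums ell2_inner u (E (\<Union>i::nat. {}) u)"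
    by (intro pvm_sums u) (auto simp: disjoint_family_on_def)
  then have "(\<lambda>i::nat. ell2_inner u (E {} u)) \<longlonglongrightarrow> 0"
    using summable_LIMSEQ_zero sums_summable by blast
  then have "ell2_inner u (E {} u) = 0" by (simp add: LIMSEQ_const_iff)
  then show "positive (sets (vector_measure E u)) (\<lambda>B. ennreal (Re (ell2_inner u (E B u))))"
    by (simp add: positive_def)
  show "countably_additive (sets (vector_measure E u)) (\<lambda>B. ennreal (Re (ell2_inner u (E B u))))"
  proof (rule countably_additiveI)
    fix A :: "nat \<Rightarrow> real set"
    assume A: "range A \<subseteq> sets (vector_measure E u)" "disjoint_family A"
    then have A': "A i \<in> sets borel" for i by auto
    have "(\<lambda>i. Re (ell2_inner u (E (A i) u))) sums Re (ell2_inner u (E (\<Union>i. A i) u))"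
      using A by (intro sums_Re pvm_sums u) auto
    then show "(\<Sum>i. ennreal (Re (ell2_inner u (E (A i) u)))) = ennreal (Re (ell2_inner u (E (\<Union>i. A i) u)))"
      using pvm_inner_nonneg[OF A' u] by (intro suminf_ennreal_eq) auto
  qed
qed (use B in auto)

lemma finite_vector_measure: "u \<in> ell2 V \<Longrightarrow> finite_measure (vector_measure E u)"
  by (intro finite_measureI) (simp add: emeasure_vector_measure)

lemma measure_vector_measure:
  "u \<in> ell2 V \<Longrightarrow> B \<in> sets borel \<Longrightarrow> measure (vector_measure E u) B = Re (ell2_inner u (E B u))"
  by (simp add: measure_def emeasure_vector_measure pvm_inner_nonneg)

lemma vector_measure_eqI:
  assumes "u \<in> ell2 V" "sets M = sets borel"
    "\<And>C. C \<in> sets borel \<Longrightarrow> ennreal (Re (ell2_inner u (E C u))) = emeasure M C"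
  shows "vector_measure E u = M"
  by (rule measure_eqI) (use assms in \<open>auto simp: emeasure_vector_measure\<close>)

text \<open>E B E C E B collapses to E (B \<inter> C). Vectors whose spectral mass is confined to B
  are produced in this way.\<close>

lemma vector_measure_projection:
  assumes u: "u \<in> ell2 V" and B: "B \<in> sets borel"
  shows "vector_measure E (E B u) = density (vector_measure E u) (\<lambda>x. ennreal (indicator B x))"
proof (rule vector_measure_eqI)
  show "E B u \<in> ell2 V" by (rule pvm_ell2[OF B u])
  fix C :: "real set" assume C: "C \<in> sets borel"
  have "ell2_inner (E B u) (E C (E B u)) = ell2_inner u (E B (E C (E B u)))"
    using u B C by (intro pvm_sym pvm_ell2)
  also have "E B (E C (E B u)) = E (B \<inter> C) u"
    using u B C by (metis pvm_Int pvm_ell2 pvm_idem Int_commute)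
  moreover have "(\<integral>\<^sup>+x. ennreal (indicator B x) * indicator C x \<partial>vector_measure E u) =
      (\<integral>\<^sup>+x. indicator (B \<inter> C) x \<partial>vector_measure E u)"
    by (intro nn_integral_cong) (auto simp: indicator_def)
  then have *: "(\<integral>\<^sup>+x\<in>C. ennreal (indicator B x) \<partial>vector_measure E u) = emeasure (vector_measure E u) (B \<inter> C)"
    using B C by (simp add: nn_integral_indicator sets.Int)
  ultimately show "ennreal (Re (ell2_inner (E B u) (E C (E B u)))) = emeasure (density (vector_measure E u) (\<lambda>x. ennreal (indicator B x))) C"
    using u B C by (simp add: emeasure_density emeasure_vector_measure nn_integral_indicator * sets.Int)
qed simp

section \<open>Recovering an operator from the quadratic form of its spectral resolution\<close>

context
  fixes H :: "(('v \<Rightarrow> complex) \<times> ('v \<Rightarrow> complex)) set"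
  assumes Domain: "Domain H = {u \<in> ell2 V. integrable (vector_measure E u) (\<lambda>x. x\<^sup>2)}"
    and form: "\<And>u w. (u, w) \<in> H \<Longrightarrow> ell2_inner u w = complex_of_real (LINT x|vector_measure E u. x)"
    and range: "\<And>u w. (u, w) \<in> H \<Longrightarrow> w \<in> ell2 V"
    and lin: "\<And>u w u' w' t. (u, w) \<in> H \<Longrightarrow> (u', w') \<in> H \<Longrightarrow> ((\<lambda>v. u v + t * u' v), (\<lambda>v. w v + t * w' v)) \<in> H"
    and sym: "\<And>u w u' w'. (u, w) \<in> H \<Longrightarrow> (u', w') \<in> H \<Longrightarrow> ell2_inner w u' = ell2_inner u w'"
begin

lemma domain_ell2: "(u, w) \<in> H \<Longrightarrow> u \<in> ell2 V"
  and domain_integrable: "(u, w) \<in> H \<Longrightarrow> integrable (vector_measure E u) (\<lambda>x. x\<^sup>2)"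
  using Domain by blast+

lemma domain_integrable1:
  assumes "(u, w) \<in> H"
  shows "integrable (vector_measure E u) (\<lambda>x. x)"
proof (rule Bochner_Integration.integrable_bound)
  interpret finite_measure "vector_measure E u"
    by (rule finite_vector_measure[OF domain_ell2[OF assms]])
  show "integrable (vector_measure E u) (\<lambda>x. 1 + x\<^sup>2)"
    using domain_integrable[OF assms] by simp
  show "AE x in vector_measure E u. norm x \<le> norm (1 + x\<^sup>2)"
  proof (rule AE_I2)
    fix x :: real
    have "0 \<le> (\<bar>x\<bar> - 1)\<^sup>2" by simp
    then show "norm x \<le> norm (1 + x\<^sup>2)" by (simp add: power2_diff)
  qed
qed (simp cong: measurable_cong_sets)

text \<open>Membership in the domain is a second-moment condition, and restriction to B can only
  lower the second moment.\<close>

lemma projection_domain: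
  assumes "(u, w) \<in> H" "B \<in> sets borel"
  obtains z where "(E B u, z) \<in> H"
proof -
  have u: "u \<in> ell2 V" by (rule domain_ell2[OF assms(1)])
  have "integrable (vector_measure E (E B u)) (\<lambda>x. x\<^sup>2)"
    unfolding vector_measure_projection[OF u assms(2)]
    using assms(2) integrable_mult_indicator[OF _ domain_integrable[OF assms(1)], of B]
    by (subst integrable_density) (auto cong: measurable_cong_sets)
  then show ?thesis using that Domain pvm_ell2[OF assms(2) u] by blast
qed

text \<open>E B commutes with E C, so E C (E B u) lies again in the range of E B, to which u - E B u
  is orthogonal.\<close>

lemma inner_projection_orthogonal:
  assumes u: "u \<in> ell2 V" and B: "B \<in> sets borel" and C: "C \<in> sets borel"
  shows "ell2_inner (\<lambda>v. u v - E B u v) (E C (E B u)) = 0"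
proof -
  have P: "E B u \<in> ell2 V" by (rule pvm_ell2[OF B u])
  have "ell2_inner (E B u) (E C (E B u)) = ell2_inner u (E B (E C (E B u)))"
    by (rule pvm_sym[OF B u pvm_ell2[OF C P]])
  also have "E B (E C (E B u)) = E C (E B u)"
    using u B C by (metis pvm_Int pvm_ell2 pvm_idem Int_commute)
  finally show ?thesis
    using ell2_inner_diff_left[OF pvm_ell2[OF C P] u P] by simp
qed

text \<open>The spectral resolution gives only the diagonal form <u, Hu>, not the commutation of H
  with E B. Write u = P + Q with P = E B u. The reflected vector P - Q has the same scalar measure
  as u, so the two forms agree and the cross terms cancel: <P, HQ> + <Q, HP> = 0. By symmetry these
  terms are conjugate, hence have real part 0, and what remains of Re <Hu, E B u> is <P,
  HP>.\<close>

lemma inner_projection_form: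
  assumes H1: "(u, w) \<in> H" and B: "B \<in> sets borel"
  shows "Re (ell2_inner w (E B u)) = (LINT x|vector_measure E u. indicator B x * x)"
proof -
  define P where "P = E B u"
  define Q where "Q = (\<lambda>v. u v + (-1) * P v)"
  obtain z where z: "(P, z) \<in> H" using projection_domain[OF H1 B] by (auto simp: P_def)
  define r where "r = (\<lambda>v. w v + (-1) * z v)"
  have u: "u \<in> ell2 V" and P: "P \<in> ell2 V" using H1 z by (auto dest: domain_ell2)
  have w: "w \<in> ell2 V" and z': "z \<in> ell2 V" using H1 z range by blast+
  have Qr: "(Q, r) \<in> H" unfolding Q_def r_def by (rule lin[OF H1 z])
  have Q: "Q \<in> ell2 V" and r: "r \<in> ell2 V" using Qr domain_ell2 range by blast+
  have orth: "ell2_inner Q (E C P) = 0" "ell2_inner (E C P) Q = 0" "ell2_inner (E C Q) P = 0" if C: "C \<in> sets borel" for C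
  proof -
    show 1: "ell2_inner Q (E C P) = 0"
      using inner_projection_orthogonal[OF u B C] by (simp add: Q_def P_def)
    then show "ell2_inner (E C P) Q = 0" by (metis ell2_inner_cnj complex_cnj_zero)
    show "ell2_inner (E C Q) P = 0" using 1 pvm_sym[OF C Q P] by simp
  qed
  \<comment> \<open>Mixed terms vanish by orthogonality, so t enters only through
    \<open>cnj t * t\<close>, which is 1 for both t = 1 and t = -1.\<close>
  have expand: "ell2_inner (\<lambda>v. P v + t * Q v) (E C (\<lambda>v. P v + t * Q v)) =
      ell2_inner (E C P) P + cnj t * t * ell2_inner (E C Q) Q" if C: "C \<in> sets borel" for C t
  proof -
    let ?y = "\<lambda>v. P v + t * Q v"
    have y: "?y \<in> ell2 V" by (rule ell2_lin[OF P Q])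
    have "ell2_inner ?y (E C ?y) = ell2_inner P (E C ?y) + cnj t * ell2_inner Q (E C ?y)"
      by (rule ell2_inner_lin_left[OF pvm_ell2[OF C y] P Q])
    also have "\<dots> = ell2_inner (E C P) ?y + cnj t * ell2_inner (E C Q) ?y"
      by (simp add: pvm_sym[OF C P y] pvm_sym[OF C Q y])
    also have "\<dots> = ell2_inner (E C P) P + cnj t * t * ell2_inner (E C Q) Q"
      using ell2_inner_lin_right[OF pvm_ell2[OF C P] P Q, of t] ell2_inner_lin_right[OF pvm_ell2[OF C Q] P Q, of t]
      by (simp add: orth[OF C])
    finally show ?thesis .
  qed
  have ueq: "u = (\<lambda>v. P v + 1 * Q v)" and weq: "w = (\<lambda>v. z v + 1 * r v)"
    by (simp_all add: Q_def r_def)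
  define y where "y = (\<lambda>v. P v + (-1) * Q v)"
  have yH: "(y, \<lambda>v. z v + (-1) * r v) \<in> H" unfolding y_def by (rule lin[OF z Qr])
  have "vector_measure E y = vector_measure E u"
  proof (rule vector_measure_eqI)
    show "y \<in> ell2 V" by (rule domain_ell2[OF yH])
    fix C :: "real set" assume C: "C \<in> sets borel"
    have "ell2_inner y (E C y) = ell2_inner u (E C u)"
      using expand[OF C, of "-1"] expand[OF C, of 1, folded ueq] by (simp add: y_def)
    then show "ennreal (Re (ell2_inner y (E C y))) = emeasure (vector_measure E u) C"
      by (simp add: emeasure_vector_measure[OF u C])
  qed simp
  then have "ell2_inner y (\<lambda>v. z v + (-1) * r v) = ell2_inner u w"
    using form[OF yH] form[OF H1] by simp
  moreover have "ell2_inner y (\<lambda>v. z v + (-1) * r v) =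
      ell2_inner P z - ell2_inner P r - ell2_inner Q z + ell2_inner Q r"
    unfolding y_def
    by (simp add: ell2_inner_diff_left[OF _ P Q] ell2_inner_diff_right[OF _ z' r] ell2_diff[OF z' r] P Q)
  moreover have "ell2_inner u w = ell2_inner P z + ell2_inner P r + ell2_inner Q z + ell2_inner Q r"
  proof -
    have "ell2_inner u w = ell2_inner (\<lambda>v. P v + 1 * Q v) w" using ueq by simp
    also have "\<dots> = ell2_inner P w + ell2_inner Q w"
      using ell2_inner_lin_left[OF w P Q, of 1] by simp
    also have "ell2_inner P w = ell2_inner P z + ell2_inner P r"
      using ell2_inner_lin_right[OF P z' r, of 1] weq by simp
    also have "ell2_inner Q w = ell2_inner Q z + ell2_inner Q r"
      using ell2_inner_lin_right[OF Q z' r, of 1] weq by simp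
    finally show ?thesis by simp
  qed
  ultimately have "ell2_inner P r + ell2_inner Q z = 0" by algebra
  moreover have "ell2_inner Q z = cnj (ell2_inner P r)"
    using sym[OF Qr z] ell2_inner_cnj[of r P] by simp
  ultimately have "Re (ell2_inner P r) = 0" by (metis complex_add_cnj mult_eq_0_iff of_real_eq_0_iff zero_neq_numeral)
  moreover have "ell2_inner P w = ell2_inner P z + ell2_inner P r"
    using ell2_inner_lin_right[OF P z' r, of 1] weq by simp
  moreover have "Re (ell2_inner w P) = Re (ell2_inner P w)"
    by (subst ell2_inner_cnj) simp
  ultimately have "Re (ell2_inner w P) = Re (ell2_inner P z)" by simp
  also have "\<dots> = (LINT x|vector_measure E P. x)" by (simp add: form[OF z])
  also have "\<dots> = (LINT x|vector_measure E u. indicator B x * x)"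
    unfolding P_def vector_measure_projection[OF u B]
    using B by (subst integral_density) (auto cong: measurable_cong_sets)
  finally show ?thesis by (simp add: P_def)
qed

text \<open>Polarization between u and P = E B w, where w = Hu: the first moments at u + P and u - P
  differ by 4 Re <w, P>, and their scalar measures differ by 4 times the signed measure with density
  1_B(x) x with respect to the measure at u. Integrating x against the latter gives 4 times the
  integral of x^2 over B, so <w, E B w> is that integral.\<close>

lemma vector_measure_image:
  assumes H1: "(u, w) \<in> H" and H2: "(w, w2) \<in> H"
  shows "vector_measure E w = density (vector_measure E u) (\<lambda>x. ennreal (x\<^sup>2))"
proof (rule vector_measure_eqI)
  have u: "u \<in> ell2 V" and w: "w \<in> ell2 V" using H1 H2 by (auto dest: domain_ell2)
  show "w \<in> ell2 V" by (rule w)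
  fix B :: "real set" assume B: "B \<in> sets borel"
  interpret Eu: finite_measure "vector_measure E u" by (rule finite_vector_measure[OF u])
  obtain z where z: "(E B w, z) \<in> H" using projection_domain[OF H2 B] by blast
  define P where "P = E B w"
  define a where "a t = (\<lambda>v. u v + complex_of_real t * P v)" for t
  have P: "P \<in> ell2 V" using z by (auto simp: P_def dest: domain_ell2)
  have z': "z \<in> ell2 V" using z range by blast
  have aH: "(a t, \<lambda>v. w v + complex_of_real t * z v) \<in> H" for t
    unfolding a_def by (rule lin[OF H1]) (use z in \<open>simp add: P_def\<close>)
  have a: "a t \<in> ell2 V" for t by (rule domain_ell2[OF aH])
  have expand: "ell2_inner (a t) (\<lambda>v. w v + complex_of_real t * z v) =
      ell2_inner u w + t * (ell2_inner u z + ell2_inner P w) + (complex_of_real t)\<^sup>2 * ell2_inner P z" for t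
  proof -
    have "ell2_inner (a t) (\<lambda>v. w v + complex_of_real t * z v) = ell2_inner u (\<lambda>v. w v + complex_of_real t * z v)
        + t * ell2_inner P (\<lambda>v. w v + complex_of_real t * z v)"
      unfolding a_def using ell2_inner_lin_left[OF ell2_lin[OF w z'] u P] by simp
    also have "\<dots> = ell2_inner u w + t * (ell2_inner u z + ell2_inner P w) + (complex_of_real t)\<^sup>2 * ell2_inner P z"
      by (simp add: ell2_inner_lin_right[OF u w z'] ell2_inner_lin_right[OF P w z'] power2_eq_square algebra_simps)
    finally show ?thesis .
  qed
  have "complex_of_real ((LINT x|vector_measure E (a 1). x) - (LINT x|vector_measure E (a (-1)). x))
      = 2 * (ell2_inner u z + ell2_inner P w)"
    using form[OF aH[of 1]] form[OF aH[of "-1"]] expand[of 1] expand[of "-1"] by simp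
  also have "ell2_inner u z = ell2_inner w P"
    using sym[OF H1 z] by (simp add: P_def)
  also have "ell2_inner P w = ell2_inner w P"
    using pvm_sym[OF B w w] by (simp add: P_def)
  finally have diff: "(LINT x|vector_measure E (a 1). x) - (LINT x|vector_measure E (a (-1)). x) = 4 * Re (ell2_inner w P)"
    by (metis Re_complex_of_real mult_2 plus_complex.sel(1) numeral_Bit0 numeral_code(2) mult.assoc numeral_plus_numeral semiring_norm(2) mult_2_right)
  have meas: "measure (vector_measure E (a 1)) C - measure (vector_measure E (a (-1))) C =
      4 * (LINT x|vector_measure E u. indicator (B \<inter> C) x * x)" if C: "C \<in> sets borel" for C
  proof -
    have expand: "ell2_inner (a t) (E C (a t)) = ell2_inner (E C u) u + t * (ell2_inner (E C u) P + ell2_inner (E C P) u)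
        + (complex_of_real t)\<^sup>2 * ell2_inner (E C P) P" for t
    proof -
      have "ell2_inner (a t) (E C (a t)) = ell2_inner u (E C (a t)) + t * ell2_inner P (E C (a t))"
        unfolding a_def using ell2_inner_lin_left[OF pvm_ell2[OF C a[of t, unfolded a_def]] u P] by simp
      also have "\<dots> = ell2_inner (E C u) (a t) + t * ell2_inner (E C P) (a t)"
        by (simp add: pvm_sym[OF C u a] pvm_sym[OF C P a])
      also have "\<dots> = ell2_inner (E C u) u + t * (ell2_inner (E C u) P + ell2_inner (E C P) u)
          + (complex_of_real t)\<^sup>2 * ell2_inner (E C P) P"
        unfolding a_def ell2_inner_lin_right[OF pvm_ell2[OF C u] u P] ell2_inner_lin_right[OF pvm_ell2[OF C P] u P]
        by (simp add: power2_eq_square algebra_simps)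
      finally show ?thesis .
    qed
    have "measure (vector_measure E (a 1)) C - measure (vector_measure E (a (-1))) C =
        2 * Re (ell2_inner (E C u) P + ell2_inner (E C P) u)"
      using expand[of 1] expand[of "-1"] by (simp add: measure_vector_measure[OF a C])
    also have "ell2_inner (E C P) u = ell2_inner P (E C u)" by (rule pvm_sym[OF C P u])
    also have "Re (ell2_inner (E C u) P + ell2_inner P (E C u)) = 2 * Re (ell2_inner P (E C u))"
      by (subst ell2_inner_cnj) simp
    also have "ell2_inner P (E C u) = ell2_inner w (E (B \<inter> C) u)"
      unfolding P_def by (simp add: pvm_sym[OF B w pvm_ell2[OF C u]] pvm_Int[OF B C u])
    also have "Re \<dots> = (LINT x|vector_measure E u. indicator (B \<inter> C) x * x)"
      using B C by (intro inner_projection_form H1) auto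
    finally show ?thesis by simp
  qed
  \<comment> \<open>The factor x changes sign, so the signed measure with density 1_B(x) x is
    represented by two positive densities, split at 0.\<close>
  define Dp where "Dp = density (vector_measure E u) (\<lambda>x. ennreal (indicator (B \<inter> {0..}) x * x))"
  define Dn where "Dn = density (vector_measure E u) (\<lambda>x. ennreal (indicator (B \<inter> {..<0}) x * (- x)))"
  have Bs: "B \<inter> {0..} \<in> sets borel" "B \<inter> {..<0} \<in> sets borel" using B by auto
  have nn: "0 \<le> indicator (B \<inter> {0..}) x * x" "0 \<le> indicator (B \<inter> {..<0}) x * (- x)" for x :: real
    by (auto simp: indicator_def)
  note i1 = domain_integrable1[OF H1] and i2 = domain_integrable[OF H1]
  have ii: "integrable (vector_measure E u) (\<lambda>x. indicator S x * x)" "integrable (vector_measure E u) (\<lambda>x. indicator S x * x\<^sup>2)"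
    if "S \<in> sets borel" for S :: "real set"
    using integrable_mult_indicator[OF _ i1, of S] integrable_mult_indicator[OF _ i2, of S] that by simp_all
  have Dmeas: "finite_measure (density (vector_measure E u) (\<lambda>x. ennreal (h x))) \<and>
      measure (density (vector_measure E u) (\<lambda>x. ennreal (h x))) C = (LINT x|vector_measure E u. indicator C x * h x)"
    if h: "integrable (vector_measure E u) h" "\<And>x. 0 \<le> h x" and C: "C \<in> sets borel" for h C
  proof -
    have [measurable]: "h \<in> borel_measurable borel" using h(1) by (auto cong: measurable_cong_sets)
    have em: "emeasure (density (vector_measure E u) (\<lambda>x. ennreal (h x))) C = ennreal (LINT x|vector_measure E u. indicator C x * h x)"
      if [measurable]: "C \<in> sets borel" for C
    proof -
      have "integrable (vector_measure E u) (\<lambda>x. indicator C x * h x)"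
        using integrable_mult_indicator[OF _ h(1), of C] that by simp
      then have "(\<integral>\<^sup>+x. ennreal (indicator C x * h x) \<partial>vector_measure E u) = ennreal (LINT x|vector_measure E u. indicator C x * h x)"
        using h by (subst nn_integral_eq_integral) auto
      moreover have "ennreal (h x) * indicator C x = ennreal (indicator C x * h x)" for x
        by (simp add: indicator_def)
      ultimately show ?thesis by (simp add: emeasure_density cong: measurable_cong_sets)
    qed
    have "0 \<le> (LINT x|vector_measure E u. indicator C x * h x)"
      using h by (intro Bochner_Integration.integral_nonneg) auto
    then show ?thesis using em[OF C] em[of UNIV] by (auto intro!: finite_measureI simp: measure_def)
  qed
  \<comment> \<open>The polarized difference minus 4 \<open>Dp\<close> plus 4 \<open>Dn\<close>
    vanishes on Borel sets; the relation is transferred to the integrals of x.\<close>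
  let ?M = "[vector_measure E (a 1), vector_measure E (a (-1)), Dp, Dn]"
  have "(\<Sum>i\<in>{..<4::nat}. ([1,-1,-4,4] ! i) * (LINT x|(?M ! i). x)) = 0"
  proof (rule integral_combination_eq_0[where N = borel])
    fix i :: nat assume "i \<in> {..<4}"
    then have i: "i = 0 \<or> i = 1 \<or> i = 2 \<or> i = 3" by auto
    have "finite_measure Dp" "finite_measure Dn"
      using Dmeas[OF ii(1)[OF Bs(1)] nn(1), of UNIV] Dmeas[of "\<lambda>x. indicator (B \<inter> {..<0}) x * (- x)" UNIV] ii(1)[OF Bs(2)] nn(2)
      by (auto simp: Dp_def Dn_def)
    then show "finite_measure (?M ! i)"
      using i finite_vector_measure[OF a] by (elim disjE; simp)
    show "sets (?M ! i) = sets borel"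
      using i by (elim disjE; simp add: Dp_def Dn_def)
    have "integrable Dp (\<lambda>x. x)"
      unfolding Dp_def using Bs nn ii(2)[OF Bs(1)]
      by (subst integrable_density) (auto simp: power2_eq_square mult.assoc cong: measurable_cong_sets)
    moreover have "integrable Dn (\<lambda>x. x)"
      unfolding Dn_def using Bs nn ii(2)[OF Bs(2)]
      by (subst integrable_density) (auto simp: power2_eq_square mult.assoc cong: measurable_cong_sets)
    ultimately show "integrable (?M ! i) (\<lambda>x. x)"
      using i domain_integrable1[OF aH] by (elim disjE; simp)
  next
    fix C :: "real set" assume C: "C \<in> sets borel"
    have "measure Dp C - measure Dn C = (LINT x|vector_measure E u. indicator C x * (indicator (B \<inter> {0..}) x * x))
        - (LINT x|vector_measure E u. indicator C x * (indicator (B \<inter> {..<0}) x * (- x)))"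
      using Dmeas[OF ii(1)[OF Bs(1)] nn(1) C] Dmeas[OF _ nn(2) C] ii(1)[OF Bs(2)] by (simp add: Dp_def Dn_def)
    also have "\<dots> = (LINT x|vector_measure E u. indicator (B \<inter> C) x * x)"
      using ii(1)[of "B \<inter> C \<inter> {0..}"] ii(1)[of "B \<inter> C \<inter> {..<0}"] B C
      apply (subst Bochner_Integration.integral_diff[symmetric])
      subgoal using integrable_mult_indicator[OF _ ii(1)[OF Bs(1)], of C] C by simp
      subgoal using integrable_mult_indicator[OF _ ii(1)[OF Bs(2)], of C] C by simp
      by (intro Bochner_Integration.integral_cong) (auto simp: indicator_def)
    finally show "(\<Sum>i\<in>{..<4::nat}. ([1,-1,-4,4] ! i) * measure (?M ! i) C) = 0"
      using meas[OF C] by (simp add: eval_nat_numeral lessThan_Suc)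
  qed simp
  then have "4 * Re (ell2_inner w P) = 4 * ((LINT x|Dp. x) - (LINT x|Dn. x))"
    using diff by (simp add: eval_nat_numeral lessThan_Suc)
  also have "(LINT x|Dp. x) - (LINT x|Dn. x) = (LINT x|vector_measure E u. indicator (B \<inter> {0..}) x * x\<^sup>2)
      - (LINT x|vector_measure E u. indicator (B \<inter> {..<0}) x * (- (x\<^sup>2)))"
    unfolding Dp_def Dn_def using Bs nn
    by (subst (1 2) integral_density) (auto simp: power2_eq_square mult.assoc cong: measurable_cong_sets)
  also have "\<dots> = (LINT x|vector_measure E u. indicator B x * x\<^sup>2)"
    apply (subst Bochner_Integration.integral_diff[symmetric])
    subgoal using ii(2)[OF Bs(1)] .
    subgoal using ii(2)[OF Bs(2)] by simp
    by (intro Bochner_Integration.integral_cong) (auto simp: indicator_def)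
  finally have "Re (ell2_inner w P) = (LINT x|vector_measure E u. indicator B x * x\<^sup>2)" by simp
  moreover have "emeasure (density (vector_measure E u) (\<lambda>x. ennreal (x\<^sup>2))) B = ennreal (LINT x|vector_measure E u. indicator B x * x\<^sup>2)"
  proof -
    have "finite_measure (density (vector_measure E u) (\<lambda>x. ennreal (x\<^sup>2)))"
      "measure (density (vector_measure E u) (\<lambda>x. ennreal (x\<^sup>2))) B = (LINT x|vector_measure E u. indicator B x * x\<^sup>2)"
      using Dmeas[OF i2 _ B] by auto
    then show ?thesis by (simp add: finite_measure.emeasure_eq_measure)
  qed
  ultimately show "ennreal (Re (ell2_inner w (E B w))) = emeasure (density (vector_measure E u) (\<lambda>x. ennreal (x\<^sup>2))) B"
    by (simp add: P_def)
qed simp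

text \<open>Iterating the image formula, the measure at \<open>e n\<close> is x^(2n) times the
  measure at \<open>e 0\<close>. Even moments are thus total masses, that is squared norms of
  \<open>e n\<close>; odd moments are the quadratic form at \<open>e n\<close>.\<close>

lemma spectral_moments:
  assumes e: "\<And>n. (e n, e (Suc n)) \<in> H"
  shows "integrable (vector_measure E (e 0)) (\<lambda>x. x ^ k)" (is ?int)
    and "complex_of_real (LINT x|vector_measure E (e 0). x ^ k) = ell2_inner (e (k div 2)) (e (k - k div 2))" (is ?eq)
proof -
  have dens: "vector_measure E (e n) = density (vector_measure E (e 0)) (\<lambda>x. ennreal (x ^ (2 * n)))" for n
  proof (induction n)
    case 0
    show ?case by (simp add: density_1)
  next
    case (Suc n)
    have "ennreal (x ^ (2 * n)) * ennreal (x\<^sup>2) = ennreal (x ^ (2 * Suc n))" for x :: real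
    proof -
      have "ennreal (x ^ (2 * n)) * ennreal (x\<^sup>2) = ennreal (x ^ (2 * n) * x\<^sup>2)"
        by (intro ennreal_mult[symmetric]) auto
      also have "x ^ (2 * n) * x\<^sup>2 = x ^ (2 * Suc n)" by (simp add: power2_eq_square mult_ac)
      finally show ?thesis .
    qed
    then show ?case
      unfolding vector_measure_image[OF e e, of n] Suc.IH
      by (subst density_density_eq) (auto cong: measurable_cong_sets)
  qed
  have en: "e n \<in> ell2 V" for n by (rule domain_ell2[OF e])
  have even: "integrable (vector_measure E (e 0)) (\<lambda>x. x ^ (2 * n)) \<and>
      complex_of_real (LINT x|vector_measure E (e 0). x ^ (2 * n)) = ell2_inner (e n) (e n)" for n
  proof -
    have "emeasure (vector_measure E (e n)) UNIV = (\<integral>\<^sup>+x. ennreal (x ^ (2 * n)) \<partial>vector_measure E (e 0))"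
      by (subst dens) (simp add: emeasure_density cong: measurable_cong_sets)
    then have nn: "(\<integral>\<^sup>+x. ennreal (x ^ (2 * n)) \<partial>vector_measure E (e 0)) = ennreal (Re (ell2_inner (e n) (e n)))"
      by (simp add: emeasure_vector_measure[OF en] pvm_UNIV[OF en])
    have "Re (ell2_inner (e n) (e n)) \<ge> 0" by (rule ell2_inner_self_nonneg[OF en])
    then have "has_bochner_integral (vector_measure E (e 0)) (\<lambda>x. x ^ (2 * n)) (Re (ell2_inner (e n) (e n)))"
      using nn by (intro has_bochner_integral_nn_integral) (auto cong: measurable_cong_sets)
    moreover have "Im (ell2_inner (e n) (e n)) = 0"
      using ell2_inner_cnj[of "e n" "e n"] by (simp add: complex_eq_iff)
    ultimately show ?thesis by (auto simp: has_bochner_integral_iff complex_eq_iff)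
  qed
  have "?int \<and> ?eq"
  proof (cases "even k")
    case True
    then obtain n where "k = 2 * n" by auto
    then show ?thesis using even[of n] by (simp add: mult_2)
  next
    case False
    then obtain n where k: "k = 2 * n + 1" by (auto elim: oddE)
    have xk: "x ^ k = x ^ (2 * n) * x" for x :: real by (simp add: k)
    have "integrable (vector_measure E (e n)) (\<lambda>x. x)" by (rule domain_integrable1[OF e])
    then have "integrable (vector_measure E (e 0)) (\<lambda>x. x ^ k)"
      unfolding dens[of n] by (subst (asm) integrable_density) (auto simp: xk cong: measurable_cong_sets)
    moreover have "ell2_inner (e n) (e (Suc n)) = complex_of_real (LINT x|vector_measure E (e n). x)"
      by (rule form[OF e])
    moreover have "(LINT x|vector_measure E (e n). x) = (LINT x|vector_measure E (e 0). x ^ k)"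
      unfolding dens[of n] by (subst integral_density) (auto simp: xk cong: measurable_cong_sets)
    ultimately show ?thesis using k by simp
  qed
  then show ?int ?eq by blast+
qed

end
end

section \<open>Closed walks in a tree\<close>

text \<open>Addresses grow at the head, so the step out of the root is the last entry: a vertex at
  or below the i-th child has an address ending in i.\<close>

definition subtree :: "nat \<Rightarrow> (nat list \<Rightarrow> nat) \<Rightarrow> nat list \<Rightarrow> nat" where
  "subtree i N v = N (v @ [i])"

definition adj_set :: "(nat list \<Rightarrow> nat) \<Rightarrow> nat list \<Rightarrow> nat list set" where
  "adj_set N v = {w. tree_adj N v w}"

text \<open>Counts walks from v to the root. Read as a function of v, this is the n-th power of the
  adjacency operator applied to the root vector.\<close>

fun walks :: "(nat list \<Rightarrow> nat) \<Rightarrow> nat \<Rightarrow> nat list \<Rightarrow> nat" where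
  "walks N 0 v = (if v = [] then 1 else 0)"
| "walks N (Suc n) v = (\<Sum>w\<in>adj_set N v. walks N n w)"

definition closed_walks :: "nat \<Rightarrow> (nat list \<Rightarrow> nat) \<Rightarrow> nat" where
  "closed_walks n N = walks N n []"

lemma in_tree_append: "in_tree N (v @ [i]) \<longleftrightarrow> i < N [] \<and> in_tree (subtree i N) v"
  by (induction v) (auto simp: subtree_def)

lemma tree_adj_sym: "tree_adj N u v \<longleftrightarrow> tree_adj N v u"
  by (auto simp: tree_adj_def)

lemma adj_set_subset: "adj_set N v \<subseteq> insert (tl v) ((\<lambda>i. i # v) ` {..<N v})"
  by (auto simp: adj_set_def tree_adj_def tree_vertices_def)

lemma finite_adj_set: "finite (adj_set N v)"
  by (rule finite_subset[OF adj_set_subset]) auto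

lemma adj_set_root: "adj_set N [] = (\<lambda>i. [i]) ` {..<N []}"
  by (auto simp: adj_set_def tree_adj_def tree_vertices_def)

lemma adj_set_subtree:
  assumes i: "i < N []" and v: "in_tree (subtree i N) v"
  shows "adj_set N (v @ [i]) = (if v = [] then {[]} else {}) \<union> (\<lambda>w. w @ [i]) ` adj_set (subtree i N) v"
proof (intro set_eqI iffI)
  fix w assume "w \<in> adj_set N (v @ [i])"
  then have w: "in_tree N w" "(\<exists>j. v @ [i] = j # w) \<or> (\<exists>j. w = j # v @ [i])"
    by (auto simp: adj_set_def tree_adj_def tree_vertices_def)
  from w(2) show "w \<in> (if v = [] then {[]} else {}) \<union> (\<lambda>w. w @ [i]) ` adj_set (subtree i N) v"
  proof
    assume "\<exists>j. v @ [i] = j # w"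
    then show ?thesis
      using w(1) v i by (cases v) (auto simp: adj_set_def tree_adj_def tree_vertices_def in_tree_append)
  next
    assume "\<exists>j. w = j # v @ [i]"
    then obtain j where j: "w = (j # v) @ [i]" by auto
    then have "in_tree (subtree i N) (j # v)" using w(1) by (simp only: in_tree_append)
    then show ?thesis using v j by (auto simp: adj_set_def tree_adj_def tree_vertices_def)
  qed
next
  fix w assume "w \<in> (if v = [] then {[]} else {}) \<union> (\<lambda>w. w @ [i]) ` adj_set (subtree i N) v"
  then consider "v = []" "w = []" | w' where "w = w' @ [i]" "w' \<in> adj_set (subtree i N) v"
    by (auto split: if_splits)
  then show "w \<in> adj_set N (v @ [i])"
  proof cases
    case 1
    then show ?thesis using i by (auto simp: adj_set_def tree_adj_def tree_vertices_def)
  next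
    case 2
    then show ?thesis using i
      by (auto simp: adj_set_def tree_adj_def tree_vertices_def in_tree_append)
  qed
qed

text \<open>A walk to the root is split at its first visit to the root.\<close>

lemma walks_subtree:
  assumes i: "i < N []" and v: "in_tree (subtree i N) v"
  shows "walks N n (v @ [i]) = (\<Sum>a<n. walks (subtree i N) a v * walks N (n - 1 - a) [])"
  using v
proof (induction n arbitrary: v)
  case (Suc n)
  let ?S = "subtree i N"
  have disj: "(if v = [] then {[]} else {}) \<inter> (\<lambda>w. w @ [i]) ` adj_set ?S v = {}" by auto
  have "walks N (Suc n) (v @ [i]) = (\<Sum>w\<in>(if v = [] then {[]} else {}). walks N n w) + (\<Sum>w\<in>adj_set ?S v. walks N n (w @ [i]))"
    by (simp only: walks.simps adj_set_subtree[of i N v, OF i Suc.prems])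
      (subst sum.union_disjoint[OF _ _ disj], auto simp: finite_adj_set sum.reindex inj_on_def)
  also have "(\<Sum>w\<in>adj_set ?S v. walks N n (w @ [i])) =
      (\<Sum>w\<in>adj_set ?S v. \<Sum>a<n. walks ?S a w * walks N (n - 1 - a) [])"
    by (intro sum.cong Suc.IH) (auto simp: adj_set_def tree_adj_def tree_vertices_def)
  also have "\<dots> = (\<Sum>a<n. walks ?S (Suc a) v * walks N (n - Suc a) [])"
    by (subst sum.swap) (simp add: sum_distrib_right)
  also have "(\<Sum>w\<in>(if v = [] then {[]} else {}). walks N n w) = walks ?S 0 v * walks N n []" by simp
  also have "walks ?S 0 v * walks N n [] + (\<Sum>a<n. walks ?S (Suc a) v * walks N (n - Suc a) []) =
      (\<Sum>a<Suc n. walks ?S a v * walks N (Suc n - 1 - a) [])"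
    by (subst sum.lessThan_Suc_shift) simp
  finally show ?case .
qed simp

lemma closed_walks_0 [simp]: "closed_walks 0 N = 1"
  by (simp add: closed_walks_def)

lemma closed_walks_1 [simp]: "closed_walks (Suc 0) N = 0"
  by (auto simp: closed_walks_def adj_set_root)

text \<open>The first excursion from the root is a step to child i, a closed walk of length a in its
  subtree and a step back; any closed walk of length n - a may follow. The two steps explain the
  double successor.\<close>

lemma closed_walks_Suc_Suc:
  "closed_walks (Suc (Suc n)) N =
     (\<Sum>a\<le>n. (\<Sum>i<N []. closed_walks a (subtree i N)) * closed_walks (n - a) N)"
proof -
  have "closed_walks (Suc (Suc n)) N = (\<Sum>i<N []. walks N (Suc n) ([] @ [i]))"
    unfolding closed_walks_def by (subst walks.simps) (simp add: adj_set_root sum.reindex inj_on_def)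
  also have "\<dots> = (\<Sum>i<N []. \<Sum>a<Suc n. walks (subtree i N) a [] * walks N (Suc n - 1 - a) [])"
    by (intro sum.cong refl walks_subtree) auto
  also have "\<dots> = (\<Sum>a\<le>n. (\<Sum>i<N []. closed_walks a (subtree i N)) * closed_walks (n - a) N)"
    unfolding closed_walks_def by (subst sum.swap) (simp add: sum_distrib_right lessThan_Suc_atMost)
  finally show ?thesis .
qed

lemma closed_walks_odd: "odd n \<Longrightarrow> closed_walks n N = 0"
proof (induction n arbitrary: N rule: less_induct)
  case (less n)
  show ?case
  proof (cases "n = 1")
    case False
    then obtain m where m: "n = Suc (Suc m)"
      using less.prems by (metis One_nat_def even_zero not0_implies_Suc)
    then have "odd m" using less.prems by simp
    have "(\<Sum>i<N []. closed_walks a (subtree i N)) * closed_walks (m - a) N = 0" if "a \<le> m" for a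
    proof (cases "odd a")
      case True
      then show ?thesis using less.IH[of a] that m by simp
    next
      case False
      then have "odd (m - a)" using \<open>odd m\<close> that by simp
      then show ?thesis using less.IH[of "m - a"] m by simp
    qed
    then show ?thesis unfolding m closed_walks_Suc_Suc by (intro sum.neutral) auto
  qed simp
qed

definition half_walks :: "nat \<Rightarrow> (nat list \<Rightarrow> nat) \<Rightarrow> nat" where
  "half_walks k N = closed_walks (2 * k) N"

lemma half_walks_0 [simp]: "half_walks 0 N = 1"
  by (simp add: half_walks_def)

text \<open>Odd lengths carry no closed walks, so the convolution can be halved; the term a belongs
  to an excursion of half-length a + 1.\<close>

lemma half_walks_Suc:
  "half_walks (Suc k) N = (\<Sum>a\<le>k. (\<Sum>i<N []. half_walks a (subtree i N)) * half_walks (k - a) N)"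
proof -
  let ?g = "\<lambda>a. (\<Sum>i<N []. closed_walks a (subtree i N)) * closed_walks (2 * k - a) N"
  have "half_walks (Suc k) N = (\<Sum>a\<le>2 * k. ?g a)"
    unfolding half_walks_def using closed_walks_Suc_Suc[of "2 * k" N] by simp
  also have "\<dots> = (\<Sum>a\<in>(\<lambda>a. 2 * a) ` {..k}. ?g a)"
  proof (rule sum.mono_neutral_right)
    show "\<forall>a\<in>{..2 * k} - (\<lambda>a. 2 * a) ` {..k}. ?g a = 0"
    proof
      fix a assume a: "a \<in> {..2 * k} - (\<lambda>a. 2 * a) ` {..k}"
      have "odd a"
      proof
        assume "even a"
        then obtain b where "a = 2 * b" by auto
        then show False using a by auto
      qed
      then show "?g a = 0" by (simp add: closed_walks_odd)
    qed
  qed auto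
  also have "\<dots> = (\<Sum>a\<le>k. (\<Sum>i<N []. half_walks a (subtree i N)) * half_walks (k - a) N)"
    by (subst sum.reindex) (auto simp: inj_on_def half_walks_def diff_mult_distrib2)
  finally show ?thesis .
qed

section \<open>The adjacency operator on finitely supported functions\<close>

lemma ell2_finite_support:
  assumes "finite F" "\<And>v. u v \<noteq> 0 \<Longrightarrow> v \<in> F" "\<And>v. u v \<noteq> 0 \<Longrightarrow> v \<in> V"
  shows "u \<in> ell2 V"
proof -
  have "(\<lambda>v. (cmod (u v))\<^sup>2) summable_on UNIV \<longleftrightarrow> (\<lambda>v. (cmod (u v))\<^sup>2) summable_on F"
    by (rule summable_on_cong_neutral) (use assms in auto)
  then show ?thesis using assms by (auto simp: ell2_def)
qed

lemma ell2_inner_finite_support: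
  assumes "finite F" "\<And>v. u v \<noteq> 0 \<Longrightarrow> w v \<noteq> 0 \<Longrightarrow> v \<in> F"
  shows "ell2_inner u w = (\<Sum>v\<in>F. cnj (u v) * w v)"
proof -
  have "ell2_inner u w = (\<Sum>\<^sub>\<infinity>v\<in>F. cnj (u v) * w v)"
    unfolding ell2_inner_def by (rule infsum_cong_neutral) (use assms in auto)
  then show ?thesis using assms by simp
qed

lemma scaled_adjacency_ell2:
  assumes "(x, y) \<in> scaled_adjacency s N"
  shows "x \<in> ell2 (tree_vertices N)" "y \<in> ell2 (tree_vertices N)"
proof -
  have x: "finite {v. x v \<noteq> 0}" "{v. x v \<noteq> 0} \<subseteq> tree_vertices N"
    and y: "y = (\<lambda>v. complex_of_real s * (\<Sum>w | tree_adj N v w. x w))"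
    using assms by (auto simp: scaled_adjacency_def)
  show "x \<in> ell2 (tree_vertices N)"
    using x by (intro ell2_finite_support[of "{v. x v \<noteq> 0}"]) auto
  have supp: "\<exists>w. tree_adj N v w \<and> x w \<noteq> 0" if "y v \<noteq> 0" for v
    using that unfolding y by (metis (mono_tags, lifting) mem_Collect_eq mult_zero_right sum.neutral)
  show "y \<in> ell2 (tree_vertices N)"
  proof (rule ell2_finite_support)
    show "finite (\<Union>w\<in>{v. x v \<noteq> 0}. adj_set N w)" using x finite_adj_set by blast
    show "v \<in> (\<Union>w\<in>{v. x v \<noteq> 0}. adj_set N w)" if "y v \<noteq> 0" for v
      using supp[OF that] tree_adj_sym by (auto simp: adj_set_def)
    show "v \<in> tree_vertices N" if "y v \<noteq> 0" for v
      using supp[OF that] by (auto simp: tree_adj_def)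
  qed
qed

lemma scaled_adjacency_lin:
  assumes "(x, y) \<in> scaled_adjacency s N" "(x', y') \<in> scaled_adjacency s N"
  shows "((\<lambda>v. x v + t * x' v), (\<lambda>v. y v + t * y' v)) \<in> scaled_adjacency s N"
proof -
  have x: "finite {v. x v \<noteq> 0}" "{v. x v \<noteq> 0} \<subseteq> tree_vertices N"
    and y: "y = (\<lambda>v. complex_of_real s * (\<Sum>w | tree_adj N v w. x w))"
    and x': "finite {v. x' v \<noteq> 0}" "{v. x' v \<noteq> 0} \<subseteq> tree_vertices N"
    and y': "y' = (\<lambda>v. complex_of_real s * (\<Sum>w | tree_adj N v w. x' w))"
    using assms by (auto simp: scaled_adjacency_def)
  have sub: "{v. x v + t * x' v \<noteq> 0} \<subseteq> {v. x v \<noteq> 0} \<union> {v. x' v \<noteq> 0}" by auto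
  have "(\<lambda>v. y v + t * y' v) = (\<lambda>v. complex_of_real s * (\<Sum>w | tree_adj N v w. x w + t * x' w))"
    unfolding y y' by (simp add: sum.distrib sum_distrib_left algebra_simps)
  moreover have "finite {v. x v + t * x' v \<noteq> 0}" "{v. x v + t * x' v \<noteq> 0} \<subseteq> tree_vertices N"
    using finite_subset[OF sub] sub x x' by auto
  ultimately show ?thesis unfolding scaled_adjacency_def by blast
qed

text \<open>Both sides become double sums over the finite union F of the two supports, with
  \<open>tree_adj\<close> as kernel; its symmetry allows the exchange of the two indices.\<close>

lemma scaled_adjacency_symmetric:
  assumes "(x, y) \<in> scaled_adjacency s N" "(x', y') \<in> scaled_adjacency s N"
  shows "ell2_inner y x' = ell2_inner x y'"
proof -
  have x: "finite {v. x v \<noteq> 0}"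
    and y: "y = (\<lambda>v. complex_of_real s * (\<Sum>w\<in>adj_set N v. x w))"
    and x': "finite {v. x' v \<noteq> 0}"
    and y': "y' = (\<lambda>v. complex_of_real s * (\<Sum>w\<in>adj_set N v. x' w))"
    using assms by (auto simp: scaled_adjacency_def adj_set_def)
  define F where "F = {v. x v \<noteq> 0} \<union> {v. x' v \<noteq> 0}"
  have F: "finite F" using x x' by (simp add: F_def)
  have restrict: "(\<Sum>w\<in>adj_set N v. u w) = (\<Sum>w\<in>F. if tree_adj N v w then u w else 0)"
    if "\<And>w. u w \<noteq> 0 \<Longrightarrow> w \<in> F" for u :: "nat list \<Rightarrow> complex" and v
  proof -
    have "(\<Sum>w\<in>adj_set N v. u w) = (\<Sum>w\<in>adj_set N v \<inter> F. u w)"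
      using that by (intro sum.mono_neutral_right finite_adj_set) auto
    also have "\<dots> = (\<Sum>w\<in>F. if w \<in> adj_set N v then u w else 0)"
      using F by (simp add: sum.inter_restrict Int_commute)
    finally show ?thesis by (simp add: adj_set_def)
  qed
  have ry: "y v = complex_of_real s * (\<Sum>w\<in>F. if tree_adj N v w then x w else 0)"
    and ry': "y' v = complex_of_real s * (\<Sum>w\<in>F. if tree_adj N v w then x' w else 0)" for v
    unfolding y y' using restrict[of x v] restrict[of x' v] by (auto simp: F_def)
  have "ell2_inner y x' = (\<Sum>v\<in>F. cnj (y v) * x' v)"
    by (rule ell2_inner_finite_support[OF F]) (auto simp: F_def)
  also have "\<dots> = (\<Sum>v\<in>F. \<Sum>w\<in>F. complex_of_real s * (if tree_adj N v w then cnj (x w) * x' v else 0))"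
    unfolding ry by (intro sum.cong refl) (auto simp: sum_distrib_left sum_distrib_right intro!: sum.cong)
  also have "\<dots> = (\<Sum>w\<in>F. \<Sum>v\<in>F. complex_of_real s * (if tree_adj N w v then cnj (x w) * x' v else 0))"
    by (subst sum.swap) (simp add: tree_adj_sym)
  also have "\<dots> = (\<Sum>w\<in>F. cnj (x w) * y' w)"
    unfolding ry' by (intro sum.cong refl) (auto simp: sum_distrib_left intro!: sum.cong)
  also have "\<dots> = ell2_inner x y'"
    by (rule ell2_inner_finite_support[OF F, symmetric]) (auto simp: F_def)
  finally show ?thesis .
qed

lemma walks_support:
  "finite {v. walks N n v \<noteq> 0} \<and> {v. walks N n v \<noteq> 0} \<subseteq> tree_vertices N"
proof (induction n)
  case 0
  show ?case by (auto simp: tree_vertices_def split: if_splits)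
next
  case (Suc n)
  have "\<exists>w\<in>adj_set N v. walks N n w \<noteq> 0" if "walks N (Suc n) v \<noteq> 0" for v
    using that by (metis sum.neutral walks.simps(2))
  then have "{v. walks N (Suc n) v \<noteq> 0} \<subseteq> (\<Union>w\<in>{v. walks N n v \<noteq> 0}. adj_set N w)"
    using tree_adj_sym by (fastforce simp: adj_set_def)
  moreover have "finite (\<Union>w\<in>{v. walks N n v \<noteq> 0}. adj_set N w)"
    using Suc finite_adj_set by blast
  moreover have "adj_set N w \<subseteq> tree_vertices N" for w
    by (auto simp: adj_set_def tree_adj_def)
  ultimately show ?case by (blast intro: finite_subset)
qed

text \<open>The vectors \<open>e n\<close>, the n-th powers of s times the adjacency operator
  applied to the root vector, are finitely supported, so consecutive pairs lie in the graph.
  Symmetry moves all powers to one side of the inner product, where pairing with the root vector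
  reads off the root coordinate.\<close>

lemma spectral_measure_at_root_moments:
  assumes "is_spectral_measure_at (tree_vertices N) (scaled_adjacency s N) root_vector \<nu>"
  shows "integrable \<nu> (\<lambda>x. x ^ k)" "(LINT x|\<nu>. x ^ k) = s ^ k * real (closed_walks k N)"
proof -
  let ?V = "tree_vertices N" and ?G = "scaled_adjacency s N"
  define H where "H = operator_closure ?V ?G"
  obtain E where E: "spectral_resolution ?V H E" and \<nu>: "\<nu> = vector_measure E root_vector"
    using assms by (auto simp: is_spectral_measure_at_def H_def)
  have pvm: "projection_valued_measure ?V E"
    and Dom: "Domain H = {u \<in> ell2 ?V. integrable (vector_measure E u) (\<lambda>x. x\<^sup>2)}"
    using E unfolding spectral_resolution_def by auto
  have form: "ell2_inner u w = complex_of_real (LINT x|vector_measure E u. x)" if "(u, w) \<in> H" for u w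
    using E that unfolding spectral_resolution_def by auto
  have range: "w \<in> ell2 ?V" if "(u, w) \<in> H" for u w
    using that by (auto simp: H_def operator_closure_def)
  have lin: "((\<lambda>v. u v + t * u' v), (\<lambda>v. w v + t * w' v)) \<in> H" if "(u, w) \<in> H" "(u', w') \<in> H" for u w u' w' t
    using operator_closure_lin[of ?G ?V t, OF _ that[unfolded H_def]]
      scaled_adjacency_ell2 scaled_adjacency_lin unfolding H_def by blast
  have sym: "ell2_inner w u' = ell2_inner u w'" if "(u, w) \<in> H" "(u', w') \<in> H" for u w u' w'
    using operator_closure_symmetric[of ?G ?V, OF _ that[unfolded H_def]]
      scaled_adjacency_ell2 scaled_adjacency_symmetric by blast
  define e where "e n = (\<lambda>v. complex_of_real (s ^ n * real (walks N n v)))" for n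
  have eG: "(e n, e (Suc n)) \<in> ?G" for n
  proof -
    have "e (Suc n) = (\<lambda>v. complex_of_real s * (\<Sum>w | tree_adj N v w. e n w))"
      by (simp add: e_def adj_set_def sum_distrib_left mult.assoc fun_eq_iff)
    moreover have "{v. e n v \<noteq> 0} \<subseteq> {v. walks N n v \<noteq> 0}" by (auto simp: e_def)
    then have "finite {v. e n v \<noteq> 0} \<and> {v. e n v \<noteq> 0} \<subseteq> ?V"
      using walks_support[of N n] finite_subset by blast
    ultimately show ?thesis unfolding scaled_adjacency_def by blast
  qed
  have eH: "(e n, e (Suc n)) \<in> H" for n
    unfolding H_def by (intro operator_closure_superset eG scaled_adjacency_ell2[OF eG])
  have shift: "ell2_inner (e a) (e b) = ell2_inner (e 0) (e (a + b))" for a b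
  proof (induction a arbitrary: b)
    case (Suc a)
    have "ell2_inner (e (Suc a)) (e b) = ell2_inner (e a) (e (Suc b))"
      by (rule scaled_adjacency_symmetric[OF eG eG])
    then show ?case by (simp add: Suc.IH)
  qed simp
  have e0: "e 0 = root_vector" by (auto simp: e_def root_vector_def)
  have inner0: "ell2_inner (e 0) (e n) = complex_of_real (s ^ n * real (closed_walks n N))" for n
    by (subst ell2_inner_finite_support[of "{[]}"])
      (auto simp: e_def closed_walks_def split: if_splits)
  note sm = spectral_moments[where e = e and H = H, OF pvm Dom form range lin sym eH, unfolded e0]
  show "integrable \<nu> (\<lambda>x. x ^ k)" unfolding \<nu> by (rule sm(1))
  have "complex_of_real (LINT x|\<nu>. x ^ k) = ell2_inner (e (k div 2)) (e (k - k div 2))"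
    unfolding \<nu> by (rule sm(2))
  also have "\<dots> = complex_of_real (s ^ k * real (closed_walks k N))"
    by (subst shift) (simp only: inner0 le_add_diff_inverse div_le_dividend)
  finally show "(LINT x|\<nu>. x ^ k) = s ^ k * real (closed_walks k N)"
    by (simp only: of_real_eq_iff)
qed

section \<open>Sums over splittings, partitions and compositions\<close>

text \<open>Runs over the ways of distributing the positions of a list over two sublists that keep
  the order. Positions are distributed, not values, so equal entries count separately.\<close>

fun split_sum :: "('a list \<Rightarrow> 'a list \<Rightarrow> 's::comm_monoid_add) \<Rightarrow> 'a list \<Rightarrow> 's" where
  "split_sum \<phi> [] = \<phi> [] []"
| "split_sum \<phi> (x # xs) = split_sum (\<lambda>b c. \<phi> (x # b) c) xs + split_sum (\<lambda>b c. \<phi> b (x # c)) xs"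

lemma split_sum_cong:
  "(\<And>b c. mset b + mset c = mset l \<Longrightarrow> \<phi> b c = \<psi> b c) \<Longrightarrow> split_sum \<phi> l = split_sum \<psi> l"
proof (induction l arbitrary: \<phi> \<psi>)
  case (Cons x l)
  have "split_sum (\<lambda>b c. \<phi> (x # b) c) l = split_sum (\<lambda>b c. \<psi> (x # b) c) l"
    by (rule Cons.IH) (use Cons.prems in auto)
  moreover have "split_sum (\<lambda>b c. \<phi> b (x # c)) l = split_sum (\<lambda>b c. \<psi> b (x # c)) l"
    by (rule Cons.IH) (use Cons.prems in auto)
  ultimately show ?case by simp
qed simp

lemma split_sum_add: "split_sum (\<lambda>b c. \<phi> b c + \<psi> b c) l = split_sum \<phi> l + split_sum \<psi> l"
  by (induction l arbitrary: \<phi> \<psi>) (simp_all add: ac_simps)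

lemma split_sum_0 [simp]: "split_sum (\<lambda>b c. 0) l = 0"
  by (induction l) auto

lemma split_sum_sum: "split_sum (\<lambda>b c. \<Sum>i\<in>I. \<phi> i b c) l = (\<Sum>i\<in>I. split_sum (\<phi> i) l)"
  by (induction I rule: infinite_finite_induct) (auto simp: split_sum_add)

lemma split_sum_mult:
  fixes x :: "'s :: comm_semiring_0"
  shows "split_sum (\<lambda>b c. x * \<phi> b c) l = x * split_sum \<phi> l"
  by (induction l arbitrary: \<phi>) (simp_all add: distrib_left)

lemma prod_list_add:
  fixes u v :: "'a \<Rightarrow> 's :: comm_semiring_1"
  shows "(\<Prod>a\<leftarrow>l. u a + v a) = split_sum (\<lambda>b c. (\<Prod>a\<leftarrow>b. u a) * (\<Prod>a\<leftarrow>c. v a)) l"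
proof (induction l)
  case (Cons x l)
  have "split_sum (\<lambda>b c. (\<Prod>a\<leftarrow>b. u a) * (v x * (\<Prod>a\<leftarrow>c. v a))) l =
      v x * split_sum (\<lambda>b c. (\<Prod>a\<leftarrow>b. u a) * (\<Prod>a\<leftarrow>c. v a)) l"
    by (subst split_sum_mult[symmetric]) (simp add: mult_ac)
  then show ?case using Cons by (simp add: split_sum_mult mult.assoc distrib_right)
qed simp

text \<open>Both sides run over the distributions into three sublists, with the first two extracted
  in opposite order.\<close>

lemma split_sum_swap:
  "split_sum (\<lambda>b c. split_sum (\<lambda>d e. \<phi> b d e) c) l = split_sum (\<lambda>d c. split_sum (\<lambda>b e. \<phi> b d e) c) l"
proof (induction l arbitrary: \<phi>)
  case (Cons x l)
  show ?case
    by (simp add: split_sum_add Cons.IH[of "\<lambda>b. \<phi> (x # b)"] Cons.IH[of "\<lambda>b d. \<phi> b (x # d)"]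
        Cons.IH[of "\<lambda>b d e. \<phi> b d (x # e)"] ac_simps)
qed simp

text \<open>Falling factorial n (n - 1) ... (n - j + 1). For n = 0 the leading factor is 0, so the
  truncated n - 1 has no effect.\<close>

fun ffact :: "nat \<Rightarrow> nat \<Rightarrow> nat" where
  "ffact n 0 = 1"
| "ffact n (Suc j) = n * ffact (n - 1) j"

lemma prod_diff_eq_ffact: "(\<Prod>i<k. real n - real i) = real (ffact n k)"
proof (induction k arbitrary: n)
  case (Suc k)
  have "(\<Prod>i<Suc k. real n - real i) = real n * (\<Prod>i<k. real n - real (Suc i))"
    by (subst prod.lessThan_Suc_shift) simp
  also have "\<dots> = real n * real (ffact (n - 1) k)"
  proof (cases n)
    case (Suc m)
    have "(\<Prod>i<k. real n - real (Suc i)) = (\<Prod>i<k. real m - real i)"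
      by (rule prod.cong) (simp_all add: Suc)
    then show ?thesis using Suc.IH[of m] Suc by simp
  qed simp
  finally show ?case by simp
qed simp

text \<open>If Z b is the joint moment of the variables indexed by b, this is the expectation of a
  product of sums over n independent copies: every factor picks one of n labelled copies, and each
  copy contributes Z of the factors it received.\<close>

fun power_sum_moment :: "('a list \<Rightarrow> 's::comm_semiring_1) \<Rightarrow> nat \<Rightarrow> 'a list \<Rightarrow> 's" where
  "power_sum_moment Z 0 l = (if l = [] then 1 else 0)"
| "power_sum_moment Z (Suc n) l = split_sum (\<lambda>b c. Z b * power_sum_moment Z n c) l"

text \<open>The sum over the partitions of \<open>l\<close> into \<open>j\<close> blocks of the product of the \<open>Z\<close>-values of the
  blocks; the first block is the one containing the head of \<open>l\<close>.\<close>

fun partition_sum :: "('a list \<Rightarrow> 's::comm_semiring_1) \<Rightarrow> nat \<Rightarrow> 'a list \<Rightarrow> 's" where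
  "partition_sum Z 0 l = (if l = [] then 1 else 0)"
| "partition_sum Z (Suc j) [] = 0"
| "partition_sum Z (Suc j) (a # l) = split_sum (\<lambda>b c. Z (a # b) * partition_sum Z j c) l"

lemma partition_sum_eq_0: "length l < j \<Longrightarrow> partition_sum Z j l = 0"
proof (induction j arbitrary: l)
  case (Suc j)
  show ?case
  proof (cases l)
    case (Cons a m)
    have "split_sum (\<lambda>b c. Z (a # b) * partition_sum Z j c) m = split_sum (\<lambda>b c. 0) m"
    proof (rule split_sum_cong)
      fix b c assume "mset b + mset c = mset m"
      then have "length b + length c = length m" by (metis size_mset size_union)
      then show "Z (a # b) * partition_sum Z j c = 0" using Suc Cons by simp
    qed
    then show ?thesis using Cons by simp
  qed simp
qed simp

lemma partition_sum_cong:
  "(\<And>b. mset b \<subseteq># mset l \<Longrightarrow> Z b = Z' b) \<Longrightarrow> partition_sum Z j l = partition_sum Z' j l"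
proof (induction j arbitrary: l)
  case (Suc j)
  show ?case
  proof (cases l)
    case (Cons a m)
    have "split_sum (\<lambda>b c. Z (a # b) * partition_sum Z j c) m = split_sum (\<lambda>b c. Z' (a # b) * partition_sum Z' j c) m"
    proof (rule split_sum_cong)
      fix b c assume *: "mset b + mset c = mset m"
      then have "mset (a # b) \<subseteq># mset l" using Cons by (metis mset.simps(2) mset_subset_eq_add_left add_mset_add_mset_same_iff mset_subset_eq_add_mset_cancel)
      then have "Z (a # b) = Z' (a # b)" by (rule Suc.prems)
      moreover have "partition_sum Z j c = partition_sum Z' j c"
      proof (rule Suc.IH)
        fix d assume "mset d \<subseteq># mset c"
        also have "mset c \<subseteq># mset m" using * by (metis mset_subset_eq_add_right)
        also have "mset m \<subseteq># mset l" using Cons by simp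
        finally show "Z d = Z' d" by (rule Suc.prems)
      qed
      ultimately show "Z (a # b) * partition_sum Z j c = Z' (a # b) * partition_sum Z' j c" by simp
    qed
    then show ?thesis using Cons by simp
  qed simp
qed simp

text \<open>The n copies are interchangeable: the factor a goes to one of them, in n ways, b
  collects the factors that join it, and the n - 1 other copies share the rest. For n = 0 the
  right-hand side is 0 in spite of the truncated n - 1.\<close>

lemma power_sum_moment_Cons:
  "power_sum_moment Z n (a # l) = of_nat n * split_sum (\<lambda>b c. Z (a # b) * power_sum_moment Z (n - 1) c) l"
proof (induction n arbitrary: l)
  case (Suc n)
  let ?f = "split_sum (\<lambda>b c. Z (a # b) * power_sum_moment Z n c) l"
  have "split_sum (\<lambda>b c. Z b * power_sum_moment Z n (a # c)) l = of_nat n * ?f"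
  proof (cases n)
    case (Suc m)
    have "split_sum (\<lambda>b c. Z b * power_sum_moment Z n (a # c)) l =
        split_sum (\<lambda>b c. of_nat n * split_sum (\<lambda>d e. Z b * (Z (a # d) * power_sum_moment Z m e)) c) l"
      by (subst Suc.IH) (simp add: Suc split_sum_mult mult.left_commute)
    also have "\<dots> = of_nat n * split_sum (\<lambda>b c. split_sum (\<lambda>d e. Z b * (Z (a # d) * power_sum_moment Z m e)) c) l"
      by (rule split_sum_mult)
    also have "\<dots> = of_nat n * split_sum (\<lambda>d c. split_sum (\<lambda>b e. Z b * (Z (a # d) * power_sum_moment Z m e)) c) l"
      by (subst split_sum_swap) (rule refl)
    also have "\<dots> = of_nat n * ?f"
      by (simp add: Suc mult.left_commute[of "Z _" "Z (a # _)"] split_sum_mult)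
    finally show ?thesis .
  qed simp
  then show ?case by (simp add: distrib_right)
qed simp

text \<open>Group the factors by the copy that receives them. Copies without a factor contribute Z
  [] = 1, and j nonempty blocks can be placed on distinct copies in \<open>ffact n j\<close>
  ways.\<close>

lemma power_sum_moment_eq:
  assumes "Z [] = 1"
  shows "power_sum_moment Z n l = (\<Sum>j\<le>length l. of_nat (ffact n j) * partition_sum Z j l)"
proof (induction "length l" arbitrary: l n rule: less_induct)
  case less
  show ?case
  proof (cases l)
    case Nil
    have "power_sum_moment Z n [] = 1" by (induction n) (simp_all add: assms)
    then show ?thesis using Nil by simp
  next
    case (Cons a m)
    have "power_sum_moment Z n l = of_nat n * split_sum (\<lambda>b c. Z (a # b) * power_sum_moment Z (n - 1) c) m"
      unfolding Cons by (rule power_sum_moment_Cons)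
    also have "split_sum (\<lambda>b c. Z (a # b) * power_sum_moment Z (n - 1) c) m =
        split_sum (\<lambda>b c. \<Sum>j\<le>length m. of_nat (ffact (n - 1) j) * (Z (a # b) * partition_sum Z j c)) m"
    proof (rule split_sum_cong)
      fix b c assume "mset b + mset c = mset m"
      then have len: "length c \<le> length m" by (metis size_mset size_union le_add2)
      then have "power_sum_moment Z (n - 1) c = (\<Sum>j\<le>length c. of_nat (ffact (n - 1) j) * partition_sum Z j c)"
        using Cons by (intro less) auto
      also have "\<dots> = (\<Sum>j\<le>length m. of_nat (ffact (n - 1) j) * partition_sum Z j c)"
        using len by (intro sum.mono_neutral_left) (auto simp: partition_sum_eq_0)
      finally show "Z (a # b) * power_sum_moment Z (n - 1) c =
          (\<Sum>j\<le>length m. of_nat (ffact (n - 1) j) * (Z (a # b) * partition_sum Z j c))"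
        by (simp add: sum_distrib_left mult.left_commute)
    qed
    also have "of_nat n * \<dots> = (\<Sum>j\<le>length m. of_nat (ffact n (Suc j)) * partition_sum Z (Suc j) l)"
      by (simp add: split_sum_sum split_sum_mult sum_distrib_left mult.assoc Cons)
    also have "\<dots> = (\<Sum>j\<le>length l. of_nat (ffact n j) * partition_sum Z j l)"
      using Cons by (simp only: length_Cons sum.atMost_Suc_shift) simp
    finally show ?thesis .
  qed
qed

text \<open>An entry a stands for an excursion of half-length a + 1, whence the length in the sum:
  these are the compositions of k with every part lowered by one.\<close>

definition compositions :: "nat \<Rightarrow> nat list set" where
  "compositions k = {l. sum_list l + length l = k}"

lemma compositions_0: "compositions 0 = {[]}"
  by (auto simp: compositions_def)

lemma compositions_Suc: "compositions (Suc k) = (\<Union>a\<le>k. (#) a ` compositions (k - a))"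
proof (intro set_eqI iffI)
  fix l assume l: "l \<in> compositions (Suc k)"
  then obtain a m where "l = a # m" by (cases l) (auto simp: compositions_def)
  then have "a \<le> k" "m \<in> compositions (k - a)" "l = a # m" using l by (auto simp: compositions_def)
  then show "l \<in> (\<Union>a\<le>k. (#) a ` compositions (k - a))" by blast
qed (auto simp: compositions_def)

lemma finite_compositions: "finite (compositions k)"
proof (induction k rule: less_induct)
  case (less k)
  then show ?case by (cases k) (auto simp: compositions_0 compositions_Suc)
qed

lemma sum_compositions_Suc:
  "(\<Sum>l\<in>compositions (Suc k). \<phi> l) = (\<Sum>a\<le>k. \<Sum>l\<in>compositions (k - a). \<phi> (a # l))"
  unfolding compositions_Suc
  by (subst sum.UNION_disjoint) (auto simp: finite_compositions sum.reindex inj_on_def)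

lemma compositions_elem_less:
  assumes "l \<in> compositions k" "a \<in> set l"
  shows "a < k"
proof -
  have "a \<le> sum_list l" using assms(2) by (rule member_le_sum_list) simp
  moreover have "0 < length l" using assms(2) by (rule length_pos_if_in_set)
  ultimately show ?thesis using assms(1) unfolding compositions_def mem_Collect_eq by linarith
qed

text \<open>Unfolded form of w = 1 / (1 - xs): a list in \<open>compositions k\<close> records the
  successive values of a chosen in the recursion.\<close>

lemma recursion_eq_sum_compositions:
  fixes w s :: "nat \<Rightarrow> 's::comm_semiring_1"
  assumes "w 0 = 1" "\<And>k. w (Suc k) = (\<Sum>a\<le>k. s a * w (k - a))"
  shows "w k = (\<Sum>l\<in>compositions k. \<Prod>a\<leftarrow>l. s a)"
proof (induction k rule: less_induct)
  case (less k)
  show ?case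
  proof (cases k)
    case (Suc n)
    have "w (Suc n) = (\<Sum>a\<le>n. s a * (\<Sum>l\<in>compositions (n - a). \<Prod>a\<leftarrow>l. s a))"
      unfolding assms(2) using less Suc by (intro sum.cong) auto
    then show ?thesis using Suc by (simp add: sum_compositions_Suc sum_distrib_left)
  qed (simp add: assms compositions_0)
qed

text \<open>Chooses one composition for each entry of the list and passes on their concatenation:
  several walk counts at the same vertex multiply into a single list of excursions.\<close>

fun concat_sum :: "(nat list \<Rightarrow> 's::comm_monoid_add) \<Rightarrow> nat list \<Rightarrow> 's" where
  "concat_sum \<phi> [] = \<phi> []"
| "concat_sum \<phi> (k # ks) = (\<Sum>l\<in>compositions k. concat_sum (\<lambda>m. \<phi> (l @ m)) ks)"

lemma concat_sum_cong:
  "(\<And>l. l \<in> compositions (sum_list ks) \<Longrightarrow> \<phi> l = \<psi> l) \<Longrightarrow> concat_sum \<phi> ks = concat_sum \<psi> ks"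
proof (induction ks arbitrary: \<phi> \<psi>)
  case (Cons k ks)
  have "concat_sum (\<lambda>m. \<phi> (l @ m)) ks = concat_sum (\<lambda>m. \<psi> (l @ m)) ks" if "l \<in> compositions k" for l
    using that by (intro Cons.IH Cons.prems) (auto simp: compositions_def)
  then show ?case by simp
qed (simp add: compositions_def)

lemma concat_sum_mult:
  fixes x :: "'s :: comm_semiring_0"
  shows "concat_sum (\<lambda>l. x * \<phi> l) ks = x * concat_sum \<phi> ks"
  by (induction ks arbitrary: \<phi>) (simp_all add: sum_distrib_left)

lemma concat_sum_prod:
  fixes s :: "nat \<Rightarrow> 's::comm_semiring_1"
  shows "concat_sum (\<lambda>l. \<Prod>a\<leftarrow>l. s a) ks = (\<Prod>k\<leftarrow>ks. \<Sum>l\<in>compositions k. \<Prod>a\<leftarrow>l. s a)"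
  by (induction ks) (simp_all add: concat_sum_mult sum_distrib_right)

section \<open>Joint walk moments of Galton--Watson trees\<close>

text \<open>The law at the root is kept separate: with p and its size-biased law this is
  \<open>UGW p\<close>, and with q twice it is the law of every subtree below the root.\<close>

definition gw :: "nat pmf \<Rightarrow> nat pmf \<Rightarrow> (nat list \<Rightarrow> nat) measure" where
  "gw p q = PiM UNIV (\<lambda>v. measure_pmf (if v = [] then p else q))"

lemma UGW_eq_gw: "UGW p = gw p (size_biased p)"
  by (simp add: UGW_def gw_def)

abbreviation tree_space :: "(nat list \<Rightarrow> nat) measure" where
  "tree_space \<equiv> PiM UNIV (\<lambda>_. count_space UNIV)"

lemma sets_gw [measurable_cong]: "sets (gw p q) = sets tree_space"
  unfolding gw_def by (rule sets_PiM_cong) auto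

lemma space_gw [simp]: "space (gw p q) = UNIV"
  by (simp add: gw_def space_PiM PiE_UNIV_domain)

lemma prob_space_gw: "prob_space (gw p q)"
  unfolding gw_def by (rule prob_space_PiM) (simp add: prob_space_measure_pmf)

lemma measurable_subtree [measurable]: "subtree i \<in> tree_space \<rightarrow>\<^sub>M tree_space"
proof -
  have "(\<lambda>N v. N (v @ [i])) \<in> tree_space \<rightarrow>\<^sub>M tree_space"
    by (intro measurable_abs_UNIV measurable_component_singleton) auto
  then show ?thesis by (simp add: subtree_def[abs_def])
qed

text \<open>Values in \<open>ennreal\<close> give every expectation a meaning before finiteness is
  known.\<close>

definition hw :: "nat \<Rightarrow> (nat list \<Rightarrow> nat) \<Rightarrow> ennreal" where
  "hw k N = of_nat (half_walks k N)"

text \<open>The number n of children is an argument of its own, detached from \<open>N []\<close>,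
  so that the root degree can be conditioned on and n is open to induction.\<close>

definition branch_sum :: "nat \<Rightarrow> nat \<Rightarrow> (nat list \<Rightarrow> nat) \<Rightarrow> ennreal" where
  "branch_sum n a N = (\<Sum>i<n. hw a (subtree i N))"

lemma hw_0 [simp]: "hw 0 N = 1"
  by (simp add: hw_def)

lemma hw_Suc: "hw (Suc k) N = (\<Sum>a\<le>k. branch_sum (N []) a N * hw (k - a) N)"
  by (simp add: hw_def half_walks_Suc branch_sum_def)

lemma hw_eq_sum_compositions:
  "hw k N = (\<Sum>l\<in>compositions k. \<Prod>a\<leftarrow>l. branch_sum (N []) a N)"
  by (rule recursion_eq_sum_compositions[of "\<lambda>k. hw k N"]) (simp_all add: hw_Suc)

lemma measurable_hw [measurable]: "hw k \<in> borel_measurable tree_space"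
proof (induction k rule: less_induct)
  case (less k)
  show ?case
  proof (cases k)
    case 0
    then show ?thesis by (simp add: hw_0[abs_def])
  next
    case (Suc n)
    have "(\<lambda>N. branch_sum (N []) a N) \<in> borel_measurable tree_space" if "a \<le> n" for a
    proof (rule measurable_compose_countable[where f = "\<lambda>m. branch_sum m a"])
      have [measurable]: "hw a \<in> borel_measurable tree_space" using less that Suc by auto
      show "branch_sum m a \<in> borel_measurable tree_space" for m
        unfolding branch_sum_def[abs_def] by measurable
      show "(\<lambda>N. N []) \<in> tree_space \<rightarrow>\<^sub>M count_space UNIV" by measurable
    qed
    moreover have "hw (n - a) \<in> borel_measurable tree_space" for a
      using less Suc by auto
    ultimately show ?thesis
      unfolding Suc hw_Suc[abs_def] by (intro borel_measurable_sum borel_measurable_times_ennreal) auto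
  qed
qed

lemma measurable_branch_sum [measurable]: "branch_sum n a \<in> borel_measurable tree_space"
  unfolding branch_sum_def[abs_def] by measurable

lemma borel_measurable_prod_list [measurable (raw)]:
  fixes f :: "'b \<Rightarrow> 'a \<Rightarrow> ennreal"
  assumes "\<And>a. f a \<in> borel_measurable M"
  shows "(\<lambda>x. \<Prod>a\<leftarrow>l. f a x) \<in> borel_measurable M"
  using assms by (induction l) auto

lemma nn_integral_split_sum:
  assumes "\<And>b c. \<phi> b c \<in> borel_measurable M"
  shows "(\<integral>\<^sup>+x. split_sum (\<lambda>b c. \<phi> b c x) l \<partial>M) = split_sum (\<lambda>b c. \<integral>\<^sup>+x. \<phi> b c x \<partial>M) l"
    and "(\<lambda>x. split_sum (\<lambda>b c. \<phi> b c x) l) \<in> borel_measurable M"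
proof -
  have "(\<integral>\<^sup>+x. split_sum (\<lambda>b c. \<phi> b c x) l \<partial>M) = split_sum (\<lambda>b c. \<integral>\<^sup>+x. \<phi> b c x \<partial>M) l \<and>
      (\<lambda>x. split_sum (\<lambda>b c. \<phi> b c x) l) \<in> borel_measurable M"
    using assms by (induction l arbitrary: \<phi>) (auto simp: nn_integral_add intro!: borel_measurable_add)
  then show "(\<integral>\<^sup>+x. split_sum (\<lambda>b c. \<phi> b c x) l \<partial>M) = split_sum (\<lambda>b c. \<integral>\<^sup>+x. \<phi> b c x \<partial>M) l"
    "(\<lambda>x. split_sum (\<lambda>b c. \<phi> b c x) l) \<in> borel_measurable M" by auto
qed

text \<open>Coordinates are independent, hence so are the restrictions to J and K, and the integral
  over their joint law is a product by Tonelli.\<close>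

lemma nn_integral_PiM_disjoint:
  fixes M :: "'i \<Rightarrow> nat measure" and f g :: "('i \<Rightarrow> nat) \<Rightarrow> ennreal"
  assumes M: "\<And>i. prob_space (M i)" "\<And>i. sets (M i) = UNIV"
    and [measurable]: "f \<in> borel_measurable (PiM UNIV M)" "g \<in> borel_measurable (PiM UNIV M)"
    and disj: "J \<inter> K = {}"
    and fJ: "\<And>x y. (\<And>i. i \<in> J \<Longrightarrow> x i = y i) \<Longrightarrow> f x = f y"
    and gK: "\<And>x y. (\<And>i. i \<in> K \<Longrightarrow> x i = y i) \<Longrightarrow> g x = g y"
  shows "(\<integral>\<^sup>+x. f x * g x \<partial>PiM UNIV M) = (\<integral>\<^sup>+x. f x \<partial>PiM UNIV M) * (\<integral>\<^sup>+x. g x \<partial>PiM UNIV M)"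
proof -
  let ?P = "PiM UNIV M"
  interpret prob_space ?P by (intro prob_space_PiM M)
  have rv: "(\<lambda>\<omega>. \<omega> i) \<in> ?P \<rightarrow>\<^sub>M M i" for i by (rule measurable_component_singleton) simp
  have "distr ?P (M i) (\<lambda>\<omega>. \<omega> i) = M i" for i
    using M by (intro distr_PiM_component) auto
  then have "indep_vars M (\<lambda>i \<omega>. \<omega> i) UNIV"
    using rv by (subst indep_vars_iff_distr_eq_PiM') (simp_all add: restrict_UNIV distr_id)
  then have ind: "indep_var (PiM J M) (\<lambda>\<omega>. restrict \<omega> J) (PiM K M) (\<lambda>\<omega>. restrict \<omega> K)"
    using disj by (intro indep_var_restrict) auto
  \<comment> \<open>Filling the missing coordinates with 0 makes f and g functions of the
    restrictions; their values are unchanged because each depends on its own coordinates.\<close>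
  define ext where "ext S x = (\<lambda>i. if i \<in> S then x i else (0::nat))" for S :: "'i set" and x
  have spM: "space (M i) = UNIV" for i using M(2) sets.sets_into_space by (metis UNIV_I top.extremum_uniqueI sets_eq_imp_space_eq space_count_space sets_count_space Pow_UNIV)
  have ext: "ext S \<in> PiM S M \<rightarrow>\<^sub>M ?P" for S
    unfolding ext_def
  proof (rule measurable_abs_UNIV)
    show "(\<lambda>x. if i \<in> S then x i else 0) \<in> PiM S M \<rightarrow>\<^sub>M M i" for i
      by (cases "i \<in> S") (auto intro: measurable_component_singleton simp: spM)
  qed
  have rst: "(\<lambda>\<omega>. restrict \<omega> S) \<in> ?P \<rightarrow>\<^sub>M PiM S M" for S by (rule measurable_restrict_subset) simp
  define f' g' where "f' = f \<circ> ext J" and "g' = g \<circ> ext K"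
  have [measurable]: "f' \<in> borel_measurable (PiM J M)" "g' \<in> borel_measurable (PiM K M)"
    unfolding f'_def g'_def using measurable_comp[OF ext assms(3)] measurable_comp[OF ext assms(4)] by auto
  have f': "f' (restrict x J) = f x" and g': "g' (restrict x K) = g x" for x
    unfolding f'_def g'_def comp_def by (auto intro!: fJ gK simp: ext_def)
  note [measurable] = rst[of J] rst[of K]
  interpret X: prob_space "distr ?P (PiM J M) (\<lambda>\<omega>. restrict \<omega> J)" by (rule prob_space_distr) measurable
  interpret Y: prob_space "distr ?P (PiM K M) (\<lambda>\<omega>. restrict \<omega> K)" by (rule prob_space_distr) measurable
  have "(\<integral>\<^sup>+x. f x * g x \<partial>?P) = (\<integral>\<^sup>+z. f' (fst z) * g' (snd z) \<partial>distr ?P (PiM J M \<Otimes>\<^sub>M PiM K M) (\<lambda>\<omega>. (restrict \<omega> J, restrict \<omega> K)))"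
    by (subst nn_integral_distr) (auto simp: f' g')
  also have "\<dots> = (\<integral>\<^sup>+z. f' (fst z) * g' (snd z) \<partial>(distr ?P (PiM J M) (\<lambda>\<omega>. restrict \<omega> J) \<Otimes>\<^sub>M distr ?P (PiM K M) (\<lambda>\<omega>. restrict \<omega> K)))"
    using ind unfolding indep_var_distribution_eq by simp
  also have "\<dots> = (\<integral>\<^sup>+x. \<integral>\<^sup>+y. f' x * g' y \<partial>distr ?P (PiM K M) (\<lambda>\<omega>. restrict \<omega> K) \<partial>distr ?P (PiM J M) (\<lambda>\<omega>. restrict \<omega> J))"
    by (subst Y.nn_integral_fst[symmetric]) auto
  also have "\<dots> = (\<integral>\<^sup>+x. f' x \<partial>distr ?P (PiM J M) (\<lambda>\<omega>. restrict \<omega> J)) * (\<integral>\<^sup>+y. g' y \<partial>distr ?P (PiM K M) (\<lambda>\<omega>. restrict \<omega> K))"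
    by (simp add: nn_integral_cmult nn_integral_multc)
  also have "\<dots> = (\<integral>\<^sup>+x. f x \<partial>?P) * (\<integral>\<^sup>+x. g x \<partial>?P)"
    by (simp add: nn_integral_distr f' g')
  finally show ?thesis .
qed

lemma distr_subtree: "distr (gw p q) tree_space (subtree i) = gw q q"
proof -
  let ?M = "\<lambda>v::nat list. measure_pmf (if v = [] then p else q)"
  have "distr (PiM UNIV ?M) (PiM UNIV (\<lambda>v. ?M (v @ [i]))) (\<lambda>\<omega>. \<lambda>v\<in>UNIV. \<omega> (v @ [i])) = PiM UNIV (\<lambda>v. ?M (v @ [i]))"
    by (rule distr_PiM_reindex) (auto simp: prob_space_measure_pmf inj_on_def)
  then have "distr (gw p q) (gw q q) (subtree i) = gw q q"
    by (simp add: gw_def subtree_def[abs_def] restrict_UNIV)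
  moreover have "distr (gw p q) tree_space (subtree i) = distr (gw p q) (gw q q) (subtree i)"
    by (rule distr_cong) (auto simp: sets_gw)
  ultimately show ?thesis by simp
qed

text \<open>Factors in one block of a partition see the same subtree, so joint moments under its law
  are required.\<close>

definition walk_moment :: "nat pmf \<Rightarrow> nat list \<Rightarrow> ennreal" where
  "walk_moment q ks = (\<integral>\<^sup>+N. (\<Prod>k\<leftarrow>ks. hw k N) \<partial>gw q q)"

lemma walk_moment_Nil [simp]: "walk_moment q [] = 1"
  by (simp add: walk_moment_def prob_space.emeasure_space_1[OF prob_space_gw, simplified])

text \<open>The n-th subtree uses the addresses ending in n, the earlier subtrees those ending in i
  < n. Splitting each factor into these two independent parts reproduces the recursion of
  \<open>power_sum_moment\<close>.\<close>

lemma nn_integral_branch_sum_prod: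
  "(\<integral>\<^sup>+N. (\<Prod>a\<leftarrow>l. branch_sum n a N) \<partial>gw p q) = power_sum_moment (walk_moment q) n l"
proof (induction n arbitrary: l)
  case 0
  show ?case
  proof (cases l)
    case Nil
    then show ?thesis by (simp add: prob_space.emeasure_space_1[OF prob_space_gw, simplified])
  next
    case (Cons a m)
    then show ?thesis by (simp add: branch_sum_def)
  qed
next
  case (Suc n)
  let ?f = "\<lambda>b N. \<Prod>a\<leftarrow>b. hw a (subtree n N)" and ?g = "\<lambda>c N. \<Prod>a\<leftarrow>c. branch_sum n a N"
  have [measurable]: "?f b \<in> borel_measurable tree_space" "?g b \<in> borel_measurable tree_space" for b by measurable
  have "(\<integral>\<^sup>+N. (\<Prod>a\<leftarrow>l. branch_sum (Suc n) a N) \<partial>gw p q) = (\<integral>\<^sup>+N. split_sum (\<lambda>b c. ?f b N * ?g c N) l \<partial>gw p q)"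
    by (simp add: prod_list_add[symmetric] branch_sum_def add.commute)
  also have "\<dots> = split_sum (\<lambda>b c. \<integral>\<^sup>+N. ?f b N * ?g c N \<partial>gw p q) l"
    by (rule nn_integral_split_sum) measurable
  also have "\<dots> = split_sum (\<lambda>b c. walk_moment q b * power_sum_moment (walk_moment q) n c) l"
  proof -
    have "(\<integral>\<^sup>+N. ?f b N * ?g c N \<partial>gw p q) = (\<integral>\<^sup>+N. ?f b N \<partial>gw p q) * (\<integral>\<^sup>+N. ?g c N \<partial>gw p q)" for b c
      unfolding gw_def
    proof (rule nn_integral_PiM_disjoint[where J = "range (\<lambda>v. v @ [n])" and K = "\<Union>i<n. range (\<lambda>v. v @ [i])"])
      show "?f b \<in> borel_measurable (PiM UNIV (\<lambda>v. measure_pmf (if v = [] then p else q)))"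
        "?g c \<in> borel_measurable (PiM UNIV (\<lambda>v. measure_pmf (if v = [] then p else q)))"
        unfolding gw_def[symmetric] by measurable
      fix x y :: "nat list \<Rightarrow> nat"
      show "?f b x = ?f b y" if "\<And>i. i \<in> range (\<lambda>v. v @ [n]) \<Longrightarrow> x i = y i"
      proof -
        have "subtree n x = subtree n y" using that by (auto simp: subtree_def)
        then show ?thesis by simp
      qed
      show "?g c x = ?g c y" if eq: "\<And>i. i \<in> (\<Union>i<n. range (\<lambda>v. v @ [i])) \<Longrightarrow> x i = y i"
      proof -
        have "subtree i x = subtree i y" if "i < n" for i
          using eq that by (auto simp: subtree_def fun_eq_iff)
        then have "branch_sum n a x = branch_sum n a y" for a
          unfolding branch_sum_def by (intro sum.cong) auto
        then show ?thesis by simp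
      qed
    qed (auto simp: prob_space_measure_pmf)
    moreover have "(\<integral>\<^sup>+N. ?f b N \<partial>gw p q) = walk_moment q b" for b
      unfolding walk_moment_def distr_subtree[of p q n, symmetric] by (subst nn_integral_distr) measurable
    ultimately show ?thesis by (simp add: Suc.IH)
  qed
  also have "\<dots> = power_sum_moment (walk_moment q) (Suc n) l" by simp
  finally show ?case .
qed

definition factorial_moment :: "nat pmf \<Rightarrow> nat \<Rightarrow> ennreal" where
  "factorial_moment p j = (\<integral>\<^sup>+n. of_nat (ffact n j) \<partial>measure_pmf p)"

text \<open>Conditioning on the root degree n, which is independent of all other coordinates, gives
  \<open>power_sum_moment\<close>; its dependence on n sits in falling factorials, whose
  expectations are the factorial moments.\<close>

lemma nn_integral_root_branch_prod:
  "(\<integral>\<^sup>+N. (\<Prod>a\<leftarrow>l. branch_sum (N []) a N) \<partial>gw p q) =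
     (\<Sum>j\<le>length l. factorial_moment p j * partition_sum (walk_moment q) j l)"
proof -
  let ?g = "\<lambda>n N. \<Prod>a\<leftarrow>l. branch_sum n a N"
  have [measurable]: "?g n \<in> borel_measurable tree_space" for n by measurable
  have [measurable]: "(\<lambda>N. indicator {n} (N []) :: ennreal) \<in> borel_measurable tree_space" for n :: nat
    by (rule measurable_compose[where N = "count_space UNIV"]) (auto intro: measurable_component_singleton)
  have "(\<integral>\<^sup>+N. (\<Prod>a\<leftarrow>l. branch_sum (N []) a N) \<partial>gw p q) = (\<integral>\<^sup>+N. (\<Sum>n. indicator {n} (N []) * ?g n N) \<partial>gw p q)"
  proof (rule nn_integral_cong)
    fix N :: "nat list \<Rightarrow> nat"
    have "(\<lambda>n. indicator {n} (N []) * ?g n N) sums (\<Sum>n\<in>{N []}. indicator {n} (N []) * ?g n N)"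
      by (rule sums_finite) (auto simp: indicator_def)
    then show "(\<Prod>a\<leftarrow>l. branch_sum (N []) a N) = (\<Sum>n. indicator {n} (N []) * ?g n N)"
      by (simp add: sums_iff)
  qed
  also have "\<dots> = (\<Sum>n. \<integral>\<^sup>+N. indicator {n} (N []) * ?g n N \<partial>gw p q)"
  proof (rule nn_integral_suminf)
    show "(\<lambda>N. indicator {n} (N []) * ?g n N) \<in> borel_measurable (gw p q)" for n
      unfolding measurable_cong_sets[OF sets_gw refl] by (intro borel_measurable_times_ennreal) fact+
  qed
  also have "\<dots> = (\<Sum>n. ennreal (pmf p n) * power_sum_moment (walk_moment q) n l)"
  proof (rule suminf_cong)
    fix n
    have "(\<integral>\<^sup>+N. indicator {n} (N []) * ?g n N \<partial>gw p q) = (\<integral>\<^sup>+N. indicator {n} (N []) \<partial>gw p q) * (\<integral>\<^sup>+N. ?g n N \<partial>gw p q)"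
      unfolding gw_def
    proof (rule nn_integral_PiM_disjoint[where J = "{[]}" and K = "- {[]}"])
      show "(\<lambda>N :: nat list \<Rightarrow> nat. indicator {n} (N []) :: ennreal) \<in> borel_measurable (PiM UNIV (\<lambda>v. measure_pmf (if v = [] then p else q)))"
        "?g n \<in> borel_measurable (PiM UNIV (\<lambda>v. measure_pmf (if v = [] then p else q)))"
        unfolding gw_def[symmetric] measurable_cong_sets[OF sets_gw refl] by fact+
      fix x y :: "nat list \<Rightarrow> nat"
      show "?g n x = ?g n y" if "\<And>i. i \<in> - {[]} \<Longrightarrow> x i = y i"
      proof -
        have "subtree i x = subtree i y" for i using that by (auto simp: subtree_def)
        then show ?thesis by (simp add: branch_sum_def)
      qed
    qed (auto simp: prob_space_measure_pmf)
    moreover have "(\<integral>\<^sup>+N. indicator {n} (N []) \<partial>gw p q) = ennreal (pmf p n)"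
    proof -
      have "distr (gw p q) (measure_pmf p) (\<lambda>N. N []) = measure_pmf p"
        using distr_PiM_component[of UNIV "\<lambda>v. measure_pmf (if v = [] then p else q)" "[]"]
        by (simp add: gw_def prob_space_measure_pmf)
      then have "(\<integral>\<^sup>+m. indicator {n} m \<partial>measure_pmf p) = (\<integral>\<^sup>+m. indicator {n} m \<partial>distr (gw p q) (measure_pmf p) (\<lambda>N. N []))"
        by simp
      also have "\<dots> = (\<integral>\<^sup>+N. indicator {n} (N []) \<partial>gw p q)"
      proof (rule nn_integral_distr)
        show "(\<lambda>N. N []) \<in> gw p q \<rightarrow>\<^sub>M measure_pmf p"
          using measurable_component_singleton[of "[]" UNIV "\<lambda>v. measure_pmf (if v = [] then p else q)"]
          by (simp add: gw_def)
      qed simp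
      finally show ?thesis by (simp add: emeasure_pmf_single)
    qed
    ultimately show "(\<integral>\<^sup>+N. indicator {n} (N []) * ?g n N \<partial>gw p q) = ennreal (pmf p n) * power_sum_moment (walk_moment q) n l"
      by (simp add: nn_integral_branch_sum_prod)
  qed
  also have "\<dots> = (\<integral>\<^sup>+n. power_sum_moment (walk_moment q) n l \<partial>measure_pmf p)"
    by (simp add: nn_integral_measure_pmf nn_integral_count_space_nat)
  also have "\<dots> = (\<integral>\<^sup>+n. (\<Sum>j\<le>length l. of_nat (ffact n j) * partition_sum (walk_moment q) j l) \<partial>measure_pmf p)"
    by (simp add: power_sum_moment_eq)
  also have "\<dots> = (\<Sum>j\<le>length l. factorial_moment p j * partition_sum (walk_moment q) j l)"
    by (simp add: nn_integral_sum nn_integral_multc factorial_moment_def)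
  finally show ?thesis .
qed

lemma nn_integral_concat_sum:
  assumes "\<And>l. \<phi> l \<in> borel_measurable M"
  shows "(\<integral>\<^sup>+x. concat_sum (\<lambda>l. \<phi> l x) ks \<partial>M) = concat_sum (\<lambda>l. \<integral>\<^sup>+x. \<phi> l x \<partial>M) ks"
proof -
  have "(\<integral>\<^sup>+x. concat_sum (\<lambda>l. \<phi> l x) ks \<partial>M) = concat_sum (\<lambda>l. \<integral>\<^sup>+x. \<phi> l x \<partial>M) ks \<and>
      (\<lambda>x. concat_sum (\<lambda>l. \<phi> l x) ks) \<in> borel_measurable M"
    using assms by (induction ks arbitrary: \<phi>) (auto simp: nn_integral_sum intro!: borel_measurable_sum)
  then show ?thesis by simp
qed

text \<open>For p = q this is a recursion: the blocks on the right are taken from lists l for which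
  sum plus length equals the sum of ks, so they have a smaller total whenever l is nonempty.\<close>

lemma nn_integral_hw_prod:
  "(\<integral>\<^sup>+N. (\<Prod>k\<leftarrow>ks. hw k N) \<partial>gw p q) =
     concat_sum (\<lambda>l. \<Sum>j\<le>length l. factorial_moment p j * partition_sum (walk_moment q) j l) ks"
proof -
  have [measurable]: "(\<lambda>N. \<Prod>a\<leftarrow>l. branch_sum (N []) a N) \<in> borel_measurable tree_space" for l
  proof (rule measurable_compose_countable[where f = "\<lambda>n N. \<Prod>a\<leftarrow>l. branch_sum n a N"])
    show "(\<lambda>N. \<Prod>a\<leftarrow>l. branch_sum m a N) \<in> borel_measurable tree_space" for m by measurable
    show "(\<lambda>N. N []) \<in> tree_space \<rightarrow>\<^sub>M count_space UNIV" by measurable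
  qed
  have "(\<Prod>k\<leftarrow>ks. hw k N) = concat_sum (\<lambda>l. \<Prod>a\<leftarrow>l. branch_sum (N []) a N) ks" for N
    by (subst concat_sum_prod) (simp add: hw_eq_sum_compositions)
  then have "(\<integral>\<^sup>+N. (\<Prod>k\<leftarrow>ks. hw k N) \<partial>gw p q) = (\<integral>\<^sup>+N. concat_sum (\<lambda>l. \<Prod>a\<leftarrow>l. branch_sum (N []) a N) ks \<partial>gw p q)"
    by simp
  also have "\<dots> = concat_sum (\<lambda>l. \<integral>\<^sup>+N. (\<Prod>a\<leftarrow>l. branch_sum (N []) a N) \<partial>gw p q) ks"
    by (rule nn_integral_concat_sum) measurable
  finally show ?thesis by (simp add: nn_integral_root_branch_prod)
qed

section \<open>From extended nonnegative to real expansions\<close>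

lemma split_sum_ennreal:
  assumes "\<And>b c. \<phi> b c \<ge> 0"
  shows "split_sum (\<lambda>b c. ennreal (\<phi> b c)) l = ennreal (split_sum \<phi> l) \<and> split_sum \<phi> l \<ge> 0"
  using assms by (induction l arbitrary: \<phi>) (simp_all add: ennreal_plus)

lemma partition_sum_ennreal:
  assumes z: "\<And>b. z b \<ge> 0"
  shows "partition_sum (\<lambda>b. ennreal (z b)) j l = ennreal (partition_sum z j l) \<and> partition_sum z j l \<ge> 0"
proof (induction j arbitrary: l)
  case (Suc j)
  then have nn: "0 \<le> z b * partition_sum z j c" for b c using z by simp
  have e: "ennreal (z b) * partition_sum (\<lambda>b. ennreal (z b)) j c = ennreal (z b * partition_sum z j c)" for b c
    using Suc z by (simp add: ennreal_mult)
  show ?case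
  proof (cases l)
    case (Cons a m)
    then show ?thesis
      using split_sum_ennreal[of "\<lambda>b c. z (a # b) * partition_sum z j c" m] nn by (simp add: e)
  qed simp
qed simp

lemma concat_sum_ennreal:
  assumes "\<And>l. \<phi> l \<ge> 0"
  shows "concat_sum (\<lambda>l. ennreal (\<phi> l)) ks = ennreal (concat_sum \<phi> ks) \<and> concat_sum \<phi> ks \<ge> 0"
  using assms by (induction ks arbitrary: \<phi>) (simp_all add: sum_ennreal sum_nonneg)

definition real_walk_moment :: "nat pmf \<Rightarrow> nat list \<Rightarrow> real" where
  "real_walk_moment q ks = enn2real (walk_moment q ks)"

definition real_factorial_moment :: "nat pmf \<Rightarrow> nat \<Rightarrow> real" where
  "real_factorial_moment p j = enn2real (factorial_moment p j)"

text \<open>Right-hand side of the recursion with real arguments; F and z may come from different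
  laws, as they do at the root.\<close>

definition walk_expansion :: "(nat \<Rightarrow> real) \<Rightarrow> (nat list \<Rightarrow> real) \<Rightarrow> nat list \<Rightarrow> real" where
  "walk_expansion F z ks = concat_sum (\<lambda>l. \<Sum>j\<le>length l. F j * partition_sum z j l) ks"

text \<open>Every entry of a composition costs one unit of the total, so a nonempty composition
  involves only blocks of strictly smaller sum. The empty block is listed apart because the total of
  ks can itself be 0.\<close>

lemma nn_integral_hw_prod_real_aux:
  assumes fin: "\<And>b. b = [] \<or> sum_list b < sum_list ks \<Longrightarrow> walk_moment q b < \<top>"
    and fm: "\<And>j. j \<le> sum_list ks \<Longrightarrow> factorial_moment p j < \<top>"
  shows "(\<integral>\<^sup>+N. (\<Prod>k\<leftarrow>ks. hw k N) \<partial>gw p q) =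
    ennreal (walk_expansion (real_factorial_moment p) (real_walk_moment q) ks)"
proof -
  let ?z = "real_walk_moment q"
  have "(\<integral>\<^sup>+N. (\<Prod>k\<leftarrow>ks. hw k N) \<partial>gw p q) =
      concat_sum (\<lambda>l. \<Sum>j\<le>length l. factorial_moment p j * partition_sum (walk_moment q) j l) ks"
    by (rule nn_integral_hw_prod)
  also have "\<dots> = concat_sum (\<lambda>l. ennreal (\<Sum>j\<le>length l. real_factorial_moment p j * partition_sum ?z j l)) ks"
  proof (rule concat_sum_cong)
    fix l assume l: "l \<in> compositions (sum_list ks)"
    have "partition_sum (walk_moment q) j l = partition_sum (\<lambda>b. ennreal (?z b)) j l" for j
    proof (rule partition_sum_cong)
      fix b assume b: "mset b \<subseteq># mset l"
      have "b = [] \<or> sum_list b < sum_list ks"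
      proof (cases l)
        case Nil
        then show ?thesis using b by simp
      next
        case (Cons a m)
        have "sum_list b \<le> sum_list l"
          using b by (metis sum_mset_sum_list sum_mset.union subset_mset.add_diff_inverse le_add1)
        then show ?thesis using l Cons unfolding compositions_def mem_Collect_eq by auto
      qed
      then show "walk_moment q b = ennreal (?z b)"
        using fin by (simp add: real_walk_moment_def)
    qed
    then have p: "partition_sum (walk_moment q) j l = ennreal (partition_sum ?z j l)" "partition_sum ?z j l \<ge> 0" for j
      using partition_sum_ennreal[of ?z j l] by (auto simp: real_walk_moment_def)
    have f: "factorial_moment p j = ennreal (real_factorial_moment p j)" if "j \<le> length l" for j
    proof -
      have "j \<le> sum_list ks" using that l unfolding compositions_def mem_Collect_eq by linarith
      then show ?thesis using fm by (simp add: real_factorial_moment_def)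
    qed
    have rf0: "real_factorial_moment p j \<ge> 0" for j by (simp add: real_factorial_moment_def)
    have "(\<Sum>j\<le>length l. factorial_moment p j * partition_sum (walk_moment q) j l) =
        (\<Sum>j\<le>length l. ennreal (real_factorial_moment p j * partition_sum ?z j l))"
      by (intro sum.cong refl) (simp add: p f ennreal_mult rf0)
    also have "\<dots> = ennreal (\<Sum>j\<le>length l. real_factorial_moment p j * partition_sum ?z j l)"
      by (rule sum_ennreal) (simp add: p rf0)
    finally show "(\<Sum>j\<le>length l. factorial_moment p j * partition_sum (walk_moment q) j l) = \<dots>" .
  qed
  also have "\<dots> = ennreal (walk_expansion (real_factorial_moment p) ?z ks)"
  proof -
    have "0 \<le> (\<Sum>j\<le>length l. real_factorial_moment p j * partition_sum ?z j l)" for l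
      using partition_sum_ennreal[of ?z] by (intro sum_nonneg mult_nonneg_nonneg) (auto simp: real_factorial_moment_def real_walk_moment_def)
    then show ?thesis
      unfolding walk_expansion_def by (rule concat_sum_ennreal[THEN conjunct1])
  qed
  finally show ?thesis .
qed

text \<open>Induction on the total of ks: the recursion is a finite combination of factorial moments
  and joint moments of smaller total.\<close>

lemma walk_moment_finite:
  assumes fm: "\<And>j. j \<le> K \<Longrightarrow> factorial_moment q j < \<top>" and "sum_list ks \<le> K"
  shows "walk_moment q ks < \<top>"
  using assms(2)
proof (induction "sum_list ks" arbitrary: ks rule: less_induct)
  case less
  have "walk_moment q ks = ennreal (walk_expansion (real_factorial_moment q) (real_walk_moment q) ks)"
    unfolding walk_moment_def
    by (rule nn_integral_hw_prod_real_aux) (use less fm in \<open>auto simp: walk_moment_def[symmetric]\<close>)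
  then show ?case by simp
qed

lemma nn_integral_hw_prod_real:
  assumes fq: "\<And>j. j \<le> K \<Longrightarrow> factorial_moment q j < \<top>" and fp: "\<And>j. j \<le> K \<Longrightarrow> factorial_moment p j < \<top>"
    and ks: "sum_list ks \<le> K"
  shows "(\<integral>\<^sup>+N. (\<Prod>k\<leftarrow>ks. hw k N) \<partial>gw p q) =
    ennreal (walk_expansion (real_factorial_moment p) (real_walk_moment q) ks)"
  by (rule nn_integral_hw_prod_real_aux) (use fq fp ks walk_moment_finite[of K q] in auto)

lemma partition_sum_nonneg: "(\<And>b. (z b :: real) \<ge> 0) \<Longrightarrow> partition_sum z j l \<ge> 0"
  using partition_sum_ennreal by blast

lemma walk_expansion_nonneg:
  assumes "\<And>j. F j \<ge> 0" "\<And>b. z b \<ge> 0"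
  shows "walk_expansion F z ks \<ge> 0"
proof -
  have "0 \<le> (\<Sum>j\<le>length l. F j * partition_sum z j l)" for l
    using assms by (intro sum_nonneg mult_nonneg_nonneg partition_sum_nonneg) auto
  then show ?thesis
    unfolding walk_expansion_def by (rule concat_sum_ennreal[THEN conjunct2])
qed

lemma real_walk_moment_eq:
  assumes "\<And>j. j \<le> K \<Longrightarrow> factorial_moment q j < \<top>" "sum_list ks \<le> K"
  shows "real_walk_moment q ks = walk_expansion (real_factorial_moment q) (real_walk_moment q) ks"
proof -
  have "walk_moment q ks = ennreal (walk_expansion (real_factorial_moment q) (real_walk_moment q) ks)"
    unfolding walk_moment_def by (rule nn_integral_hw_prod_real[of K q q]) (use assms in auto)
  moreover have "walk_expansion (real_factorial_moment q) (real_walk_moment q) ks \<ge> 0"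
    by (rule walk_expansion_nonneg) (simp_all add: real_factorial_moment_def real_walk_moment_def)
  ultimately show ?thesis by (simp add: real_walk_moment_def)
qed

text \<open>Both sides take the value 0 when the factorial moment is infinite, so the identity is
  unconditional.\<close>

lemma expectation_falling_factorial:
  "measure_pmf.expectation p (\<lambda>n. \<Prod>i<k. real n - real i) = real_factorial_moment p k"
proof -
  have "measure_pmf.expectation p (\<lambda>n. \<Prod>i<k. real n - real i) = measure_pmf.expectation p (\<lambda>n. real (ffact n k))"
    by (simp add: prod_diff_eq_ffact)
  also have "\<dots> = enn2real (\<integral>\<^sup>+n. ennreal (real (ffact n k)) \<partial>measure_pmf p)"
    by (rule integral_eq_nn_integral) auto
  finally show ?thesis by (simp add: real_factorial_moment_def factorial_moment_def ennreal_of_nat_eq_real_of_nat)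
qed

text \<open>\<open>enn2real\<close> sends infinity to 0, so a nonzero value certifies finiteness. In
  this way the asymptotic hypothesis yields finite moments.\<close>

lemma factorial_moment_finite: "real_factorial_moment p k \<noteq> 0 \<Longrightarrow> factorial_moment p k < \<top>"
  by (auto simp: real_factorial_moment_def top.not_eq_extremum[symmetric])

section \<open>Factorial moments of the size-biased law\<close>

context
  fixes p :: "nat pmf"
  assumes mean_pos: "pmf_mean p > 0"
begin

lemma nn_integral_pmf_shift:
  fixes g :: "nat \<Rightarrow> ennreal"
  assumes "g 0 = 0"
  shows "(\<integral>\<^sup>+n. g n \<partial>measure_pmf p) = (\<Sum>n. ennreal (pmf p (Suc n)) * g (Suc n))"
proof -
  have "(\<lambda>n. ennreal (pmf p (Suc n)) * g (Suc n)) sums (\<Sum>n. ennreal (pmf p (Suc n)) * g (Suc n))"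
    by (simp add: summable_sums)
  from sums_Suc[OF this] have "(\<lambda>n. ennreal (pmf p n) * g n) sums (\<Sum>n. ennreal (pmf p (Suc n)) * g (Suc n))"
    using assms by simp
  then show ?thesis
    by (simp add: nn_integral_measure_pmf nn_integral_count_space_nat sums_iff)
qed

lemma pmf_size_biased: "pmf (size_biased p) k = real (k + 1) * pmf p (k + 1) / pmf_mean p"
  unfolding size_biased_def
proof (rule pmf_embed_pmf)
  show "0 \<le> real (k + 1) * pmf p (k + 1) / pmf_mean p" for k using mean_pos by simp
  \<comment> \<open>The Bochner integral of a non-integrable function is 0, so a positive mean
    forces integrability.\<close>
  have int: "integrable (measure_pmf p) real"
    using mean_pos not_integrable_integral_eq by (fastforce simp: pmf_mean_def)
  have "(\<Sum>k. ennreal (pmf p (Suc k)) * ennreal (real (Suc k))) = (\<integral>\<^sup>+n. ennreal (real n) \<partial>measure_pmf p)"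
    by (rule nn_integral_pmf_shift[symmetric]) simp
  also have "\<dots> = ennreal (pmf_mean p)"
    unfolding pmf_mean_def using int by (intro nn_integral_eq_integral) auto
  finally have s: "(\<Sum>k. ennreal (pmf p (Suc k)) * ennreal (real (Suc k))) = ennreal (pmf_mean p)" .
  have "(\<integral>\<^sup>+k. ennreal (real (k + 1) * pmf p (k + 1) / pmf_mean p) \<partial>count_space UNIV) =
      (\<Sum>k. (ennreal (pmf p (Suc k)) * ennreal (real (Suc k))) / ennreal (pmf_mean p))"
    using mean_pos by (simp add: nn_integral_count_space_nat divide_ennreal[symmetric] ennreal_mult mult.commute)
  also have "\<dots> = ennreal (pmf_mean p) / ennreal (pmf_mean p)"
    unfolding divide_ennreal_def s[symmetric] by (rule ennreal_suminf_multc)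
  also have "\<dots> = 1" using mean_pos by (simp add: divide_ennreal)
  finally show "(\<integral>\<^sup>+k. ennreal (real (k + 1) * pmf p (k + 1) / pmf_mean p) \<partial>count_space UNIV) = 1" .
qed

text \<open>The weight k + 1 times the falling factorial of k of order j is the falling factorial of
  k + 1 of order j + 1, so size-biasing shifts the order by one.\<close>

lemma factorial_moment_size_biased:
  "factorial_moment (size_biased p) j = factorial_moment p (Suc j) / ennreal (pmf_mean p)"
proof -
  have "factorial_moment (size_biased p) j = (\<Sum>k. ennreal (pmf (size_biased p) k) * of_nat (ffact k j))"
    unfolding factorial_moment_def by (simp add: nn_integral_measure_pmf nn_integral_count_space_nat)
  also have "\<dots> = (\<Sum>k. (ennreal (pmf p (Suc k)) * of_nat (ffact (Suc k) (Suc j))) / ennreal (pmf_mean p))"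
  proof (rule suminf_cong)
    fix k
    have "ennreal (pmf (size_biased p) k) = (of_nat (Suc k) * ennreal (pmf p (Suc k))) / ennreal (pmf_mean p)"
      using mean_pos by (simp add: pmf_size_biased divide_ennreal[symmetric] ennreal_mult ennreal_of_nat_eq_real_of_nat del: of_nat_Suc)
    then show "ennreal (pmf (size_biased p) k) * of_nat (ffact k j) =
        (ennreal (pmf p (Suc k)) * of_nat (ffact (Suc k) (Suc j))) / ennreal (pmf_mean p)"
      by (simp only: ffact.simps diff_Suc_1 of_nat_mult divide_ennreal_def mult_ac)
  qed
  also have "\<dots> = (\<Sum>k. ennreal (pmf p (Suc k)) * of_nat (ffact (Suc k) (Suc j))) / ennreal (pmf_mean p)"
    unfolding divide_ennreal_def by (rule ennreal_suminf_multc)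
  also have "(\<Sum>k. ennreal (pmf p (Suc k)) * of_nat (ffact (Suc k) (Suc j))) = factorial_moment p (Suc j)"
    unfolding factorial_moment_def by (rule nn_integral_pmf_shift[symmetric]) simp
  finally show ?thesis .
qed

lemma real_factorial_moment_size_biased:
  assumes "factorial_moment p (Suc j) < \<top>"
  shows "factorial_moment (size_biased p) j < \<top>"
    "real_factorial_moment (size_biased p) j = real_factorial_moment p (Suc j) / pmf_mean p"
proof -
  obtain r where r: "factorial_moment p (Suc j) = ennreal r" "r \<ge> 0"
    using assms by (cases "factorial_moment p (Suc j)") auto
  have *: "factorial_moment (size_biased p) j = ennreal (r / pmf_mean p)"
    using factorial_moment_size_biased[of j] r mean_pos by (simp add: divide_ennreal)
  then show "factorial_moment (size_biased p) j < \<top>" by simp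
  show "real_factorial_moment (size_biased p) j = real_factorial_moment p (Suc j) / pmf_mean p"
    using r mean_pos by (simp add: * real_factorial_moment_def)
qed

end

lemma hw_eq: "hw k N = ennreal (real (closed_walks (2 * k) N))"
  by (simp add: hw_def half_walks_def ennreal_of_nat_eq_real_of_nat)

section \<open>Moments of the expected spectral measure\<close>

context
  fixes p :: "nat pmf" and \<mu> :: "real measure"
  assumes \<mu>: "is_UGW_spectral_measure p \<mu>"
begin

lemma spectral_measure_kernel:
  obtains \<nu> where "\<mu> = UGW p \<bind> \<nu>" "\<nu> \<in> UGW p \<rightarrow>\<^sub>M subprob_algebra borel" "sets \<mu> = sets borel"
    "AE N in UGW p. \<forall>k. integrable (\<nu> N) (\<lambda>x. x ^ k) \<and>
       (LINT x|\<nu> N. x ^ k) = (pmf_mean p powr (-1/2)) ^ k * real (closed_walks k N)"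
proof -
  obtain \<nu> where \<nu>: "\<nu> \<in> UGW p \<rightarrow>\<^sub>M prob_algebra borel"
    "AE N in UGW p. is_spectral_measure_at (tree_vertices N)
           (scaled_adjacency (pmf_mean p powr (-1/2)) N) root_vector (\<nu> N)"
    "\<mu> = UGW p \<bind> \<nu>"
    using \<mu> unfolding is_UGW_spectral_measure_def by blast
  have m: "\<nu> \<in> UGW p \<rightarrow>\<^sub>M subprob_algebra borel" by (rule measurable_prob_algebraD[OF \<nu>(1)])
  show ?thesis
  proof (rule that[OF \<nu>(3) m])
    show "sets \<mu> = sets borel"
      unfolding \<nu>(3) using sets_kernel[OF m] by (intro sets_bind) (auto simp: UGW_eq_gw)
    show "AE N in UGW p. \<forall>k. integrable (\<nu> N) (\<lambda>x. x ^ k) \<and>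
       (LINT x|\<nu> N. x ^ k) = (pmf_mean p powr (-1/2)) ^ k * real (closed_walks k N)"
      using \<nu>(2) by eventually_elim (blast intro: spectral_measure_at_root_moments)
  qed
qed

text \<open>Almost every tree has the walk count as its rescaled moment, and the integrands are
  nonnegative, so the mixture of the spectral measures can be integrated in
  \<open>ennreal\<close>.\<close>

lemma spectral_measure_even_moment:
  assumes m: "(\<integral>\<^sup>+N. hw k N \<partial>gw p (size_biased p)) = ennreal m" "m \<ge> 0"
  shows "integrable \<mu> (\<lambda>x. x ^ (2 * k))"
    "(LINT x|\<mu>. x ^ (2 * k)) = (pmf_mean p powr (-1/2)) ^ (2 * k) * m"
proof -
  let ?s = "pmf_mean p powr (-1/2)"
  obtain \<nu> where \<nu>: "\<mu> = UGW p \<bind> \<nu>" "\<nu> \<in> UGW p \<rightarrow>\<^sub>M subprob_algebra borel" "sets \<mu> = sets borel"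
    "AE N in UGW p. \<forall>k. integrable (\<nu> N) (\<lambda>x. x ^ k) \<and> (LINT x|\<nu> N. x ^ k) = ?s ^ k * real (closed_walks k N)"
    by (rule spectral_measure_kernel)
  have "(\<integral>\<^sup>+x. ennreal (x ^ (2 * k)) \<partial>\<mu>) = (\<integral>\<^sup>+N. \<integral>\<^sup>+x. ennreal (x ^ (2 * k)) \<partial>\<nu> N \<partial>UGW p)"
    unfolding \<nu>(1) by (rule nn_integral_bind[OF _ \<nu>(2)]) measurable
  also have "\<dots> = (\<integral>\<^sup>+N. ennreal (?s ^ (2 * k)) * hw k N \<partial>UGW p)"
  proof (rule nn_integral_cong_AE)
    show "AE N in UGW p. (\<integral>\<^sup>+x. ennreal (x ^ (2 * k)) \<partial>\<nu> N) = ennreal (?s ^ (2 * k)) * hw k N"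
      using \<nu>(4)
    proof eventually_elim
      case (elim N)
      then have "(\<integral>\<^sup>+x. ennreal (x ^ (2 * k)) \<partial>\<nu> N) = ennreal (?s ^ (2 * k) * real (closed_walks (2 * k) N))"
        by (subst nn_integral_eq_integral) (auto simp del: powr_minus)
      then show ?case by (simp add: hw_eq ennreal_mult)
    qed
  qed
  also have "\<dots> = ennreal (?s ^ (2 * k) * m)"
    using m by (simp add: UGW_eq_gw nn_integral_cmult ennreal_mult)
  finally have "has_bochner_integral \<mu> (\<lambda>x. x ^ (2 * k)) (?s ^ (2 * k) * m)"
    using m(2) \<nu>(3) by (intro has_bochner_integral_nn_integral) (auto cong: measurable_cong_sets)
  then show "integrable \<mu> (\<lambda>x. x ^ (2 * k))" "(LINT x|\<mu>. x ^ (2 * k)) = ?s ^ (2 * k) * m"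
    by (auto simp: has_bochner_integral_iff)
qed

text \<open>Integrability comes from |x|^(2k+1) \<le> 1 + x^(2k+2), which is why the walk count of
  index k + 1 occurs. For almost every tree the odd moment is 0, so the positive and negative parts
  have the same integral, and this equality survives averaging over trees.\<close>

lemma spectral_measure_odd_moment:
  assumes m: "(\<integral>\<^sup>+N. hw (Suc k) N \<partial>gw p (size_biased p)) = ennreal m" "m \<ge> 0"
  shows "integrable \<mu> (\<lambda>x. x ^ (2 * k + 1))" "(LINT x|\<mu>. x ^ (2 * k + 1)) = 0"
proof -
  let ?s = "pmf_mean p powr (-1/2)"
  obtain \<nu> where \<nu>: "\<mu> = UGW p \<bind> \<nu>" "\<nu> \<in> UGW p \<rightarrow>\<^sub>M subprob_algebra borel" "sets \<mu> = sets borel"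
    "AE N in UGW p. \<forall>k. integrable (\<nu> N) (\<lambda>x. x ^ k) \<and> (LINT x|\<nu> N. x ^ k) = ?s ^ k * real (closed_walks k N)"
    by (rule spectral_measure_kernel)
  \<comment> \<open>Order 0 with \<open>hw 0\<close> equal to 1: the constant 1 is
    integrable.\<close>
  have "integrable \<mu> (\<lambda>x. x ^ (2 * 0))"
    by (rule spectral_measure_even_moment[where m = 1])
      (simp_all add: prob_space.emeasure_space_1[OF prob_space_gw, simplified])
  then have one: "integrable \<mu> (\<lambda>x. 1 :: real)" by simp
  show int: "integrable \<mu> (\<lambda>x. x ^ (2 * k + 1))"
  proof (rule Bochner_Integration.integrable_bound)
    show "integrable \<mu> (\<lambda>x. 1 + x ^ (2 * Suc k))"
      by (intro Bochner_Integration.integrable_add one spectral_measure_even_moment[OF m])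
    show "AE x in \<mu>. norm (x ^ (2 * k + 1)) \<le> norm (1 + x ^ (2 * Suc k))"
    proof (rule AE_I2)
      fix x :: real
      have "\<bar>x\<bar> ^ (2 * k + 1) \<le> 1 + \<bar>x\<bar> ^ (2 * Suc k)"
      proof (cases "\<bar>x\<bar> \<le> 1")
        case True
        then have "\<bar>x\<bar> ^ (2 * k + 1) \<le> 1" by (intro power_le_one) auto
        then show ?thesis by (simp add: add_increasing2)
      next
        case False
        then have "\<bar>x\<bar> ^ (2 * k + 1) \<le> \<bar>x\<bar> ^ (2 * Suc k)" by (intro power_increasing) auto
        then show ?thesis by simp
      qed
      moreover have "\<bar>x\<bar> ^ (2 * Suc k) = x ^ (2 * Suc k)" by (rule power_even_abs) simp
      moreover have "0 \<le> x ^ (2 * Suc k)" by (rule zero_le_even_power) simp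
      ultimately show "norm (x ^ (2 * k + 1)) \<le> norm (1 + x ^ (2 * Suc k))"
        by (simp only: real_norm_def power_abs)
    qed
  qed (use \<nu>(3) in \<open>simp cong: measurable_cong_sets\<close>)
  have "(\<integral>\<^sup>+x. ennreal (x ^ (2 * k + 1)) \<partial>\<mu>) = (\<integral>\<^sup>+N. \<integral>\<^sup>+x. ennreal (x ^ (2 * k + 1)) \<partial>\<nu> N \<partial>UGW p)"
    unfolding \<nu>(1) by (rule nn_integral_bind[OF _ \<nu>(2)]) measurable
  also have "\<dots> = (\<integral>\<^sup>+N. \<integral>\<^sup>+x. ennreal (- (x ^ (2 * k + 1))) \<partial>\<nu> N \<partial>UGW p)"
  proof (rule nn_integral_cong_AE)
    show "AE N in UGW p. (\<integral>\<^sup>+x. ennreal (x ^ (2 * k + 1)) \<partial>\<nu> N) = (\<integral>\<^sup>+x. ennreal (- (x ^ (2 * k + 1))) \<partial>\<nu> N)"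
      using \<nu>(4)
    proof eventually_elim
      case (elim N)
      have i: "integrable (\<nu> N) (\<lambda>x. x ^ (2 * k + 1))" using elim by blast
      have "(LINT x|\<nu> N. x ^ (2 * k + 1)) = 0"
        using elim closed_walks_odd[of "2 * k + 1" N] by (metis odd_two_times_div_two_succ mult_zero_right of_nat_0 even_plus_one_iff even_mult_iff even_numeral)
      then have "enn2real (\<integral>\<^sup>+x. ennreal (x ^ (2 * k + 1)) \<partial>\<nu> N) = enn2real (\<integral>\<^sup>+x. ennreal (- (x ^ (2 * k + 1))) \<partial>\<nu> N)"
        by (simp only: real_lebesgue_integral_def[OF i])
      then show ?case
        using i unfolding real_integrable_def by (metis ennreal_enn2real top.not_eq_extremum infinity_ennreal_def)
    qed
  qed
  also have "\<dots> = (\<integral>\<^sup>+x. ennreal (- (x ^ (2 * k + 1))) \<partial>\<mu>)"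
    unfolding \<nu>(1) by (rule nn_integral_bind[OF _ \<nu>(2), symmetric]) measurable
  finally show "(LINT x|\<mu>. x ^ (2 * k + 1)) = 0"
    by (simp only: real_lebesgue_integral_def[OF int])
qed

end

section \<open>Asymptotics of the walk moments\<close>

lemma split_sum_neutral:
  fixes \<phi> :: "'a list \<Rightarrow> 'a list \<Rightarrow> 's::comm_monoid_add"
  assumes "\<And>b c. mset b + mset c = mset l \<Longrightarrow> \<phi> b c = 0"
  shows "split_sum \<phi> l = 0"
  using split_sum_cong[of l \<phi> "\<lambda>_ _. 0"] assms by simp

lemma mset_add_length: "mset b + mset c = mset l \<Longrightarrow> length b + length c = length l"
  by (metis size_mset size_union)

lemma split_sum_only_empty:
  assumes "\<And>b c. length c < length l \<Longrightarrow> \<phi> b c = 0"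
  shows "split_sum \<phi> l = \<phi> [] l"
  using assms
proof (induction l arbitrary: \<phi>)
  case (Cons x l)
  have "split_sum (\<lambda>b c. \<phi> (x # b) c) l = 0"
    by (rule split_sum_neutral) (use Cons.prems in \<open>auto dest: mset_add_length\<close>)
  moreover have "split_sum (\<lambda>b c. \<phi> b (x # c)) l = \<phi> [] (x # l)"
    by (rule Cons.IH) (use Cons.prems in auto)
  ultimately show ?case by simp
qed simp

text \<open>Only splits in which c misses at most one element contribute: b is empty, or b is one of
  the \<open>length l\<close> singletons.\<close>

lemma split_sum_length_top:
  fixes g :: "nat \<Rightarrow> real"
  assumes "\<And>i. Suc i < length l \<Longrightarrow> g i = 0"
  shows "split_sum (\<lambda>b c. g (length c)) l = g (length l) + real (length l) * g (length l - 1)"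
  using assms
proof (induction l arbitrary: g)
  case (Cons x l)
  have "split_sum (\<lambda>b c. g (length c)) l = g (length l)"
    by (rule split_sum_only_empty) (use Cons.prems in auto)
  moreover have "split_sum (\<lambda>b c. g (Suc (length c))) l = g (Suc (length l)) + real (length l) * g (Suc (length l - 1))"
    by (rule Cons.IH) (use Cons.prems in auto)
  ultimately show ?case by (cases l) (simp_all add: algebra_simps)
qed simp

text \<open>As many blocks as factors force every block to be a singleton.\<close>

lemma partition_sum_length: "partition_sum Z (length l) l = (\<Prod>a\<leftarrow>l. Z [a])"
proof (induction l)
  case (Cons a l)
  have "split_sum (\<lambda>b c. Z (a # b) * partition_sum Z (length l) c) l = Z [a] * partition_sum Z (length l) l"
    by (rule split_sum_only_empty) (simp add: partition_sum_eq_0)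
  then show ?case using Cons by simp
qed simp

text \<open>One block is a pair and all others are singletons; a multiplicative weight makes each
  choice of the pair contribute the full product. This count is the origin of the 1/c
  correction.\<close>

lemma partition_sum_length_minus_1:
  fixes u :: "nat \<Rightarrow> real"
  assumes "l \<noteq> []"
  shows "partition_sum (\<lambda>b. \<Prod>a\<leftarrow>b. u a) (length l - 1) l = real (length l choose 2) * (\<Prod>a\<leftarrow>l. u a)"
  using assms
proof (induction "length l" arbitrary: l rule: less_induct)
  case less
  let ?t = "\<lambda>b. \<Prod>a\<leftarrow>b. u a"
  obtain a m where l: "l = a # m" using less.prems by (cases l) auto
  show ?case
  proof (cases m)
    case Nil
    then show ?thesis using l by simp
  next
    case (Cons x m')
    define r where "r = length m'"
    have lm: "length m = Suc r" "length l = Suc (Suc r)" using Cons l by (auto simp: r_def)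
    \<comment> \<open>If the complement of the head block has length r, the head belongs to the
      pair; if it has length r + 1, the head is alone and the pair lies in the complement; a shorter
      complement cannot fill r blocks.\<close>
    define g where "g i = (if i < r then 0 else if i = r then 1 else real (Suc r choose 2))" for i
    have "partition_sum ?t (length l - 1) l = split_sum (\<lambda>b c. ?t (a # b) * partition_sum ?t r c) m"
      using l lm by simp
    also have "\<dots> = split_sum (\<lambda>b c. ?t l * g (length c)) m"
    proof (rule split_sum_cong)
      fix b c assume bc: "mset b + mset c = mset m"
      then have len: "length c \<le> Suc r" using mset_add_length lm by fastforce
      have t: "?t l = ?t (a # b) * ?t c"
      proof -
        have "?t m = ?t (b @ c)"
          by (metis bc mset_append mset_map prod_mset_prod_list)
        then show ?thesis by (simp add: l mult.assoc)
      qed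
      consider "length c < r" | "length c = r" | "length c = Suc r" using len by linarith
      then show "?t (a # b) * partition_sum ?t r c = ?t l * g (length c)"
      proof cases
        case 1
        then show ?thesis by (simp add: g_def partition_sum_eq_0)
      next
        case 2
        then show ?thesis using partition_sum_length[of ?t c] by (simp add: g_def t)
      next
        case 3
        then have "partition_sum ?t (length c - 1) c = real (length c choose 2) * ?t c"
          using lm by (intro less.hyps) auto
        then show ?thesis using 3 by (simp add: g_def t)
      qed
    qed
    also have "\<dots> = ?t l * split_sum (\<lambda>b c. g (length c)) m" by (rule split_sum_mult)
    also have "split_sum (\<lambda>b c. g (length c)) m = g (Suc r) + real (Suc r) * g r"
      using split_sum_length_top[of m g] lm by (simp add: g_def)
    also have "\<dots> = real (length l choose 2)"
      by (simp add: g_def lm numeral_2_eq_2)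
    finally show ?thesis by (simp add: mult.commute)
  qed
qed

lemma partition_sum_scale:
  fixes z :: "nat list \<Rightarrow> real"
  shows "partition_sum (\<lambda>b. x ^ sum_list b * z b) j l = x ^ sum_list l * partition_sum z j l"
proof (induction j arbitrary: l)
  case (Suc j)
  show ?case
  proof (cases l)
    case (Cons a m)
    have "split_sum (\<lambda>b c. (x ^ sum_list (a # b) * z (a # b)) * partition_sum (\<lambda>b. x ^ sum_list b * z b) j c) m =
        split_sum (\<lambda>b c. x ^ sum_list l * (z (a # b) * partition_sum z j c)) m"
    proof (rule split_sum_cong)
      fix b c assume "mset b + mset c = mset m"
      then have "sum_list b + sum_list c = sum_list m"
        by (metis sum_list_append sum_mset_sum_list mset_append)
      then have "x ^ sum_list l = x ^ sum_list (a # b) * x ^ sum_list c"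
        using Cons by (simp add: power_add[symmetric] add.assoc)
      then show "(x ^ sum_list (a # b) * z (a # b)) * partition_sum (\<lambda>b. x ^ sum_list b * z b) j c =
          x ^ sum_list l * (z (a # b) * partition_sum z j c)"
        by (simp add: Suc.IH)
    qed
    then show ?thesis using Cons by (simp add: split_sum_mult)
  qed simp
qed simp

text \<open>Normalized contribution of the composition l: \<phi> j stands for the j-th factorial
  moment over x^j, and z for joint moments over x to the total. Each block lost by merging costs one
  factor 1/x.\<close>

definition composition_term :: "(nat \<Rightarrow> real) \<Rightarrow> (nat list \<Rightarrow> real) \<Rightarrow> real \<Rightarrow> nat list \<Rightarrow> real" where
  "composition_term \<phi> z x l = (\<Sum>j\<le>length l. \<phi> j / x ^ (length l - j) * partition_sum z j l)"

text \<open>On compositions the total of ks is \<open>sum_list l + length l\<close>; the factorial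
  moment supplies x^j and the joint moments x to the sum of l, so the power falls short by
  \<open>length l - j\<close>.\<close>

lemma walk_expansion_scale:
  assumes x: "x > 0"
  shows "walk_expansion (\<lambda>j. x ^ j * \<phi> j) (\<lambda>b. x ^ sum_list b * z b) ks =
    x ^ sum_list ks * concat_sum (composition_term \<phi> z x) ks"
proof -
  have "walk_expansion (\<lambda>j. x ^ j * \<phi> j) (\<lambda>b. x ^ sum_list b * z b) ks =
    concat_sum (\<lambda>l. x ^ sum_list ks * composition_term \<phi> z x l) ks"
    unfolding walk_expansion_def
  proof (rule concat_sum_cong)
    fix l assume "l \<in> compositions (sum_list ks)"
    then have s: "sum_list ks = sum_list l + length l" by (simp add: compositions_def)
    have "x ^ j * \<phi> j * (x ^ sum_list l * y) = x ^ sum_list ks * (\<phi> j / x ^ (length l - j) * y)" if "j \<le> length l" for j y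
    proof -
      have "x ^ sum_list ks = x ^ j * x ^ sum_list l * x ^ (length l - j)"
        unfolding s using that by (simp add: power_add[symmetric])
      then show ?thesis using x by simp
    qed
    then show "(\<Sum>j\<le>length l. x ^ j * \<phi> j * partition_sum (\<lambda>b. x ^ sum_list b * z b) j l) =
        x ^ sum_list ks * composition_term \<phi> z x l"
      by (simp add: partition_sum_scale composition_term_def sum_distrib_left)
  qed
  then show ?thesis by (simp add: concat_sum_mult)
qed

lemma tendsto_split_sum:
  fixes \<phi> :: "'c \<Rightarrow> 'a list \<Rightarrow> 'a list \<Rightarrow> real"
  assumes "\<And>b c. mset b + mset c = mset l \<Longrightarrow> ((\<lambda>x. \<phi> x b c) \<longlongrightarrow> L b c) F"
  shows "((\<lambda>x. split_sum (\<phi> x) l) \<longlongrightarrow> split_sum L l) F"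
  using assms
proof (induction l arbitrary: \<phi> L)
  case (Cons a l)
  have "((\<lambda>x. split_sum (\<lambda>b c. \<phi> x (a # b) c) l) \<longlongrightarrow> split_sum (\<lambda>b c. L (a # b) c) l) F"
    by (rule Cons.IH) (use Cons.prems in auto)
  moreover have "((\<lambda>x. split_sum (\<lambda>b c. \<phi> x b (a # c)) l) \<longlongrightarrow> split_sum (\<lambda>b c. L b (a # c)) l) F"
    by (rule Cons.IH) (use Cons.prems in auto)
  ultimately show ?case by (simp add: tendsto_add)
qed simp

lemma tendsto_partition_sum:
  fixes z :: "'c \<Rightarrow> 'a list \<Rightarrow> real"
  assumes "\<And>b. mset b \<subseteq># mset l \<Longrightarrow> ((\<lambda>x. z x b) \<longlongrightarrow> L b) F"
  shows "((\<lambda>x. partition_sum (z x) j l) \<longlongrightarrow> partition_sum L j l) F"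
  using assms
proof (induction j arbitrary: l)
  case (Suc j)
  show ?case
  proof (cases l)
    case (Cons a m)
    have "((\<lambda>x. split_sum (\<lambda>b c. z x (a # b) * partition_sum (z x) j c) m) \<longlongrightarrow>
        split_sum (\<lambda>b c. L (a # b) * partition_sum L j c) m) F"
    proof (intro tendsto_split_sum tendsto_mult)
      fix b c assume bc: "mset b + mset c = mset m"
      then have "mset (a # b) \<subseteq># mset l" "mset c \<subseteq># mset m" "mset m \<subseteq># mset l"
        using Cons by (auto simp flip: bc)
      then show "((\<lambda>x. z x (a # b)) \<longlongrightarrow> L (a # b)) F" "((\<lambda>x. partition_sum (z x) j c) \<longlongrightarrow> partition_sum L j c) F"
        by (auto intro!: Suc.prems Suc.IH intro: subset_mset.order_trans)
    qed
    then show ?thesis using Cons by simp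
  qed simp
qed simp

lemma tendsto_concat_sum:
  fixes \<phi> :: "'c \<Rightarrow> nat list \<Rightarrow> real"
  assumes "\<And>l. l \<in> compositions (sum_list ks) \<Longrightarrow> ((\<lambda>x. \<phi> x l) \<longlongrightarrow> L l) F"
  shows "((\<lambda>x. concat_sum (\<phi> x) ks) \<longlongrightarrow> concat_sum L ks) F"
  using assms
proof (induction ks arbitrary: \<phi> L)
  case (Cons k ks)
  have "((\<lambda>x. concat_sum (\<lambda>m. \<phi> x (l @ m)) ks) \<longlongrightarrow> concat_sum (\<lambda>m. L (l @ m)) ks) F" if "l \<in> compositions k" for l
    by (intro Cons.IH Cons.prems) (use that in \<open>auto simp: compositions_def\<close>)
  then show ?case by (auto intro!: tendsto_sum)
qed (simp add: compositions_def)

lemma tendsto_prod_list: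
  fixes \<phi> :: "'c \<Rightarrow> 'a \<Rightarrow> real"
  assumes "\<And>a. a \<in> set l \<Longrightarrow> ((\<lambda>x. \<phi> x a) \<longlongrightarrow> L a) F"
  shows "((\<lambda>x. \<Prod>a\<leftarrow>l. \<phi> x a) \<longlongrightarrow> (\<Prod>a\<leftarrow>l. L a)) F"
  using assms by (induction l) (auto intro!: tendsto_mult)

section \<open>Leading order: Catalan numbers\<close>

abbreviation catalan :: "nat \<Rightarrow> real" where
  "catalan k \<equiv> fps_nth catalan_fps k"

lemma catalan_0: "catalan 0 = 1"
  by (simp add: catalan_fps_def)

lemma catalan_Suc: "catalan (Suc k) = (\<Sum>a\<le>k. catalan a * catalan (k - a))"
proof -
  have "catalan (Suc k) = fps_nth (1 + fps_X * catalan_fps\<^sup>2) (Suc k)" using catalan_fps_eq by simp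
  also have "\<dots> = fps_nth (catalan_fps\<^sup>2) k" by simp
  also have "\<dots> = (\<Sum>a\<le>k. catalan a * catalan (k - a))"
    by (simp only: power2_eq_square fps_mult_nth atLeast0AtMost)
  finally show ?thesis .
qed

lemma catalan_eq_sum_compositions: "catalan k = (\<Sum>l\<in>compositions k. \<Prod>a\<leftarrow>l. catalan a)"
  by (rule recursion_eq_sum_compositions) (simp_all add: catalan_0 catalan_Suc)

text \<open>Every partition with fewer than \<open>length l\<close> blocks carries a negative power
  of c, so the partition into singletons gives the limit.\<close>

lemma tendsto_composition_term:
  assumes \<phi>: "\<And>j. ((\<lambda>c. \<phi> c j) \<longlongrightarrow> 1) at_top"
    and z: "\<And>b. mset b \<subseteq># mset l \<Longrightarrow> ((\<lambda>c. z c b) \<longlongrightarrow> (\<Prod>a\<leftarrow>b. catalan a)) at_top"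
  shows "((\<lambda>c. composition_term (\<phi> c) (z c) c l) \<longlongrightarrow> (\<Prod>a\<leftarrow>l. catalan a)) at_top"
proof -
  let ?L = "\<lambda>b. \<Prod>a\<leftarrow>b. catalan a"
  have p: "((\<lambda>c. partition_sum (z c) j l) \<longlongrightarrow> partition_sum ?L j l) at_top" for j
    by (rule tendsto_partition_sum[OF z])
  have "((\<lambda>c. \<phi> c j / c ^ (length l - j) * partition_sum (z c) j l) \<longlongrightarrow>
      (if j = length l then ?L l else 0)) at_top" if "j \<le> length l" for j
  proof (cases "j = length l")
    case True
    have "partition_sum ?L j l = ?L l"
      using partition_sum_length[of ?L l] True by simp
    then show ?thesis using tendsto_mult[OF \<phi>[of j] p[of j]] True by simp
  next
    case False
    then have "filterlim (\<lambda>c::real. c ^ (length l - j)) at_top at_top"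
      using that by (intro filterlim_pow_at_top filterlim_ident) auto
    then have "((\<lambda>c. \<phi> c j / c ^ (length l - j)) \<longlongrightarrow> 0) at_top"
      by (intro real_tendsto_divide_at_top[OF \<phi>])
    from tendsto_mult[OF this p] show ?thesis using False by simp
  qed
  then have "((\<lambda>c. composition_term (\<phi> c) (z c) c l) \<longlongrightarrow> (\<Sum>j\<le>length l. if j = length l then ?L l else 0)) at_top"
    unfolding composition_term_def by (intro tendsto_sum) auto
  then show ?thesis by simp
qed

text \<open>Blocks have smaller total, so their limits are known by induction. To leading order only
  singletons count, and the resulting sum over compositions is the Catalan recursion; in particular
  joint moments factorize in the limit.\<close>

lemma tendsto_normalized_moment:
  assumes \<phi>: "\<And>j. ((\<lambda>c. \<phi> c j) \<longlongrightarrow> 1) at_top"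
    and eq: "\<And>ks. \<forall>\<^sub>F c in at_top. z c ks = concat_sum (composition_term (\<phi> c) (z c) c) ks"
    and Nil: "\<And>c. z c [] = 1"
  shows "((\<lambda>c. z c ks) \<longlongrightarrow> (\<Prod>k\<leftarrow>ks. catalan k)) at_top"
proof (induction "sum_list ks" arbitrary: ks rule: less_induct)
  case less
  have "((\<lambda>c. concat_sum (composition_term (\<phi> c) (z c) c) ks) \<longlongrightarrow> concat_sum (\<lambda>l. \<Prod>a\<leftarrow>l. catalan a) ks) at_top"
  proof (intro tendsto_concat_sum tendsto_composition_term \<phi>)
    fix l b assume l: "l \<in> compositions (sum_list ks)" and b: "mset b \<subseteq># mset l"
    show "((\<lambda>c. z c b) \<longlongrightarrow> (\<Prod>a\<leftarrow>b. catalan a)) at_top"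
    proof (cases l)
      case Nil
      then show ?thesis using b by (simp add: assms(3))
    next
      case (Cons a m)
      have "sum_list b \<le> sum_list l"
        using b by (metis sum_mset_sum_list sum_mset.union subset_mset.add_diff_inverse le_add1)
      then have "sum_list b < sum_list ks" using l Cons unfolding compositions_def mem_Collect_eq by auto
      then show ?thesis by (rule less)
    qed
  qed
  also have "concat_sum (\<lambda>l. \<Prod>a\<leftarrow>l. catalan a) ks = (\<Prod>k\<leftarrow>ks. catalan k)"
    by (simp add: concat_sum_prod catalan_eq_sum_compositions[symmetric])
  finally show ?case
    by (rule Lim_transform_eventually) (use eq[of ks] in \<open>auto elim: eventually_mono\<close>)
qed

lemma sum_compositions_length_eq:
  fixes u :: "nat \<Rightarrow> real"
  shows "(\<Sum>l\<in>compositions k. if length l = i then \<Prod>a\<leftarrow>l. u a else 0) = fps_nth ((fps_X * Abs_fps u) ^ i) k"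
proof (induction i arbitrary: k)
  case 0
  have "(\<Sum>l\<in>compositions k. if length l = 0 then \<Prod>a\<leftarrow>l. u a else 0) = (\<Sum>l\<in>compositions k. if l = [] then 1 else 0)"
    by (intro sum.cong) auto
  then show ?case by (simp add: finite_compositions) (simp add: compositions_def)
next
  case (Suc i)
  show ?case
  proof (cases k)
    case (Suc n)
    have "(\<Sum>l\<in>compositions (Suc n). if length l = Suc i then \<Prod>a\<leftarrow>l. u a else 0) =
        (\<Sum>a\<le>n. \<Sum>l\<in>compositions (n - a). u a * (if length l = i then \<Prod>a\<leftarrow>l. u a else 0))"
      by (subst sum_compositions_Suc) (intro sum.cong refl, auto)
    also have "\<dots> = (\<Sum>a\<le>n. u a * fps_nth ((fps_X * Abs_fps u) ^ i) (n - a))"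
      by (simp add: sum_distrib_left[symmetric] Suc.IH)
    also have "\<dots> = fps_nth (Abs_fps u * (fps_X * Abs_fps u) ^ i) n"
      by (simp add: fps_mult_nth atLeast0AtMost)
    also have "\<dots> = fps_nth (fps_X * (Abs_fps u * (fps_X * Abs_fps u) ^ i)) (Suc n)" by simp
    finally show ?thesis using Suc by (simp add: mult.assoc)
  qed (simp add: compositions_0)
qed

lemma length_le_compositions: "l \<in> compositions k \<Longrightarrow> length l \<le> k"
  unfolding compositions_def by auto

text \<open>Lists of length i contribute the coefficient of (x U)^i, where U is the series of u, so
  weighting by g of the length substitutes x U into the series of g.\<close>

lemma sum_compositions_eq_compose:
  fixes g u :: "nat \<Rightarrow> real"
  shows "(\<Sum>l\<in>compositions k. g (length l) * (\<Prod>a\<leftarrow>l. u a)) =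
    fps_nth (fps_compose (Abs_fps g) (fps_X * Abs_fps u)) k"
proof -
  have "(\<Sum>l\<in>compositions k. g (length l) * (\<Prod>a\<leftarrow>l. u a)) =
      (\<Sum>l\<in>compositions k. \<Sum>i\<le>k. g i * (if length l = i then \<Prod>a\<leftarrow>l. u a else 0))"
  proof (intro sum.cong refl)
    fix l assume "l \<in> compositions k"
    then have "length l \<le> k" by (rule length_le_compositions)
    moreover have "(\<Sum>i\<le>k. g i * (if length l = i then \<Prod>a\<leftarrow>l. u a else 0)) =
        (\<Sum>i\<le>k. if i = length l then g (length l) * (\<Prod>a\<leftarrow>l. u a) else 0)"
      by (intro sum.cong) auto
    ultimately show "g (length l) * (\<Prod>a\<leftarrow>l. u a) = (\<Sum>i\<le>k. g i * (if length l = i then \<Prod>a\<leftarrow>l. u a else 0))"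
      by simp
  qed
  also have "\<dots> = (\<Sum>i\<le>k. g i * fps_nth ((fps_X * Abs_fps u) ^ i) k)"
    by (subst sum.swap) (simp add: sum_distrib_left[symmetric] sum_compositions_length_eq)
  finally show ?thesis by (simp add: fps_compose_nth atLeast0AtMost)
qed

section \<open>Error terms relative to a vanishing scale\<close>

lemma bigo_times_null:
  fixes f g :: "real \<Rightarrow> real"
  assumes "f \<in> O[at_top](e)" "(g \<longlongrightarrow> 0) at_top"
  shows "(\<lambda>c. f c * g c) \<in> o[at_top](e)"
proof -
  have "g \<in> o[at_top](\<lambda>_. 1)" using assms(2) by (intro smalloI_tendsto) auto
  from landau_o.big_small_mult[OF assms(1) this] show ?thesis by simp
qed

lemma smallo_times_tendsto:
  fixes f g :: "real \<Rightarrow> real"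
  assumes "f \<in> o[at_top](e)" "(g \<longlongrightarrow> L) at_top"
  shows "(\<lambda>c. f c * g c) \<in> o[at_top](e)"
proof -
  have "g \<in> O[at_top](\<lambda>_. 1)" using assms(2) by (intro bigoI_tendsto[where c = L]) auto
  from landau_o.small_big_mult[OF assms(1) this] show ?thesis by simp
qed

lemma smallo_sum:
  fixes f :: "'i \<Rightarrow> real \<Rightarrow> real"
  assumes "\<And>i. i \<in> I \<Longrightarrow> f i \<in> o[F](e)"
  shows "(\<lambda>c. \<Sum>i\<in>I. f i c) \<in> o[F](e)"
  using assms by (induction I rule: infinite_finite_induct) (auto intro!: sum_in_smallo)

text \<open>Telescoping: one factor is exchanged at a time, while the others stay
  convergent.\<close>

lemma smallo_prod_list_diff:
  fixes x y :: "real \<Rightarrow> 'a \<Rightarrow> real"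
  assumes "\<And>a. a \<in> set l \<Longrightarrow> (\<lambda>c. x c a - y c a) \<in> o[at_top](e)"
    and "\<And>a. a \<in> set l \<Longrightarrow> ((\<lambda>c. x c a) \<longlongrightarrow> L a) at_top"
    and "\<And>a. a \<in> set l \<Longrightarrow> ((\<lambda>c. y c a) \<longlongrightarrow> L a) at_top"
  shows "(\<lambda>c. (\<Prod>a\<leftarrow>l. x c a) - (\<Prod>a\<leftarrow>l. y c a)) \<in> o[at_top](e)"
  using assms
proof (induction l)
  case (Cons a l)
  have 1: "(\<lambda>c. (x c a - y c a) * (\<Prod>a\<leftarrow>l. x c a)) \<in> o[at_top](e)"
    using Cons.prems by (intro smallo_times_tendsto[where L = "\<Prod>a\<leftarrow>l. L a"] tendsto_prod_list) auto
  have 2: "(\<lambda>c. ((\<Prod>a\<leftarrow>l. x c a) - (\<Prod>a\<leftarrow>l. y c a)) * y c a) \<in> o[at_top](e)"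
    using Cons.prems by (intro smallo_times_tendsto[where L = "L a"] Cons.IH) auto
  have eq: "(\<Prod>a\<leftarrow>a # l. x c a) - (\<Prod>a\<leftarrow>a # l. y c a) =
      (x c a - y c a) * (\<Prod>a\<leftarrow>l. x c a) + ((\<Prod>a\<leftarrow>l. x c a) - (\<Prod>a\<leftarrow>l. y c a)) * y c a" for c
    by (simp add: algebra_simps)
  show ?case unfolding eq by (rule sum_in_smallo(1)[OF 1 2])
qed simp

lemma tendsto_of_smallo_bounded:
  fixes f :: "real \<Rightarrow> real"
  assumes "f \<in> o[at_top](e)" "(e \<longlongrightarrow> 0) at_top"
  shows "(f \<longlongrightarrow> 0) at_top"
proof (rule tendsto_0_le[OF assms(2), of _ 1])
  show "\<forall>\<^sub>F c in at_top. norm (f c) \<le> norm (e c) * 1"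
    using landau_o.smallD[OF assms(1), of 1] by simp
qed

text \<open>The series x^2 / (1 - x)^3; r choose 2 counts the partitions of r \<ge> 1 factors into r
  - 1 blocks.\<close>

definition choose2_fps :: "real fps" where
  "choose2_fps = Abs_fps (\<lambda>r. real (r choose 2))"

section \<open>First-order expansion in \<open>a\<close> and \<open>b\<close>, modulo
  o(\<open>e\<close>)\<close>

context
  fixes e a b :: "real \<Rightarrow> real"
  assumes e0: "(e \<longlongrightarrow> 0) at_top"
    and a: "a \<in> O[at_top](e)" and a0: "(a \<longlongrightarrow> 0) at_top"
    and b: "b \<in> O[at_top](e)" and b_def: "b = (\<lambda>c. 1 / c)"
begin

lemma b0: "(b \<longlongrightarrow> 0) at_top"
  unfolding b_def by (intro real_tendsto_divide_at_top[OF tendsto_const filterlim_ident])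

text \<open>For j = length l the deviation of \<phi> from 1 yields the a-term; for j = length l - 1
  the weight 1/c is the b-term and the rest may be replaced by its limit; smaller j are negligible.
  The factors \<open>z c [k]\<close> are left as they stand, because their own expansion is what the
  induction provides.\<close>

lemma composition_term_expansion:
  assumes \<phi>1: "\<And>j. (\<lambda>c. \<phi> c j - (1 + g j * a c)) \<in> o[at_top](e)"
    and z: "\<And>ks. ((\<lambda>c. z c ks) \<longlongrightarrow> (\<Prod>k\<leftarrow>ks. catalan k)) at_top"
  shows "(\<lambda>c. composition_term (\<phi> c) (z c) c l -
      ((\<Prod>k\<leftarrow>l. z c [k]) + a c * (g (length l) * (\<Prod>k\<leftarrow>l. catalan k))
        + b c * (real (length l choose 2) * (\<Prod>k\<leftarrow>l. catalan k)))) \<in> o[at_top](e)"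
proof -
  let ?P = "\<Prod>k\<leftarrow>l. catalan k" and ?r = "length l"
  let ?L = "\<lambda>b. \<Prod>k\<leftarrow>b. catalan k"
  have \<phi>: "((\<lambda>c. \<phi> c j) \<longlongrightarrow> 1) at_top" for j
  proof -
    have "((\<lambda>c. (\<phi> c j - (1 + g j * a c)) + (1 + g j * a c)) \<longlongrightarrow> 0 + (1 + g j * 0)) at_top"
      by (intro tendsto_intros a0 tendsto_of_smallo_bounded[OF \<phi>1 e0])
    then show ?thesis by simp
  qed
  have p: "((\<lambda>c. partition_sum (z c) j l) \<longlongrightarrow> partition_sum ?L j l) at_top" for j
    by (rule tendsto_partition_sum[OF z])
  define \<tau> where "\<tau> j c = \<phi> c j / c ^ (?r - j) * partition_sum (z c) j l" for j c
  define \<rho> where "\<rho> j c = (if j = ?r then (\<Prod>k\<leftarrow>l. z c [k]) + a c * (g ?r * ?P)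
     else if Suc j = ?r then b c * (real (?r choose 2) * ?P) else 0)" for j c
  have "(\<lambda>c. \<tau> j c - \<rho> j c) \<in> o[at_top](e)" if jr: "j \<le> ?r" for j
  proof -
    consider "j = ?r" | "Suc j = ?r" | "Suc (Suc j) \<le> ?r" using jr by linarith
    then show ?thesis
    proof cases
      case 1
      have Z: "((\<lambda>c. \<Prod>k\<leftarrow>l. z c [k]) \<longlongrightarrow> ?P) at_top"
        using z[of "[_]"] by (intro tendsto_prod_list) simp
      have "(\<lambda>c. (\<phi> c ?r - (1 + g ?r * a c)) * (\<Prod>k\<leftarrow>l. z c [k])) \<in> o[at_top](e)"
        by (rule smallo_times_tendsto[OF \<phi>1 Z])
      moreover have "(\<lambda>c. a c * (g ?r * ((\<Prod>k\<leftarrow>l. z c [k]) - ?P))) \<in> o[at_top](e)"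
      proof (rule bigo_times_null[OF a])
        have "((\<lambda>c. g ?r * ((\<Prod>k\<leftarrow>l. z c [k]) - ?P)) \<longlongrightarrow> g ?r * (?P - ?P)) at_top"
          by (intro tendsto_intros Z)
        then show "((\<lambda>c. g ?r * ((\<Prod>k\<leftarrow>l. z c [k]) - ?P)) \<longlongrightarrow> 0) at_top" by simp
      qed
      ultimately have "(\<lambda>c. (\<phi> c ?r - (1 + g ?r * a c)) * (\<Prod>k\<leftarrow>l. z c [k])
          + a c * (g ?r * ((\<Prod>k\<leftarrow>l. z c [k]) - ?P))) \<in> o[at_top](e)"
        by (rule sum_in_smallo(1))
      moreover have "(\<phi> c ?r - (1 + g ?r * a c)) * (\<Prod>k\<leftarrow>l. z c [k])
          + a c * (g ?r * ((\<Prod>k\<leftarrow>l. z c [k]) - ?P)) = \<tau> j c - \<rho> j c" for c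
        by (simp add: \<tau>_def \<rho>_def 1 partition_sum_length algebra_simps)
      ultimately show ?thesis by simp
    next
      case 2
      have ne: "l \<noteq> []" using 2 by auto
      have j: "j = ?r - 1" using 2 by simp
      have "((\<lambda>c. \<phi> c j * partition_sum (z c) j l - real (?r choose 2) * ?P) \<longlongrightarrow>
          1 * partition_sum ?L j l - real (?r choose 2) * ?P) at_top"
        by (intro tendsto_intros \<phi> p)
      also have "partition_sum ?L j l = real (?r choose 2) * ?P"
        unfolding j by (rule partition_sum_length_minus_1[OF ne])
      finally have "(\<lambda>c. b c * (\<phi> c j * partition_sum (z c) j l - real (?r choose 2) * ?P)) \<in> o[at_top](e)"
        by (intro bigo_times_null[OF b]) simp
      moreover have "b c * (\<phi> c j * partition_sum (z c) j l - real (?r choose 2) * ?P) = \<tau> j c - \<rho> j c" for c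
      proof -
        have "?r - j = 1" "j \<noteq> ?r" using 2 by auto
        then show ?thesis by (simp add: \<tau>_def \<rho>_def b_def 2 algebra_simps)
      qed
      ultimately show ?thesis by simp
    next
      case 3
      \<comment> \<open>One factor 1/c is spent on \<open>b\<close>; the remaining positive power of
        1/c makes the term negligible against \<open>e\<close>.\<close>
      define i where "i = ?r - j - 1"
      have i: "?r - j = Suc i" "i > 0" using 3 by (auto simp: i_def)
      have "((\<lambda>c. \<phi> c j * partition_sum (z c) j l / c ^ i) \<longlongrightarrow> 0) at_top"
        by (intro real_tendsto_divide_at_top[OF tendsto_mult[OF \<phi> p]] filterlim_pow_at_top filterlim_ident i)
      then have "(\<lambda>c. b c * (\<phi> c j * partition_sum (z c) j l / c ^ i)) \<in> o[at_top](e)"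
        by (rule bigo_times_null[OF b])
      moreover have "b c * (\<phi> c j * partition_sum (z c) j l / c ^ i) = \<tau> j c - \<rho> j c" for c
        using 3 i by (auto simp: \<tau>_def \<rho>_def b_def)
      ultimately show ?thesis by simp
    qed
  qed
  then have "(\<lambda>c. \<Sum>j\<le>?r. \<tau> j c - \<rho> j c) \<in> o[at_top](e)"
    by (intro smallo_sum) auto
  moreover have "(\<Sum>j\<le>?r. \<rho> j c) = (\<Prod>k\<leftarrow>l. z c [k]) + a c * (g ?r * ?P) + b c * (real (?r choose 2) * ?P)" for c
  proof (cases ?r)
    case 0
    then show ?thesis by (simp add: \<rho>_def)
  next
    case (Suc n)
    have "(\<Sum>j\<le>Suc n. \<rho> j c) = \<rho> (Suc n) c + \<rho> n c + (\<Sum>j<n. \<rho> j c)"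
      by (simp add: lessThan_Suc_atMost[symmetric])
    moreover have "(\<Sum>j<n. \<rho> j c) = 0" using Suc by (intro sum.neutral) (auto simp: \<rho>_def)
    ultimately show ?thesis using Suc by (simp add: \<rho>_def)
  qed
  ultimately show ?thesis
    by (simp add: composition_term_def \<tau>_def sum_subtractf)
qed

text \<open>The sums over compositions are the coefficients of W = 1 / (1 - xU) with U = T + aA +
  bB, while T = 1 / (1 - xT). The linearization at T therefore has slope x T^2, with the exact
  remainder x T (U - T) (W - T), which is of order e times a null function.\<close>

lemma geometric_expansion:
  fixes A B :: "real fps"
  defines "u \<equiv> (\<lambda>c k. catalan k + a c * fps_nth A k + b c * fps_nth B k)"
  shows "(\<lambda>c. (\<Sum>l\<in>compositions k. \<Prod>i\<leftarrow>l. u c i) -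
      (catalan k + a c * fps_nth (fps_X * catalan_fps\<^sup>2 * A) k + b c * fps_nth (fps_X * catalan_fps\<^sup>2 * B) k)) \<in> o[at_top](e)"
proof -
  let ?T = catalan_fps
  define w where "w c k = (\<Sum>l\<in>compositions k. \<Prod>i\<leftarrow>l. u c i)" for c k
  have u: "((\<lambda>c. u c k) \<longlongrightarrow> catalan k) at_top" for k
  proof -
    have "((\<lambda>c. u c k) \<longlongrightarrow> catalan k + 0 * fps_nth A k + 0 * fps_nth B k) at_top"
      unfolding u_def by (intro tendsto_intros a0 b0)
    then show ?thesis by simp
  qed
  have w: "((\<lambda>c. w c k) \<longlongrightarrow> catalan k) at_top" for k
    unfolding w_def by (subst catalan_eq_sum_compositions) (intro tendsto_sum tendsto_prod_list u)
  define W where "W c = Abs_fps (w c)" for c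
  define U where "U c = Abs_fps (u c)" for c
  have U: "U c = ?T + fps_const (a c) * A + fps_const (b c) * B" for c
    by (rule fps_ext) (simp add: U_def u_def)
  have W: "W c = 1 + fps_X * (U c * W c)" for c
  proof (rule fps_ext)
    fix n
    show "fps_nth (W c) n = fps_nth (1 + fps_X * (U c * W c)) n"
    proof (cases n)
      case 0
      then show ?thesis by (simp add: W_def w_def compositions_0)
    next
      case (Suc m)
      have "w c (Suc m) = (\<Sum>i\<le>m. u c i * w c (m - i))"
        unfolding w_def by (simp add: sum_compositions_Suc sum_distrib_left)
      then have "fps_nth (W c) (Suc m) = fps_nth (U c * W c) m"
        by (simp add: W_def U_def fps_mult_nth atLeast0AtMost)
      then show ?thesis using Suc by simp
    qed
  qed
  have T: "?T * (1 - fps_X * ?T) = 1"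
    using catalan_fps_eq by (simp add: power2_eq_square algebra_simps)
  have diff: "W c - ?T - fps_X * ?T\<^sup>2 * (U c - ?T) = fps_X * ?T * ((U c - ?T) * (W c - ?T))" for c
  proof -
    have "W c - ?T = (W c - ?T) * (?T * (1 - fps_X * ?T))" by (simp add: T)
    also have "\<dots> = ?T * ((W c - ?T) - fps_X * ?T * (W c - ?T))" by (simp add: algebra_simps)
    also have "(W c - ?T) - fps_X * ?T * (W c - ?T) = fps_X * (U c - ?T) * W c"
    proof -
      have "W c - ?T = fps_X * (U c * W c) - fps_X * ?T\<^sup>2"
        using W[of c] catalan_fps_eq by (metis add_diff_cancel_left)
      then show ?thesis by (simp add: power2_eq_square algebra_simps)
    qed
    finally show ?thesis by (simp add: power2_eq_square algebra_simps)
  qed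
  have null: "((\<lambda>c. fps_nth (Y * (W c - ?T)) k) \<longlongrightarrow> 0) at_top" for Y :: "real fps"
  proof -
    have "((\<lambda>c. \<Sum>i=0..k. fps_nth Y i * (w c (k - i) - catalan (k - i))) \<longlongrightarrow>
        (\<Sum>i=0..k. fps_nth Y i * (catalan (k - i) - catalan (k - i)))) at_top"
      by (intro tendsto_intros w)
    then show ?thesis by (simp add: fps_mult_nth W_def)
  qed
  have "(\<lambda>c. a c * fps_nth (fps_X * ?T * A * (W c - ?T)) k + b c * fps_nth (fps_X * ?T * B * (W c - ?T)) k) \<in> o[at_top](e)"
    by (intro sum_in_smallo(1) bigo_times_null a b null)
  moreover have "a c * fps_nth (fps_X * ?T * A * (W c - ?T)) k + b c * fps_nth (fps_X * ?T * B * (W c - ?T)) k =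
      w c k - (catalan k + a c * fps_nth (fps_X * ?T\<^sup>2 * A) k + b c * fps_nth (fps_X * ?T\<^sup>2 * B) k)" for c
  proof -
    have "fps_X * ?T * ((U c - ?T) * (W c - ?T)) =
        fps_const (a c) * (fps_X * ?T * A * (W c - ?T)) + fps_const (b c) * (fps_X * ?T * B * (W c - ?T))"
      by (simp add: U algebra_simps)
    moreover have "fps_X * ?T\<^sup>2 * (U c - ?T) = fps_const (a c) * (fps_X * ?T\<^sup>2 * A) + fps_const (b c) * (fps_X * ?T\<^sup>2 * B)"
      by (simp add: U algebra_simps)
    ultimately have "W c - ?T - (fps_const (a c) * (fps_X * ?T\<^sup>2 * A) + fps_const (b c) * (fps_X * ?T\<^sup>2 * B)) =
       fps_const (a c) * (fps_X * ?T * A * (W c - ?T)) + fps_const (b c) * (fps_X * ?T * B * (W c - ?T))"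
      using diff[of c] by simp
    then have "fps_nth (W c - ?T - (fps_const (a c) * (fps_X * ?T\<^sup>2 * A) + fps_const (b c) * (fps_X * ?T\<^sup>2 * B))) k =
       fps_nth (fps_const (a c) * (fps_X * ?T * A * (W c - ?T)) + fps_const (b c) * (fps_X * ?T * B * (W c - ?T))) k"
      by simp
    then show ?thesis
      by (simp only: fps_sub_nth fps_add_nth fps_mult_left_const_nth) (simp add: W_def)
  qed
  ultimately show ?thesis by (simp add: w_def)
qed

text \<open>Three approximations are added: the first-order form of each composition term, the
  replacement of \<open>z c [i]\<close> by its expansion, and the geometric sum. Expansions are
  supplied for i < k, which covers the entries of all compositions of k. The law behind \<phi> may
  differ from the one behind z, so the root and the subtrees are both covered.\<close>

lemma walk_expansion_first_order:
  fixes A B :: "real fps"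
  assumes \<phi>1: "\<And>j. (\<lambda>c. \<phi> c j - (1 + g j * a c)) \<in> o[at_top](e)"
    and z: "\<And>ks. ((\<lambda>c. z c ks) \<longlongrightarrow> (\<Prod>k\<leftarrow>ks. catalan k)) at_top"
    and z1: "\<And>i. i < k \<Longrightarrow> (\<lambda>c. z c [i] - (catalan i + a c * fps_nth A i + b c * fps_nth B i)) \<in> o[at_top](e)"
  shows "(\<lambda>c. concat_sum (composition_term (\<phi> c) (z c) c) [k] -
      (catalan k
       + a c * fps_nth (fps_X * catalan_fps\<^sup>2 * A + fps_compose (Abs_fps g) (fps_X * catalan_fps)) k
       + b c * fps_nth (fps_X * catalan_fps\<^sup>2 * B + fps_compose choose2_fps (fps_X * catalan_fps)) k)) \<in> o[at_top](e)"
proof -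
  let ?u = "\<lambda>c i. catalan i + a c * fps_nth A i + b c * fps_nth B i"
  let ?P = "\<lambda>l. \<Prod>k\<leftarrow>l. catalan k"
  have u: "((\<lambda>c. ?u c i) \<longlongrightarrow> catalan i) at_top" for i
  proof -
    have "((\<lambda>c. ?u c i) \<longlongrightarrow> catalan i + 0 * fps_nth A i + 0 * fps_nth B i) at_top"
      by (intro tendsto_intros a0 b0)
    then show ?thesis by simp
  qed
  have T: "Abs_fps catalan = catalan_fps" by (rule fps_ext) simp
  have 1: "(\<lambda>c. \<Sum>l\<in>compositions k. composition_term (\<phi> c) (z c) c l -
      ((\<Prod>i\<leftarrow>l. z c [i]) + a c * (g (length l) * ?P l) + b c * (real (length l choose 2) * ?P l))) \<in> o[at_top](e)"
    by (intro smallo_sum composition_term_expansion \<phi>1 z)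
  have 2: "(\<lambda>c. \<Sum>l\<in>compositions k. (\<Prod>i\<leftarrow>l. z c [i]) - (\<Prod>i\<leftarrow>l. ?u c i)) \<in> o[at_top](e)"
    using z[of "[_]"]
    by (intro smallo_sum smallo_prod_list_diff[where L = catalan] z1 u compositions_elem_less) auto
  note 3 = geometric_expansion[where k = k and A = A and B = B]
  have 4: "(\<Sum>l\<in>compositions k. g (length l) * ?P l) = fps_nth (fps_compose (Abs_fps g) (fps_X * catalan_fps)) k"
    using sum_compositions_eq_compose[of g catalan k] by (simp add: T)
  have 5: "(\<Sum>l\<in>compositions k. real (length l choose 2) * ?P l) = fps_nth (fps_compose choose2_fps (fps_X * catalan_fps)) k"
    using sum_compositions_eq_compose[of "\<lambda>r. real (r choose 2)" catalan k] by (simp add: T choose2_fps_def)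
  have eq: "concat_sum (composition_term (\<phi> c) (z c) c) [k] -
      (catalan k
       + a c * fps_nth (fps_X * catalan_fps\<^sup>2 * A + fps_compose (Abs_fps g) (fps_X * catalan_fps)) k
       + b c * fps_nth (fps_X * catalan_fps\<^sup>2 * B + fps_compose choose2_fps (fps_X * catalan_fps)) k) =
    (\<Sum>l\<in>compositions k. composition_term (\<phi> c) (z c) c l -
      ((\<Prod>i\<leftarrow>l. z c [i]) + a c * (g (length l) * ?P l) + b c * (real (length l choose 2) * ?P l)))
    + (\<Sum>l\<in>compositions k. (\<Prod>i\<leftarrow>l. z c [i]) - (\<Prod>i\<leftarrow>l. ?u c i))
    + ((\<Sum>l\<in>compositions k. \<Prod>i\<leftarrow>l. ?u c i) -
      (catalan k + a c * fps_nth (fps_X * catalan_fps\<^sup>2 * A) k + b c * fps_nth (fps_X * catalan_fps\<^sup>2 * B) k))" for c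
    unfolding fps_add_nth 4[symmetric] 5[symmetric]
    by (simp add: sum_subtractf sum.distrib sum_distrib_left distrib_left)
  show ?thesis
    unfolding eq by (rule sum_in_smallo(1)[OF sum_in_smallo(1)[OF 1 2] 3])
qed

text \<open>With A and B solving the fixed-point equations, the expansion at k reproduces itself
  from those below k.\<close>

lemma moment_first_order:
  fixes A B :: "real fps"
  assumes \<phi>1: "\<And>j. (\<lambda>c. \<phi> c j - (1 + g j * a c)) \<in> o[at_top](e)"
    and eq: "\<And>ks. \<forall>\<^sub>F c in at_top. z c ks = concat_sum (composition_term (\<phi> c) (z c) c) ks"
    and z: "\<And>ks. ((\<lambda>c. z c ks) \<longlongrightarrow> (\<Prod>k\<leftarrow>ks. catalan k)) at_top"
    and A: "A = fps_X * catalan_fps\<^sup>2 * A + fps_compose (Abs_fps g) (fps_X * catalan_fps)"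
    and B: "B = fps_X * catalan_fps\<^sup>2 * B + fps_compose choose2_fps (fps_X * catalan_fps)"
  shows "(\<lambda>c. z c [k] - (catalan k + a c * fps_nth A k + b c * fps_nth B k)) \<in> o[at_top](e)"
proof (induction k rule: less_induct)
  case (less k)
  have S: "(\<lambda>c. concat_sum (composition_term (\<phi> c) (z c) c) [k] -
      (catalan k + a c * fps_nth A k + b c * fps_nth B k)) \<in> o[at_top](e)"
    using walk_expansion_first_order[where A = A and B = B and g = g and \<phi> = \<phi> and z = z and k = k, OF \<phi>1 z less]
    by (simp only: A[symmetric] B[symmetric])
  have ev: "\<forall>\<^sub>F c in at_top. concat_sum (composition_term (\<phi> c) (z c) c) [k] -
      (catalan k + a c * fps_nth A k + b c * fps_nth B k) = z c [k] - (catalan k + a c * fps_nth A k + b c * fps_nth B k)"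
    using eq[of "[k]"] by eventually_elim simp
  show ?case by (rule landau_o.small.in_cong[OF ev, THEN iffD1, OF S])
qed

end

section \<open>Identification of the limiting series\<close>

lemma fps_inverse_cancel:
  fixes D :: "real fps"
  assumes "fps_nth D 0 \<noteq> 0"
  shows "D * (G * inverse D) = G"
  using inverse_mult_eq_1[OF assms] by (metis mult.commute mult.left_commute mult.right_neutral)

lemma catalan_denominator: "fps_nth (1 - fps_X * catalan_fps\<^sup>2) 0 \<noteq> (0 :: real)"
  by simp

text \<open>Solves A = x T^2 A + G(x T) with G the series of f (r + 1); the shifted index comes from
  the factorial moments of the size-biased law.\<close>

definition correction_fps :: "(nat \<Rightarrow> real) \<Rightarrow> real fps" where
  "correction_fps f = fps_compose (Abs_fps (\<lambda>r. f (Suc r))) (fps_X * catalan_fps)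
      * inverse (1 - fps_X * catalan_fps\<^sup>2)"

lemma correction_fps_eq:
  "correction_fps f = fps_X * catalan_fps\<^sup>2 * correction_fps f
     + fps_compose (Abs_fps (\<lambda>r. f (Suc r))) (fps_X * catalan_fps)"
  using fps_inverse_cancel[OF catalan_denominator, of "fps_compose (Abs_fps (\<lambda>r. f (Suc r))) (fps_X * catalan_fps)"]
  unfolding correction_fps_def[symmetric] by (simp add: algebra_simps)

text \<open>Since f 0 = 0, F(xT) = xT G(xT). Multiplying by 1 - x T^2 leaves xT G(xT) (T + 1 - x
  T^2), and the bracket is 2 by the Catalan equation: this is the origin of the factor 2 in the
  moment series.\<close>

lemma root_correction_fps:
  assumes "f 0 = 0"
  shows "fps_X * catalan_fps\<^sup>2 * correction_fps f + fps_compose (Abs_fps f) (fps_X * catalan_fps) =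
    2 * fps_compose (Abs_fps f) (fps_X * catalan_fps) / (1 - fps_X * catalan_fps\<^sup>2)"
proof -
  let ?y = "fps_X * catalan_fps" and ?D = "1 - fps_X * catalan_fps\<^sup>2"
  let ?G = "fps_compose (Abs_fps (\<lambda>r. f (Suc r))) ?y" and ?F = "fps_compose (Abs_fps f) ?y"
  have "Abs_fps f = fps_X * Abs_fps (\<lambda>r. f (Suc r))"
  proof (rule fps_ext)
    show "fps_nth (Abs_fps f) n = fps_nth (fps_X * Abs_fps (\<lambda>r. f (Suc r))) n" for n
      using assms by (cases n) simp_all
  qed
  then have F: "?F = ?y * ?G"
    by (simp add: fps_compose_mult_distrib fps_X_fps_compose_startby0)
  have A: "?D * correction_fps f = ?G"
    unfolding correction_fps_def by (rule fps_inverse_cancel[OF catalan_denominator])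
  have "?D * (fps_X * catalan_fps\<^sup>2 * correction_fps f + ?F) = fps_X * catalan_fps\<^sup>2 * ?G + ?D * ?F"
    unfolding A[symmetric] by (simp add: algebra_simps)
  also have "\<dots> = ?y * ?G * (catalan_fps + 1 - fps_X * catalan_fps\<^sup>2)"
    unfolding F by (simp add: power2_eq_square algebra_simps)
  also have "catalan_fps + 1 - fps_X * catalan_fps\<^sup>2 = (2 :: real fps)"
    using catalan_fps_eq by (metis add_diff_cancel_right' add_diff_eq diff_add_cancel one_add_one add.commute)
  also have "?y * ?G * 2 = 2 * ?F" unfolding F by (rule mult.commute)
  finally have *: "2 * ?F = ?D * (fps_X * catalan_fps\<^sup>2 * correction_fps f + ?F)" by simp
  have "2 * ?F / ?D = ?D * (fps_X * catalan_fps\<^sup>2 * correction_fps f + ?F) * inverse ?D"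
    unfolding * by (rule fps_divide_unit[OF catalan_denominator])
  also have "\<dots> = fps_X * catalan_fps\<^sup>2 * correction_fps f + ?F"
    using fps_inverse_cancel[OF catalan_denominator] by (simp only: mult.assoc)
  finally show ?thesis by simp
qed

text \<open>Substitute xT into x^2 / (1 - x)^3 and use 1 / (1 - xT) = T.\<close>

lemma choose2_compose_catalan:
  "fps_compose choose2_fps (fps_X * catalan_fps) = fps_X\<^sup>2 * catalan_fps ^ 5"
proof -
  let ?y = "fps_X * catalan_fps" and ?one = "Abs_fps (\<lambda>_. 1 :: real)" and ?id = "Abs_fps (\<lambda>r. real r)"
  have y0: "fps_nth ?y 0 = 0" by simp
  have 1: "(1 - fps_X) * choose2_fps = fps_X * ?id"
  proof (rule fps_ext)
    show "fps_nth ((1 - fps_X) * choose2_fps) n = fps_nth (fps_X * ?id) n" for n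
      by (cases n) (simp_all add: choose2_fps_def left_diff_distrib numeral_2_eq_2)
  qed
  have 2: "(1 - fps_X) * ?id = fps_X * ?one"
  proof (rule fps_ext)
    show "fps_nth ((1 - fps_X) * ?id) n = fps_nth (fps_X * ?one) n" for n
      by (cases n) (simp_all add: left_diff_distrib)
  qed
  have 3: "(1 - fps_X) * ?one = 1"
  proof (rule fps_ext)
    show "fps_nth ((1 - fps_X) * ?one) n = fps_nth 1 n" for n
      by (cases n) (simp_all add: left_diff_distrib)
  qed
  have "(1 - fps_X) ^ 3 * choose2_fps = (1 - fps_X)\<^sup>2 * ((1 - fps_X) * choose2_fps)"
    by (simp add: power3_eq_cube power2_eq_square mult.assoc)
  also have "\<dots> = (1 - fps_X) * fps_X * ((1 - fps_X) * ?id)"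
    unfolding 1 by (simp add: power2_eq_square mult_ac)
  also have "\<dots> = fps_X\<^sup>2 * ((1 - fps_X) * ?one)"
    unfolding 2 by (simp add: power2_eq_square mult_ac)
  finally have "(1 - fps_X) ^ 3 * choose2_fps = fps_X\<^sup>2" by (simp add: 3)
  then have "fps_compose ((1 - fps_X) ^ 3 * choose2_fps) ?y = fps_compose (fps_X\<^sup>2) ?y" by simp
  then have c: "(1 - ?y) ^ 3 * fps_compose choose2_fps ?y = ?y\<^sup>2"
    by (simp add: fps_compose_mult_distrib[OF y0] fps_compose_power[OF y0, symmetric] fps_compose_sub_distrib
        fps_X_fps_compose_startby0[OF y0])
  have T: "catalan_fps * (1 - ?y) = 1"
    using catalan_fps_eq by (simp add: power2_eq_square algebra_simps)
  have "fps_compose choose2_fps ?y = (catalan_fps * (1 - ?y)) ^ 3 * fps_compose choose2_fps ?y" by (simp add: T)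
  also have "\<dots> = catalan_fps ^ 3 * ((1 - ?y) ^ 3 * fps_compose choose2_fps ?y)"
    by (simp add: power_mult_distrib mult.assoc)
  also have "\<dots> = fps_X\<^sup>2 * catalan_fps ^ 5"
    unfolding c by (simp add: power_mult_distrib eval_nat_numeral mult_ac)
  finally show ?thesis .
qed

text \<open>Follows from the closed form x^2 T^4 C and T = (1 - x T^2) C. The 1/c term comes from
  partition counts, which are the same at the root and below, so this one equation governs both, and
  its solution is the moment series of \<open>sigma1\<close>.\<close>

lemma sigma1_fps_fixpoint:
  "sigma1_fps = fps_X * catalan_fps\<^sup>2 * sigma1_fps + fps_compose choose2_fps (fps_X * catalan_fps)"
proof -
  let ?x = "fps_X :: real fps" and ?T = catalan_fps and ?C = central_fps
  have 1: "?T * (1 - 2 * ?x * ?T) = 1 - ?x * ?T\<^sup>2"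
    using catalan_fps_eq by (simp add: power2_eq_square algebra_simps) 
  have "?T = ?T * ((1 - 2 * ?x * ?T) * ?C)" by (simp add: central_fps_inverse)
  also have "\<dots> = (1 - ?x * ?T\<^sup>2) * ?C" by (simp only: mult.assoc[symmetric] 1)
  finally have T: "?T = (1 - ?x * ?T\<^sup>2) * ?C" .
  have "?x\<^sup>2 * ?T ^ 5 = ?x\<^sup>2 * ?T ^ 4 * ?T" by (simp add: eval_nat_numeral mult_ac)
  also have "\<dots> = ?x\<^sup>2 * ?T ^ 4 * ((1 - ?x * ?T\<^sup>2) * ?C)" using T by simp
  also have "\<dots> = (1 - ?x * ?T\<^sup>2) * sigma1_fps" by (simp add: sigma1_fps_eq mult_ac)
  finally show ?thesis unfolding choose2_compose_catalan by (simp add: algebra_simps)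
qed

section \<open>Moments of the limiting measures\<close>

lemma semicircle_has_moment: "has_moment semicircle k (if even k then catalan (k div 2) else 0)"
proof (cases "even k")
  case True
  then obtain i where k: "k = 2 * i" by auto
  define X Y where "X = real ((2 * Suc i) choose (Suc i))" and "Y = real ((2 * i) choose i)"
  have "arc_moment k = pi * Y" "arc_moment (k + 2) = pi * X"
    using k by (simp_all add: arc_moment_def X_def Y_def)
  moreover have "real (Suc i) * X = 2 * (2 * real i + 1) * Y"
    unfolding X_def Y_def by (rule central_binomial_Suc)
  then have "(4 * Y - X) / 2 = 1 / real (i + 1) * Y" by (simp add: field_simps)
  moreover have "(4 * (pi * Y) - pi * X) / (2 * pi) = (4 * Y - X) / 2" by (simp add: field_simps)
  ultimately have "(4 * arc_moment k - arc_moment (k + 2)) / (2 * pi) = 1 / real (i + 1) * Y"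
    by (simp only:)
  then show ?thesis
    using semicircle_moment[of k] k by (simp add: catalan_fps_def Y_def)
next
  case False
  then show ?thesis using semicircle_moment[of k] by (simp add: arc_moment_def)
qed

lemma arc_moment_even: "arc_moment (2 * j) = pi * real ((2 * j) choose j)"
  by (simp add: arc_moment_def)

lemma sigma1_has_moment: "has_moment sigma1 k (if even k then fps_nth sigma1_fps (k div 2) else 0)"
proof (cases "even k")
  case True
  then obtain i where k: "k = 2 * i" by auto
  define X Y Z where "X = real ((2 * (i + 2)) choose (i + 2))" and "Y = real ((2 * (i + 1)) choose (i + 1))"
    and "Z = real ((2 * i) choose i)"
  have "arc_moment k = pi * Z" "arc_moment (k + 2) = pi * Y" "arc_moment (k + 4) = pi * X"
  proof -
    have "k + 2 = 2 * (i + 1)" "k + 4 = 2 * (i + 2)" using k by simp_all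
    then show "arc_moment k = pi * Z" "arc_moment (k + 2) = pi * Y" "arc_moment (k + 4) = pi * X"
      by (simp_all only: arc_moment_even X_def Y_def Z_def k)
  qed
  then have "(arc_moment (k + 4) - 4 * arc_moment (k + 2) + 2 * arc_moment k) / (2 * pi) = (X - 4 * Y + 2 * Z) / 2"
    by (simp add: field_simps)
  moreover have "fps_nth sigma1_fps i = (X - 4 * Y + 2 * Z) / 2"
    by (simp only: sigma1_fps_def fps_nth_Abs_fps X_def Y_def Z_def)
  ultimately have "(arc_moment (k + 4) - 4 * arc_moment (k + 2) + 2 * arc_moment k) / (2 * pi) = fps_nth sigma1_fps i"
    by (simp only:)
  with sigma1_moment[of k] have "has_moment sigma1 k (fps_nth sigma1_fps i)" by (simp only:)
  then show ?thesis using k by simp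
next
  case False
  then show ?thesis using sigma1_moment[of k] by (simp add: arc_moment_def)
qed

lemma has_moment_0: "has_moment \<nu> 0 m \<Longrightarrow> m = \<nu> UNIV"
proof -
  assume "has_moment \<nu> 0 m"
  then obtain P N where "sets P = sets borel" "sets N = sets borel"
    "\<forall>B\<in>sets borel. \<nu> B = measure P B - measure N B" "m = (LINT x|P. x ^ 0) - (LINT x|N. x ^ 0)"
    unfolding has_moment_def by blast
  moreover from this have "space P = UNIV" "space N = UNIV" by (metis sets_eq_imp_space_eq space_borel)+
  ultimately show "m = \<nu> UNIV" by simp
qed

text \<open>Any real sequence can be prescribed as moments; the total mass is the constant
  coefficient 2 f 0 = 0 of the series.\<close>

lemma exists_sigma_f1:
  assumes "f 0 = 0"
  shows "\<exists>\<sigma>f. is_sigma_f1 f \<sigma>f"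
proof -
  define G where "G = 2 * fps_compose (Abs_fps f) (fps_X * catalan_fps) / (1 - fps_X * catalan_fps\<^sup>2)"
  obtain \<nu> where \<nu>: "signed_measure \<nu>" "\<And>k. has_moment \<nu> k (if even k then fps_nth G (k div 2) else 0)"
    using exists_signed_measure_with_moments[of "\<lambda>k. if even k then fps_nth G (k div 2) else 0"] by blast
  have m: "moment \<nu> k = (if even k then fps_nth G (k div 2) else 0)" for k
    by (rule moment_eqI[OF \<nu>(2)])
  have "fps_nth G 0 = 0"
    using assms by (simp add: G_def fps_divide_unit numeral_fps_const)
  then have "\<nu> UNIV = 0" using has_moment_0[OF \<nu>(2)[of 0]] by simp
  moreover have "Abs_fps (\<lambda>k. moment \<nu> (2 * k)) = G" by (rule fps_ext) (simp add: m)
  ultimately show ?thesis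
    unfolding is_sigma_f1_def using \<nu> m by (intro exI[of _ \<nu>]) (auto simp: G_def)
qed

text \<open>The closed form of the series is traded for the expression that the expansion at the
  root produces.\<close>

lemma combined_has_moment:
  assumes \<sigma>f: "is_sigma_f1 f \<sigma>f" and "c > 0" "f 0 = 0"
  shows "moment (\<lambda>B. semicircle B + 1 / c powr \<alpha> * \<sigma>f B + 1 / c * sigma1 B) k =
    (if even k then catalan (k div 2)
       + 1 / c powr \<alpha> * fps_nth (fps_X * catalan_fps\<^sup>2 * correction_fps f
          + fps_compose (Abs_fps f) (fps_X * catalan_fps)) (k div 2)
       + 1 / c * fps_nth sigma1_fps (k div 2) else 0)"
proof -
  obtain m where m: "has_moment \<sigma>f k m" using \<sigma>f unfolding is_sigma_f1_def by blast
  have mm: "moment \<sigma>f k = m" by (rule moment_eqI[OF m])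
  have "moment (\<lambda>B. semicircle B + 1 / c powr \<alpha> * \<sigma>f B + 1 / c * sigma1 B) k =
      (if even k then catalan (k div 2) else 0) + 1 / c powr \<alpha> * m
      + 1 / c * (if even k then fps_nth sigma1_fps (k div 2) else 0)"
    using assms(2)
    by (intro moment_eqI has_moment_add has_moment_scale semicircle_has_moment sigma1_has_moment m) auto
  moreover have "m = 0" if "odd k" using \<sigma>f mm that unfolding is_sigma_f1_def by blast
  moreover have "m = fps_nth (fps_X * catalan_fps\<^sup>2 * correction_fps f
          + fps_compose (Abs_fps f) (fps_X * catalan_fps)) (k div 2)" if "even k"
  proof -
    have "Abs_fps (\<lambda>k. moment \<sigma>f (2 * k)) = fps_X * catalan_fps\<^sup>2 * correction_fps f
          + fps_compose (Abs_fps f) (fps_X * catalan_fps)"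
      unfolding root_correction_fps[of f, OF assms(3)] using \<sigma>f unfolding is_sigma_f1_def by blast
    then have "moment \<sigma>f (2 * (k div 2)) = fps_nth (fps_X * catalan_fps\<^sup>2 * correction_fps f
          + fps_compose (Abs_fps f) (fps_X * catalan_fps)) (k div 2)"
      by (metis fps_nth_Abs_fps)
    then show ?thesis using that mm by simp
  qed
  ultimately show ?thesis by simp
qed

theorem theorem2:
  fixes p :: "real \<Rightarrow> nat pmf" and \<mu> :: "real \<Rightarrow> real measure"
    and \<alpha> :: real and f :: "nat \<Rightarrow> real"
  assumes mean: "\<And>c. c > 0 \<Longrightarrow> pmf_mean (p c) = c"
    and alpha: "\<alpha> > 0"
    and factorial_moments: "\<And>k.
      (\<lambda>c. measure_pmf.expectation (p c) (\<lambda>n. \<Prod>i<k. real n - real i) / c ^ k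
             - (1 + f k / c powr \<alpha>))
        \<in> o[at_top](\<lambda>c. 1 / c powr \<alpha>)"
    and mu: "\<forall>\<^sub>F c in at_top. is_UGW_spectral_measure (p c) (\<mu> c)"
  shows "(\<exists>\<sigma>f. is_sigma_f1 f \<sigma>f) \<and>
    (\<forall>\<sigma>f. is_sigma_f1 f \<sigma>f \<longrightarrow>
      (\<forall>k::nat.
        (\<forall>\<^sub>F c in at_top. integrable (\<mu> c) (\<lambda>x. x ^ k)) \<and>
        (\<lambda>c. (LINT x|\<mu> c. x ^ k)
               - moment (\<lambda>B. semicircle B + 1 / c powr \<alpha> * \<sigma>f B + 1 / c * sigma1 B) k)
          \<in> o[at_top](\<lambda>c. 1 / c powr min 1 \<alpha>)))"
proof -
  define e where "e = (\<lambda>c::real. 1 / c powr min 1 \<alpha>)"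
  define a where "a = (\<lambda>c::real. 1 / c powr \<alpha>)"
  define b where "b = (\<lambda>c::real. 1 / c)"
  define q where "q c = size_biased (p c)" for c
  define \<phi>p where "\<phi>p c j = real_factorial_moment (p c) j / c ^ j" for c j
  define \<phi> where "\<phi> c j = real_factorial_moment (q c) j / c ^ j" for c j
  define z where "z c ks = real_walk_moment (q c) ks / c ^ sum_list ks" for c ks
  have powr_lim: "((\<lambda>c::real. 1 / c powr r) \<longlongrightarrow> 0) at_top" if "r > 0" for r :: real
    using tendsto_neg_powr[OF _ filterlim_ident, of "- r"] that by (simp add: powr_minus_divide)
  have e0: "(e \<longlongrightarrow> 0) at_top" and a0: "(a \<longlongrightarrow> 0) at_top"
    unfolding e_def a_def using alpha by (auto intro!: powr_lim)
  have bigo: "(\<lambda>c. 1 / c powr r) \<in> O[at_top](e)" if "min 1 \<alpha> \<le> r" for r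
  proof (rule bigoI)
    show "\<forall>\<^sub>F c in at_top. norm (1 / c powr r) \<le> 1 * norm (e c)"
      using eventually_ge_at_top[of 1]
    proof eventually_elim
      case (elim c)
      then have "c powr min 1 \<alpha> \<le> c powr r" by (intro powr_mono that) auto
      then show ?case using elim by (simp add: e_def frac_le)
    qed
  qed
  have a: "a \<in> O[at_top](e)" unfolding a_def by (rule bigo) simp
  have b: "b \<in> O[at_top](e)"
  proof -
    have "\<forall>\<^sub>F c in at_top. 1 / c powr 1 = b c"
      using eventually_gt_at_top[of 0] by eventually_elim (simp add: b_def)
    then show ?thesis using bigo[of 1] landau_o.big.in_cong by fastforce
  qed
  \<comment> \<open>The factorial moment of order 0 is 1, so the hypothesis for k = 0 says that the
    constant f 0 is o(1).\<close>
  have f0: "f 0 = 0"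
  proof (rule ccontr)
    assume "f 0 \<noteq> 0"
    then have "\<forall>\<^sub>F c in at_top. norm (1 - (1 + f 0 / c powr \<alpha>)) \<le> \<bar>f 0\<bar> / 2 * norm (1 / c powr \<alpha>)"
      using landau_o.smallD[OF factorial_moments[of 0], of "\<bar>f 0\<bar> / 2"] by simp
    then have "\<forall>\<^sub>F c :: real in at_top. False"
      using eventually_gt_at_top[of 0]
    proof eventually_elim
      case (elim c)
      then have "c powr \<alpha> > 0" by simp
      then show ?case using elim \<open>f 0 \<noteq> 0\<close> by (simp add: abs_mult field_simps)
    qed
    then show False by simp
  qed
  have \<phi>p1: "(\<lambda>c. \<phi>p c j - (1 + f j * a c)) \<in> o[at_top](e)" for j
  proof -
    have "(\<lambda>c. \<phi>p c j - (1 + f j * a c)) \<in> o[at_top](a)"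
      using factorial_moments[of j] by (simp add: \<phi>p_def a_def expectation_falling_factorial)
    then show ?thesis using a by (rule landau_o.small_big_trans)
  qed
  have \<phi>p: "((\<lambda>c. \<phi>p c j) \<longlongrightarrow> 1) at_top" for j
  proof -
    have "((\<lambda>c. (\<phi>p c j - (1 + f j * a c)) + (1 + f j * a c)) \<longlongrightarrow> 0 + (1 + f j * 0)) at_top"
      by (intro tendsto_intros a0 tendsto_of_smallo_bounded[OF \<phi>p1 e0])
    then show ?thesis by simp
  qed
  \<comment> \<open>A normalized moment tending to 1 is eventually nonzero, whereas an infinite
    factorial moment would have been recorded as 0.\<close>
  have fin: "\<forall>\<^sub>F c in at_top. \<forall>j\<in>{..K}. factorial_moment (p c) j < \<top>" for K
  proof (intro eventually_ball_finite ballI)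
    fix j
    have "\<forall>\<^sub>F c in at_top. \<phi>p c j > 0" by (rule order_tendstoD(1)[OF \<phi>p]) simp
    then show "\<forall>\<^sub>F c in at_top. factorial_moment (p c) j < \<top>"
      by eventually_elim (rule factorial_moment_finite, auto simp: \<phi>p_def)
  qed simp
  \<comment> \<open>Size-biasing turns the moment of order j + 1 into that of order j and divides it
    by c, which is exactly the change from c^(j+1) to c^j in the normalization; hence index j
    inherits f (j + 1).\<close>
  have \<phi>1: "(\<lambda>c. \<phi> c j - (1 + f (Suc j) * a c)) \<in> o[at_top](e)" for j
  proof -
    have ev: "\<forall>\<^sub>F c in at_top. \<phi>p c (Suc j) - (1 + f (Suc j) * a c) = \<phi> c j - (1 + f (Suc j) * a c)"
      using fin[of "Suc j"] eventually_gt_at_top[of 0]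
    proof eventually_elim
      case (elim c)
      then have "real_factorial_moment (q c) j = real_factorial_moment (p c) (Suc j) / c"
        unfolding q_def using real_factorial_moment_size_biased(2)[of "p c" j] mean[of c] by simp
      then show ?case by (simp add: \<phi>_def \<phi>p_def)
    qed
    show ?thesis by (rule landau_o.small.in_cong[OF ev, THEN iffD1, OF \<phi>p1])
  qed
  have \<phi>: "((\<lambda>c. \<phi> c j) \<longlongrightarrow> 1) at_top" for j
  proof -
    have "((\<lambda>c. (\<phi> c j - (1 + f (Suc j) * a c)) + (1 + f (Suc j) * a c)) \<longlongrightarrow> 0 + (1 + f (Suc j) * 0)) at_top"
      by (intro tendsto_intros a0 tendsto_of_smallo_bounded[OF \<phi>1 e0])
    then show ?thesis by simp
  qed
  have finq: "\<forall>\<^sub>F c in at_top. \<forall>j\<le>K. factorial_moment (q c) j < \<top>" for K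
    using fin[of "Suc K"] eventually_gt_at_top[of 0]
  proof eventually_elim
    case (elim c)
    then show ?case
      unfolding q_def using real_factorial_moment_size_biased(1)[of "p c"] mean[of c] by auto
  qed
  have scale: "walk_expansion F (real_walk_moment (q c)) ks =
      c ^ sum_list ks * concat_sum (composition_term (\<lambda>j. F j / c ^ j) (z c) c) ks" if "c > 0" for F c ks
  proof -
    have "(\<lambda>j. c ^ j * (F j / c ^ j)) = F" "(\<lambda>b. c ^ sum_list b * z c b) = real_walk_moment (q c)"
      using that by (auto simp: z_def)
    then show ?thesis using walk_expansion_scale[OF that, of "\<lambda>j. F j / c ^ j" "z c" ks] by simp
  qed
  have eq: "\<forall>\<^sub>F c in at_top. z c ks = concat_sum (composition_term (\<phi> c) (z c) c) ks" for ks
    using finq[of "sum_list ks"] eventually_gt_at_top[of 0]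
  proof eventually_elim
    case (elim c)
    have "real_walk_moment (q c) ks = walk_expansion (real_factorial_moment (q c)) (real_walk_moment (q c)) ks"
      using elim by (intro real_walk_moment_eq[of "sum_list ks"]) auto
    also have "\<dots> = c ^ sum_list ks * concat_sum (composition_term (\<phi> c) (z c) c) ks"
      unfolding \<phi>_def using elim by (intro scale)
    finally show ?case using elim by (simp add: z_def)
  qed
  have zlim: "((\<lambda>c. z c ks) \<longlongrightarrow> (\<Prod>k\<leftarrow>ks. catalan k)) at_top" for ks
    by (rule tendsto_normalized_moment[OF \<phi> eq]) (simp add: z_def real_walk_moment_def)
  have z1: "(\<lambda>c. z c [i] - (catalan i + a c * fps_nth (correction_fps f) i + b c * fps_nth sigma1_fps i)) \<in> o[at_top](e)" for i
    by (rule moment_first_order[OF e0 a a0 b b_def \<phi>1 eq zlim correction_fps_eq sigma1_fps_fixpoint])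
  \<comment> \<open>At the root the factorial moments are those of p, hence f is unshifted, whereas
    the subtrees keep z. The b-coefficient reproduces the fixed point
    \<open>sigma1_fps\<close>.\<close>
  have root: "(\<lambda>c. concat_sum (composition_term (\<phi>p c) (z c) c) [i] - (catalan i
       + a c * fps_nth (fps_X * catalan_fps\<^sup>2 * correction_fps f + fps_compose (Abs_fps f) (fps_X * catalan_fps)) i
       + b c * fps_nth sigma1_fps i)) \<in> o[at_top](e)" for i
    using walk_expansion_first_order[where \<phi> = \<phi>p and g = f and z = z and k = i
        and A = "correction_fps f" and B = sigma1_fps, OF e0 a a0 b b_def \<phi>p1 zlim z1]
    by (simp only: sigma1_fps_fixpoint[symmetric])
  define L where "L c i = walk_expansion (real_factorial_moment (p c)) (real_walk_moment (q c)) [i]" for c i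
  have L0: "L c i \<ge> 0" for c i
    unfolding L_def by (rule walk_expansion_nonneg) (simp_all add: real_factorial_moment_def real_walk_moment_def)
  have hwL: "\<forall>\<^sub>F c in at_top. (\<integral>\<^sup>+N. hw i N \<partial>gw (p c) (size_biased (p c))) = ennreal (L c i)" for i
    using fin[of i] finq[of i]
  proof eventually_elim
    case (elim c)
    then show ?case
      using nn_integral_hw_prod_real[of i "q c" "p c" "[i]"] by (simp add: L_def q_def)
  qed
  have main: "(\<forall>\<^sub>F c in at_top. integrable (\<mu> c) (\<lambda>x. x ^ k)) \<and>
        (\<lambda>c. (LINT x|\<mu> c. x ^ k)
               - moment (\<lambda>B. semicircle B + 1 / c powr \<alpha> * \<sigma>f B + 1 / c * sigma1 B) k) \<in> o[at_top](e)"
    if \<sigma>f: "is_sigma_f1 f \<sigma>f" for \<sigma>f k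
  proof (cases "even k")
    case True
    then obtain i where k: "k = 2 * i" by auto
    have ev: "\<forall>\<^sub>F c in at_top. integrable (\<mu> c) (\<lambda>x. x ^ k) \<and>
       concat_sum (composition_term (\<phi>p c) (z c) c) [i] - (catalan i
       + a c * fps_nth (fps_X * catalan_fps\<^sup>2 * correction_fps f + fps_compose (Abs_fps f) (fps_X * catalan_fps)) i
       + b c * fps_nth sigma1_fps i) =
       (LINT x|\<mu> c. x ^ k)
               - moment (\<lambda>B. semicircle B + 1 / c powr \<alpha> * \<sigma>f B + 1 / c * sigma1 B) k"
      using mu hwL[of i] eventually_gt_at_top[of 0]
    proof eventually_elim
      case (elim c)
      have s: "(c powr (- 1 / 2)) ^ (2 * i) = 1 / c ^ i"
      proof -
        have "(c powr (- 1 / 2)) ^ (2 * i) = ((c powr (- 1 / 2))\<^sup>2) ^ i" by (simp add: power_mult)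
        also have "(c powr (- 1 / 2))\<^sup>2 = c powr (- 1)"
          using elim by (simp add: power2_eq_square powr_add[symmetric])
        also have "\<dots> = 1 / c" using elim by (simp add: powr_minus_divide)
        finally show ?thesis by (simp add: power_one_over)
      qed
      have "L c i = c ^ i * concat_sum (composition_term (\<phi>p c) (z c) c) [i]"
        unfolding L_def \<phi>p_def using scale[of c "real_factorial_moment (p c)" "[i]"] elim by simp
      then have "concat_sum (composition_term (\<phi>p c) (z c) c) [i] = (c powr (- 1 / 2)) ^ (2 * i) * L c i"
        using elim unfolding s by simp
      then show ?case
        using spectral_measure_even_moment[OF elim(1,2) L0] mean[of c] elim
          combined_has_moment[OF \<sigma>f, of c \<alpha> k] f0 k
        by (simp add: a_def b_def)
    qed
    have ev2: "\<forall>\<^sub>F c in at_top. concat_sum (composition_term (\<phi>p c) (z c) c) [i] - (catalan i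
       + a c * fps_nth (fps_X * catalan_fps\<^sup>2 * correction_fps f + fps_compose (Abs_fps f) (fps_X * catalan_fps)) i
       + b c * fps_nth sigma1_fps i) =
       (LINT x|\<mu> c. x ^ k)
               - moment (\<lambda>B. semicircle B + 1 / c powr \<alpha> * \<sigma>f B + 1 / c * sigma1 B) k"
      using ev by (rule eventually_mono) blast
    show ?thesis
      using landau_o.small.in_cong[OF ev2, THEN iffD1, OF root] ev by (auto elim: eventually_mono)
  next
    case False
    then obtain i where k: "k = 2 * i + 1" by (auto elim: oddE)
    \<comment> \<open>The moment of order 2i + 1 is dominated through the walk count of index i + 1,
      hence the use of \<open>Suc i\<close>.\<close>
    have ev: "\<forall>\<^sub>F c in at_top. integrable (\<mu> c) (\<lambda>x. x ^ k) \<and> 0 = (LINT x|\<mu> c. x ^ k)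
               - moment (\<lambda>B. semicircle B + 1 / c powr \<alpha> * \<sigma>f B + 1 / c * sigma1 B) k"
      using mu hwL[of "Suc i"] eventually_gt_at_top[of 0]
    proof eventually_elim
      case (elim c)
      show ?case
        using spectral_measure_odd_moment[OF elim(1,2) L0]
          combined_has_moment[OF \<sigma>f elim(3) f0, of \<alpha> k] False unfolding k by simp
    qed
    have ev2: "\<forall>\<^sub>F c in at_top. 0 = (LINT x|\<mu> c. x ^ k)
               - moment (\<lambda>B. semicircle B + 1 / c powr \<alpha> * \<sigma>f B + 1 / c * sigma1 B) k"
      using ev by (rule eventually_mono) blast
    have "(\<lambda>c. 0) \<in> o[at_top](e)" by simp
    from landau_o.small.in_cong[OF ev2, THEN iffD1, OF this] show ?thesis
      using ev by (auto elim: eventually_mono)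
  qed
  then show ?thesis using exists_sigma_f1[of f, OF f0] unfolding e_def by blast
qed

end
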